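(* Let $G$ be a second countable compact group and let $\{F_n\}_{n=1}^\infty$ be a Følner sequence for $\widehat{G}$. Then for all $f\in C(G)$, $$\lim_{n\to\infty}\|\varphi'_{F_n}\circ\varphi_{F_n}(f)-f\|_\infty=0.$$
   Context: $\widehat{G}$ is a fixed transversal of the equivalence classes of irreducible unitary representations of $G$. For $\pi\in\widehat{G}$, $d(\pi)=\dim\pi$, and $\pi(g)=(\pi_{ij}(g))_{i,j}$ is its matrix form with respect to a fixed orthonormal basis. For $\pi,\sigma,\mu\in\widehat{G}$, $N_{\pi,\sigma}^{\mu}=\dim\mathrm{Hom}_G(\mu,\pi\otimes\sigma)$. The normalized Haar measure is used. The functions $\sqrt{d(\pi)}\pi_{ij}$ ($\pi\in\widehat{G}$, $1\le i,j\le d(\pi)$) form a complete orthonormal system of $L^2(G)$; let $E_{\sqrt{d(\pi)}\pi_{ij},\sqrt{d(\sigma)}\sigma_{kl}}\in\mathbb{B}(L^2(G))$ denote the corresponding matrix units ($E_{a,b}$ maps $b$ to $a$ and kills the other basis vectors). For $f\in C(G)$, $M_f\in\mathbb{B}(L^2(G))$ is multiplication by $f$. For a (non-empty) finite subset $F\subset\widehat{G}$ put $w(F)=\sum_{\pi\in F}d(\pi)^2$, let $P_F=\sum_{\pi\in F}\sum_{i,j}E_{\sqrt{d(\pi)}\pi_{ij},\sqrt{d(\pi)}\pi_{ij}}$, and define unital completely positive maps $\varphi_F:C(G)\to\mathbb{B}(P_FL^2(G))$, $\varphi_F(f)=P_FM_fP_F$, and $\varphi'_F:\mathbb{B}(P_FL^2(G))\to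 C(G)$, $$\varphi'_F(E_{\sqrt{d(\pi)}\pi_{ij},\sqrt{d(\sigma)}\sigma_{kl}})=\frac{1}{w(F)}\sqrt{d(\pi)d(\sigma)}\,\pi_{ij}\overline{\sigma_{kl}}\qquad(\pi,\sigma\in F).$$ A sequence $\{F_n\}_{n=1}^\infty$ of (non-empty) finite subsets of $\widehat{G}$ is a Følner sequence if for every $\pi\in\widehat{G}$, $$\lim_{n\to\infty}\frac{1}{w(F_n)}\left(\sum_{\sigma\in F_n}\sum_{\mu\in F_n^c}\frac{d(\sigma)d(\mu)}{d(\pi)}N_{\pi,\mu}^{\sigma}+\sum_{\sigma\in F_n^c}\sum_{\mu\in F_n}\frac{d(\sigma)d(\mu)}{d(\pi)}N_{\pi,\mu}^{\sigma}\right)=0,$$ where $F_n^c=\widehat{G}\setminus F_n$. *)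

theory Defs
  imports
    "HOL-Probability.Probability"
    "Jordan_Normal_Form.Schur_Decomposition"
    "Jordan_Normal_Form.VS_Connect"
begin

text \<open>
  Groups are types of class \<^class>\<open>topological_group_add\<close>. The library writes their operation as
  \<open>+\<close>, but \<^class>\<open>group_add\<close> does not assume commutativity. A unitary representation of dimension
  \<open>d\<close> is given in matrix form, so that the choice of an orthonormal basis is part of the
  representation; irreducible unitary representations of a compact group are finite-dimensional.
\<close>

definition haar_prob :: "'g::topological_group_add measure \<Rightarrow> bool" where
  "haar_prob \<mu> \<longleftrightarrow> prob_space \<mu> \<and> sets \<mu> = sets borel \<and> (\<forall>a. distr \<mu> borel (\<lambda>x. a + x) = \<mu>)"

definition unitary_mat :: "nat \<Rightarrow> complex mat \<Rightarrow> bool" where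
  "unitary_mat d U \<longleftrightarrow>
     U \<in> carrier_mat d d \<and> U * mat_adjoint U = 1\<^sub>m d \<and> mat_adjoint U * U = 1\<^sub>m d"

definition rdim :: "('g::topological_group_add \<Rightarrow> complex mat) \<Rightarrow> nat" where
  "rdim \<pi> = dim_row (\<pi> 0)"

definition unitary_rep :: "('g::topological_group_add \<Rightarrow> complex mat) \<Rightarrow> bool" where
  "unitary_rep \<pi> \<longleftrightarrow>
     (\<forall>g. unitary_mat (rdim \<pi>) (\<pi> g)) \<and>
     (\<forall>g h. \<pi> (g + h) = \<pi> g * \<pi> h) \<and>
     (\<forall>i<rdim \<pi>. \<forall>j<rdim \<pi>. continuous_on UNIV (\<lambda>g. \<pi> g $$ (i, j)))"

definition irrep :: "('g::topological_group_add \<Rightarrow> complex mat) \<Rightarrow> bool" where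
  "irrep \<pi> \<longleftrightarrow> unitary_rep \<pi> \<and> rdim \<pi> > 0 \<and>
     (\<forall>W. subspace class_ring W (module_vec TYPE(complex) (rdim \<pi>)) \<and>
          (\<forall>g. \<forall>v\<in>W. \<pi> g *\<^sub>v v \<in> W) \<longrightarrow>
          W = {0\<^sub>v (rdim \<pi>)} \<or> W = carrier_vec (rdim \<pi>))"

definition rep_equiv ::
    "('g::topological_group_add \<Rightarrow> complex mat) \<Rightarrow> ('g \<Rightarrow> complex mat) \<Rightarrow> bool" where
  "rep_equiv \<pi> \<sigma> \<longleftrightarrow> rdim \<pi> = rdim \<sigma> \<and>
     (\<exists>U. unitary_mat (rdim \<pi>) U \<and> (\<forall>g. U * \<pi> g = \<sigma> g * U))"

definition dual_transversal :: "('g::topological_group_add \<Rightarrow> complex mat) set \<Rightarrow> bool" where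
  "dual_transversal Ghat \<longleftrightarrow>
     (\<forall>\<pi>\<in>Ghat. irrep \<pi>) \<and> (\<forall>\<sigma>. irrep \<sigma> \<longrightarrow> (\<exists>!\<pi>. \<pi> \<in> Ghat \<and> rep_equiv \<pi> \<sigma>))"

definition kronecker :: "complex mat \<Rightarrow> complex mat \<Rightarrow> complex mat" where
  "kronecker A B = mat (dim_row A * dim_row B) (dim_col A * dim_col B)
     (\<lambda>(i, j). A $$ (i div dim_row B, j div dim_col B) * B $$ (i mod dim_row B, j mod dim_col B))"

definition tensor_rep ::
    "('g::topological_group_add \<Rightarrow> complex mat) \<Rightarrow> ('g \<Rightarrow> complex mat) \<Rightarrow> 'g \<Rightarrow> complex mat" where
  "tensor_rep \<pi> \<sigma> = (\<lambda>g. kronecker (\<pi> g) (\<sigma> g))"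

definition intertwiners ::
    "('g::topological_group_add \<Rightarrow> complex mat) \<Rightarrow> ('g \<Rightarrow> complex mat) \<Rightarrow> complex mat set" where
  "intertwiners \<mu> \<rho> = {T \<in> carrier_mat (rdim \<rho>) (rdim \<mu>). \<forall>g. T * \<mu> g = \<rho> g * T}"

definition dim_Hom ::
    "('g::topological_group_add \<Rightarrow> complex mat) \<Rightarrow> ('g \<Rightarrow> complex mat) \<Rightarrow> nat" where
  "dim_Hom \<mu> \<rho> = vectorspace.dim class_ring
     ((module_mat TYPE(complex) (rdim \<rho>) (rdim \<mu>)) \<lparr>carrier := intertwiners \<mu> \<rho>\<rparr>)"

text \<open>\<open>fusion \<pi> \<sigma> \<mu>\<close> is $N_{\pi,\sigma}^{\mu}$.\<close>

definition fusion :: "('g::topological_group_add \<Rightarrow> complex mat) \<Rightarrow> ('g \<Rightarrow> complex mat) \<Rightarrow>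
    ('g \<Rightarrow> complex mat) \<Rightarrow> nat" where
  "fusion \<pi> \<sigma> \<mu> = dim_Hom \<mu> (tensor_rep \<pi> \<sigma>)"

definition weight :: "('g::topological_group_add \<Rightarrow> complex mat) set \<Rightarrow> real" where
  "weight F = (\<Sum>\<pi>\<in>F. (real (rdim \<pi>))\<^sup>2)"

text \<open>
  The sums over the complement of \<open>F n\<close> have nonnegative terms and are taken in
  \<^typ>\<open>ennreal\<close>, where every such sum has its true value (\<^const>\<open>infsum\<close> on \<^typ>\<open>real\<close> would
  be \<open>0\<close> on a divergent sum).
\<close>

definition folner_term :: "('g::topological_group_add \<Rightarrow> complex mat) \<Rightarrow> ('g \<Rightarrow> complex mat) \<Rightarrow>
    ('g \<Rightarrow> complex mat) \<Rightarrow> ennreal" where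
  "folner_term \<pi> \<sigma> \<mu> =
     ennreal (real (rdim \<sigma>) * real (rdim \<mu>) / real (rdim \<pi>) * real (fusion \<pi> \<mu> \<sigma>))"

definition folner_seq :: "('g::topological_group_add \<Rightarrow> complex mat) set \<Rightarrow>
    (nat \<Rightarrow> ('g \<Rightarrow> complex mat) set) \<Rightarrow> bool" where
  "folner_seq Ghat F \<longleftrightarrow>
     (\<forall>n. finite (F n) \<and> F n \<noteq> {} \<and> F n \<subseteq> Ghat) \<and>
     (\<forall>\<pi>\<in>Ghat.
        (\<lambda>n. ((\<Sum>\<sigma>\<in>F n. \<Sum>\<^sub>\<infinity>\<mu>\<in>Ghat - F n. folner_term \<pi> \<sigma> \<mu>) +
              (\<Sum>\<^sub>\<infinity>\<sigma>\<in>Ghat - F n. \<Sum>\<mu>\<in>F n. folner_term \<pi> \<sigma> \<mu>)) / ennreal (weight (F n)))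
        \<longlonglongrightarrow> 0)"

text \<open>
  Elements of $L^2(G)$ are represented by functions and operators by their action on
  representatives. The inner product is linear in the second argument. The index
  \<open>(\<pi>, i, j)\<close> stands for the basis vector $\sqrt{d(\pi)}\,\pi_{ij}$.
\<close>

definition L2_inner :: "'g measure \<Rightarrow> ('g \<Rightarrow> complex) \<Rightarrow> ('g \<Rightarrow> complex) \<Rightarrow> complex" where
  "L2_inner \<mu> a b = (LINT x|\<mu>. cnj (a x) * b x)"

definition basis_index :: "('g::topological_group_add \<Rightarrow> complex mat) set \<Rightarrow>
    (('g \<Rightarrow> complex mat) \<times> nat \<times> nat) set" where
  "basis_index F = (SIGMA \<pi>:F. {..<rdim \<pi>} \<times> {..<rdim \<pi>})"

definition basis_fun ::
    "('g::topological_group_add \<Rightarrow> complex mat) \<times> nat \<times> nat \<Rightarrow> 'g \<Rightarrow> complex" where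
  "basis_fun = (\<lambda>(\<pi>, i, j) g. complex_of_real (sqrt (real (rdim \<pi>))) * \<pi> g $$ (i, j))"

definition matrix_unit :: "'g measure \<Rightarrow> ('g \<Rightarrow> complex) \<Rightarrow> ('g \<Rightarrow> complex) \<Rightarrow>
    ('g \<Rightarrow> complex) \<Rightarrow> 'g \<Rightarrow> complex" where
  "matrix_unit \<mu> a b = (\<lambda>\<xi> x. L2_inner \<mu> b \<xi> * a x)"

definition proj_op :: "'g::topological_group_add measure \<Rightarrow> ('g \<Rightarrow> complex mat) set \<Rightarrow>
    ('g \<Rightarrow> complex) \<Rightarrow> 'g \<Rightarrow> complex" where
  "proj_op \<mu> F = (\<lambda>\<xi> x. \<Sum>p\<in>basis_index F. matrix_unit \<mu> (basis_fun p) (basis_fun p) \<xi> x)"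

definition mult_op :: "('g \<Rightarrow> complex) \<Rightarrow> ('g \<Rightarrow> complex) \<Rightarrow> 'g \<Rightarrow> complex" where
  "mult_op f = (\<lambda>\<xi> x. f x * \<xi> x)"

definition compress :: "'g::topological_group_add measure \<Rightarrow> ('g \<Rightarrow> complex mat) set \<Rightarrow>
    ('g \<Rightarrow> complex) \<Rightarrow> ('g \<Rightarrow> complex) \<Rightarrow> 'g \<Rightarrow> complex" where
  "compress \<mu> F f = proj_op \<mu> F \<circ> mult_op f \<circ> proj_op \<mu> F"

text \<open>
  An operator \<open>T\<close> on $P_F L^2(G)$ is the sum of the $\langle p, T q\rangle E_{p,q}$ over the basis
  vectors \<open>p\<close>, \<open>q\<close>, so the linear map prescribed on the matrix units is the following one; see
  \<open>decompress_matrix_unit\<close>.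
\<close>

definition decompress :: "'g::topological_group_add measure \<Rightarrow> ('g \<Rightarrow> complex mat) set \<Rightarrow>
    (('g \<Rightarrow> complex) \<Rightarrow> 'g \<Rightarrow> complex) \<Rightarrow> 'g \<Rightarrow> complex" where
  "decompress \<mu> F T = (\<lambda>x.
     \<Sum>(\<pi>, i, j)\<in>basis_index F. \<Sum>(\<sigma>, k, l)\<in>basis_index F.
       L2_inner \<mu> (basis_fun (\<pi>, i, j)) (T (basis_fun (\<sigma>, k, l))) *
       (complex_of_real (1 / weight F * sqrt (real (rdim \<pi>) * real (rdim \<sigma>))) *
        \<pi> x $$ (i, j) * cnj (\<sigma> x $$ (k, l))))"

lemma decompress_matrix_unit:
  assumes "finite F" "(\<pi>, i, j) \<in> basis_index F" "(\<sigma>, k, l) \<in> basis_index F"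
    and orthonormal: "\<And>p q. p \<in> basis_index F \<Longrightarrow> q \<in> basis_index F \<Longrightarrow>
      L2_inner \<mu> (basis_fun p) (basis_fun q) = (if p = q then 1 else 0)"
  shows "decompress \<mu> F (matrix_unit \<mu> (basis_fun (\<pi>, i, j)) (basis_fun (\<sigma>, k, l))) =
    (\<lambda>x. complex_of_real (1 / weight F * sqrt (real (rdim \<pi>) * real (rdim \<sigma>))) *
         \<pi> x $$ (i, j) * cnj (\<sigma> x $$ (k, l)))"
proof
  fix x
  let ?I = "basis_index F"
  define c :: "('a \<Rightarrow> complex mat) \<times> nat \<times> nat \<Rightarrow> ('a \<Rightarrow> complex mat) \<times> nat \<times> nat \<Rightarrow> complex"
    where "c = (\<lambda>(\<pi>, i, j) (\<sigma>, k, l).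
      complex_of_real (1 / weight F * sqrt (real (rdim \<pi>) * real (rdim \<sigma>))) *
      \<pi> x $$ (i, j) * cnj (\<sigma> x $$ (k, l)))"
  define p where "p = (\<pi>, i, j)"
  define q where "q = (\<sigma>, k, l)"
  have pq: "p \<in> ?I" "q \<in> ?I" using assms by (auto simp: p_def q_def)
  have fin: "finite ?I" using assms(1) by (auto simp: basis_index_def)
  have unit: "L2_inner \<mu> (basis_fun r) (matrix_unit \<mu> (basis_fun p) (basis_fun q) (basis_fun s)) =
      (if s = q then if r = p then 1 else 0 else 0)" if "r \<in> ?I" "s \<in> ?I" for r s
  proof -
    have "L2_inner \<mu> (basis_fun r) (matrix_unit \<mu> (basis_fun p) (basis_fun q) (basis_fun s)) =
        L2_inner \<mu> (basis_fun q) (basis_fun s) * L2_inner \<mu> (basis_fun r) (basis_fun p)"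
      unfolding matrix_unit_def L2_inner_def[of \<mu> "basis_fun r"]
      by (simp only: mult.left_commute[of "cnj _"] integral_mult_right_zero)
    then show ?thesis using orthonormal that pq by auto
  qed
  have "decompress \<mu> F (matrix_unit \<mu> (basis_fun p) (basis_fun q)) x =
      (\<Sum>r\<in>?I. \<Sum>s\<in>?I. L2_inner \<mu> (basis_fun r)
        (matrix_unit \<mu> (basis_fun p) (basis_fun q) (basis_fun s)) * c r s)"
    by (simp add: decompress_def c_def case_prod_unfold)
  also have "\<dots> = (\<Sum>r\<in>?I. \<Sum>s\<in>?I. if s = q then (if r = p then c r s else 0) else 0)"
    by (intro sum.cong refl) (simp add: unit)
  also have "\<dots> = c p q" using fin pq by simp
  finally show "decompress \<mu> F (matrix_unit \<mu> (basis_fun (\<pi>, i, j)) (basis_fun (\<sigma>, k, l))) x =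
    complex_of_real (1 / weight F * sqrt (real (rdim \<pi>) * real (rdim \<sigma>))) *
         \<pi> x $$ (i, j) * cnj (\<sigma> x $$ (k, l))"
    by (simp add: p_def q_def c_def)
qed

end

theory Submission
  imports Defs "Jordan_Normal_Form.Spectral_Radius"
begin

text \<open>
  With \<open>D = (\<Sum>\<pi>\<in>F. d(\<pi>) \<chi>\<^sub>\<pi>)\<close> the composed map sends \<open>f\<close> to
  \<open>x \<mapsto> (1 / w(F)) \<integral> f(y) \<bar>D(x - y)\<bar>\<^sup>2 dy\<close>, an average of \<open>f\<close> against a probability density.
  By Schur orthogonality the integral of \<open>d(\<pi>) - Re \<chi>\<^sub>\<pi>\<close> against this density equals \<open>1 / w(F)\<close>
  times one of the two sums of the Folner condition, multiplied by \<open>d(\<pi>)\<close>, so it tends to \<open>0\<close>.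
  Since the irreducible representations separate points, compactness bounds
  \<open>\<bar>f(y) - f(x)\<bar>\<close> by \<open>\<epsilon>\<close> plus a multiple of a finite sum of the
  \<open>d(\<pi>) - Re \<chi>\<^sub>\<pi>(x - y)\<close>, which gives uniform convergence.

  Separation of points is obtained without the spectral theorem. If all unitary representations are
  trivial at \<open>y \<noteq> 0\<close>, there is a continuous real \<open>k \<noteq> 0\<close> with \<open>k(-x) = k(x)\<close> that is orthogonal to all
  matrix coefficients. Normalised even convolution powers of \<open>k\<close> converge uniformly to a continuous
  idempotent \<open>p \<noteq> 0\<close>, which is orthogonal to all matrix coefficients as well. But convolution with
  \<open>p\<close> has finite-dimensional range, on which right translation gives a representation that has \<open>p\<close>
  in the span of its coefficients.
\<close>

section \<open>Haar integration\<close>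

text \<open>The obstacle is the separation of points, and power iteration overcomes it. Convolution
  with a symmetric real \<open>k\<close> is a self-adjoint operator, and the squared norm of the (n
  + 1)-fold power of \<open>k\<close> is the sum of the (2n + 2)-th powers of its eigenvalues. Such
  a sequence grows like \<open>L ^ Suc n\<close>, with L the square of the largest modulus of an
  eigenvalue. Dividing even powers of \<open>k\<close> by powers of L leaves the kernel of the
  projection onto the eigenspaces of largest modulus; evenness removes the sign of a negative
  eigenvalue. The proof sees no eigenvalues: log-convexity and submultiplicativity of the squared
  norms produce L and keep the normalised norms at least 1, so the limit cannot vanish.

  The function d(\<pi>) - Re \<chi>(\<pi>) serves as the distance to the neutral element because it
  is nonnegative, vanishes there, and has an integral against the density that involves only
  dimensions and fusion multiplicities, the data of the Folner condition.\<close>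

lemma continuous_on_compose_UNIV:
  assumes "continuous_on UNIV f" "continuous_on S g"
  shows "continuous_on S (\<lambda>x. f (g x))"
  using continuous_on_compose2[OF assms] by simp

lemma mat_adjoint_carrier [simp, intro]:
  "A \<in> carrier_mat n m \<Longrightarrow> mat_adjoint A \<in> carrier_mat m n"
  unfolding mat_adjoint_def carrier_mat_def by auto

lemma mat_adjoint_dim [simp]:
  "dim_row (mat_adjoint A) = dim_col A" "dim_col (mat_adjoint A) = dim_row A"
  unfolding mat_adjoint_def by auto

lemma mat_adjoint_index [simp]:
  fixes A :: "complex mat"
  shows "i < dim_col A \<Longrightarrow> j < dim_row A \<Longrightarrow> mat_adjoint A $$ (i, j) = cnj (A $$ (j, i))"
  unfolding mat_adjoint_def by (simp add: mat_of_rows_index)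

lemma mat_mult_index:
  assumes "A \<in> carrier_mat n m" "B \<in> carrier_mat m k" "i < n" "j < k"
  shows "(A * B) $$ (i, j) = (\<Sum>r<m. A $$ (i, r) * B $$ (r, j))"
  using assms by (auto simp: scalar_prod_def lessThan_atLeast0)

locale compact_haar =
  fixes \<mu> :: "'g::{topological_group_add, t2_space, second_countable_topology} measure"
  assumes compact_UNIV: "compact (UNIV :: 'g set)"
    and haar: "haar_prob \<mu>"
begin

sublocale prob_space \<mu>
  using haar by (simp add: haar_prob_def)

lemma sets_haar [measurable_cong]: "sets \<mu> = sets borel"
  using haar by (simp add: haar_prob_def)

lemma space_haar [simp]: "space \<mu> = UNIV"
  using sets_eq_imp_space_eq[OF sets_haar] by simp

lemma prob_UNIV [simp]: "prob UNIV = 1"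
  using prob_space by simp

lemma measurable_haar: "continuous_on UNIV f \<Longrightarrow> f \<in> borel_measurable \<mu>"
  using borel_measurable_continuous_onI[of f] measurable_cong_sets[OF sets_haar refl] by blast

lemma continuous_bounded:
  fixes f :: "'g \<Rightarrow> 'b::real_normed_vector"
  assumes "continuous_on UNIV f"
  obtains B where "B > 0" "\<And>x. norm (f x) \<le> B"
proof -
  have "bounded (f ` UNIV)"
    using compact_continuous_image[OF assms compact_UNIV] compact_imp_bounded by blast
  then show ?thesis
    using that unfolding bounded_pos by auto
qed

lemma integrable_continuous:
  fixes f :: "'g \<Rightarrow> 'b::{banach, second_countable_topology}"
  assumes "continuous_on UNIV f"
  shows "integrable \<mu> f"
proof -
  obtain B where "\<And>x. norm (f x) \<le> B" using continuous_bounded[OF assms] by blast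
  then show ?thesis
    by (intro integrable_const_bound[of _ B] measurable_haar assms) auto
qed

lemma integral_left_translate:
  fixes f :: "'g \<Rightarrow> 'b::{banach, second_countable_topology}"
  assumes "continuous_on UNIV f"
  shows "(LINT x|\<mu>. f (a + x)) = (LINT x|\<mu>. f x)"
proof -
  have m: "(\<lambda>x. a + x) \<in> measurable \<mu> borel"
    by (intro measurable_haar continuous_intros)
  have "(LINT x|\<mu>. f x) = (LINT x|distr \<mu> borel (\<lambda>x. a + x). f x)"
    using haar by (simp add: haar_prob_def)
  also have "\<dots> = (LINT x|\<mu>. f (a + x))"
    by (intro integral_distr m borel_measurable_continuous_onI assms)
  finally show ?thesis by simp
qed

lemma integrable_pair:
  fixes h :: "'g \<Rightarrow> 'g \<Rightarrow> 'b::{banach, second_countable_topology}"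
  assumes "continuous_on UNIV (\<lambda>p. h (fst p) (snd p))"
  shows "integrable (\<mu> \<Otimes>\<^sub>M \<mu>) (\<lambda>(x, y). h x y)"
proof -
  interpret P: pair_prob_space \<mu> \<mu> ..
  have "compact (UNIV :: ('g \<times> 'g) set)"
    using compact_Times[OF compact_UNIV compact_UNIV] by simp
  then have "bounded (range (\<lambda>p. h (fst p) (snd p)))"
    using compact_continuous_image[OF assms] compact_imp_bounded by blast
  then obtain B where B: "\<And>p. norm (h (fst p) (snd p)) \<le> B"
    unfolding bounded_iff by auto
  \<comment> \<open>Second countability enters here: it makes the Borel sets of the product group
    coincide with the product sigma-algebra.\<close>
  have "sets (\<mu> \<Otimes>\<^sub>M \<mu>) = sets borel"
    unfolding borel_prod[symmetric] by (intro sets_pair_measure_cong sets_haar)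
  then have "(\<lambda>p. h (fst p) (snd p)) \<in> borel_measurable (\<mu> \<Otimes>\<^sub>M \<mu>)"
    using borel_measurable_continuous_onI[OF assms] measurable_cong_sets by blast
  then show ?thesis
    unfolding case_prod_unfold
    by (intro P.integrable_const_bound[of _ B]) (use B in auto)
qed

lemma Fubini_continuous:
  fixes h :: "'g \<Rightarrow> 'g \<Rightarrow> 'b::{banach, second_countable_topology}"
  assumes "continuous_on UNIV (\<lambda>p. h (fst p) (snd p))"
  shows "(LINT x|\<mu>. LINT y|\<mu>. h x y) = (LINT y|\<mu>. LINT x|\<mu>. h x y)"
proof -
  interpret P: pair_prob_space \<mu> \<mu> ..
  show ?thesis using P.Fubini_integral[OF integrable_pair[OF assms]] by simp
qed

text \<open>Only left invariance is given. Integrate f (- x + y) over both variables: the y-integral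
  is that of f, while the x-integral is that of f (- x), since - x + y = - (- y + x). Fubini equates
  the two.\<close>

lemma integral_uminus:
  fixes f :: "'g \<Rightarrow> 'b::{banach, second_countable_topology}"
  assumes f: "continuous_on UNIV f"
  shows "(LINT x|\<mu>. f (- x)) = (LINT x|\<mu>. f x)"
proof -
  have "(LINT x|\<mu>. LINT y|\<mu>. f (- x + y)) = (LINT y|\<mu>. LINT x|\<mu>. f (- x + y))"
    by (intro Fubini_continuous continuous_on_compose_UNIV[OF f] continuous_intros)
  moreover have "(LINT y|\<mu>. f (- x + y)) = (LINT y|\<mu>. f y)" for x
    by (rule integral_left_translate[OF f])
  moreover have "(LINT x|\<mu>. f (- x + y)) = (LINT x|\<mu>. f (- x))" for y
    using integral_left_translate[of "\<lambda>x. f (- x)" "- y"]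
    by (simp add: minus_add continuous_on_compose_UNIV[OF f] continuous_intros)
  ultimately show ?thesis by simp
qed

text \<open>Inversion turns a right translation into a left one.\<close>

lemma integral_right_translate:
  fixes f :: "'g \<Rightarrow> 'b::{banach, second_countable_topology}"
  assumes f: "continuous_on UNIV f"
  shows "(LINT x|\<mu>. f (x + a)) = (LINT x|\<mu>. f x)"
proof -
  have "(LINT x|\<mu>. f (x + a)) = (LINT x|\<mu>. f (- x + a))"
    by (rule integral_uminus[symmetric])
      (intro continuous_on_compose_UNIV[OF f] continuous_intros)
  also have "\<dots> = (LINT x|\<mu>. f (- x))"
    using integral_left_translate[of "\<lambda>x. f (- x)" "- a"]
    by (simp add: minus_add continuous_on_compose_UNIV[OF f] continuous_intros)
  finally show ?thesis by (simp add: integral_uminus[OF f])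
qed

lemma integral_reflect:
  fixes f :: "'g \<Rightarrow> 'b::{banach, second_countable_topology}"
  assumes f: "continuous_on UNIV f"
  shows "(LINT z|\<mu>. f (x - z)) = (LINT z|\<mu>. f z)"
proof -
  have "(LINT z|\<mu>. f (x - z)) = (LINT z|\<mu>. f (x + z))"
    using integral_uminus[of "\<lambda>z. f (x + z)"]
    by (simp add: continuous_on_compose_UNIV[OF f] continuous_intros)
  then show ?thesis by (simp add: integral_left_translate[OF f])
qed

text \<open>By compactness finitely many translates of the open set f > 0 cover the group. The sum
  of the corresponding translates of f has a positive minimum, and its integral is a multiple of the
  integral of f.\<close>

lemma integral_pos:
  fixes f :: "'g \<Rightarrow> real"
  assumes f: "continuous_on UNIV f" and nn: "\<And>x. f x \<ge> 0" and a: "f a > 0"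
  shows "(LINT x|\<mu>. f x) > 0"
proof -
  let ?U = "\<lambda>g. {x. f (g + x) > 0}"
  have ct: "continuous_on UNIV (\<lambda>x. f (g + x))" for g
    by (intro continuous_on_compose_UNIV[OF f] continuous_intros)
  have "open (?U g)" for g
    using open_Collect_less[OF continuous_on_const ct, of 0 g] by simp
  moreover have "UNIV \<subseteq> (\<Union>g. ?U g)"
  proof
    fix x
    have "x \<in> ?U (a - x)" using a by simp
    then show "x \<in> (\<Union>g. ?U g)" by blast
  qed
  ultimately obtain C where C: "finite C" "UNIV \<subseteq> (\<Union>g\<in>C. ?U g)"
    using compactE_image[OF compact_UNIV, of UNIV ?U] by (metis)
  let ?s = "\<lambda>x. \<Sum>g\<in>C. f (g + x)"
  have cs: "continuous_on UNIV ?s" by (intro continuous_on_sum ct)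
  obtain m where m: "\<And>x. ?s m \<le> ?s x"
    using continuous_attains_inf[OF compact_UNIV _ cs] by auto
  obtain g where "g \<in> C" "f (g + m) > 0" using C(2) by blast
  then have "?s m > 0" using C(1) nn by (intro sum_pos2) auto
  also have "?s m = (LINT x|\<mu>. ?s m)" by simp
  also have "\<dots> \<le> (LINT x|\<mu>. ?s x)"
    using m by (intro integral_mono integrable_continuous cs) auto
  also have "\<dots> = card C * (LINT x|\<mu>. f x)"
    by (subst Bochner_Integration.integral_sum)
      (auto intro!: integrable_continuous ct simp: integral_left_translate[OF f])
  finally show ?thesis by (simp add: zero_less_mult_iff)
qed

text \<open>The group is first countable, so sequences suffice and dominated convergence applies
  with a constant bound.\<close>

lemma continuous_on_integral:
  fixes h :: "'g \<Rightarrow> 'g \<Rightarrow> 'b::{banach, second_countable_topology}"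
  assumes h: "continuous_on UNIV (\<lambda>p. h (fst p) (snd p))"
  shows "continuous_on UNIV (\<lambda>x. LINT y|\<mu>. h x y)"
proof -
  have "compact (UNIV :: ('g \<times> 'g) set)"
    using compact_Times[OF compact_UNIV compact_UNIV] by simp
  then have "bounded (range (\<lambda>p. h (fst p) (snd p)))"
    using compact_continuous_image[OF h] compact_imp_bounded by blast
  then obtain B where B: "\<And>x y. norm (h x y) \<le> B"
    unfolding bounded_iff by fastforce
  have c1: "continuous_on UNIV (\<lambda>x. h x y)" for y
    using continuous_on_compose_UNIV[OF h, of UNIV "\<lambda>x. (x, y)"] by (simp add: continuous_intros)
  have c2: "continuous_on UNIV (\<lambda>y. h x y)" for x
    using continuous_on_compose_UNIV[OF h, of UNIV "\<lambda>y. (x, y)"] by (simp add: continuous_intros)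
  show ?thesis
  proof (rule continuous_on_sequentiallyI)
    fix u :: "nat \<Rightarrow> 'g" and a assume "u \<longlonglongrightarrow> a"
    then have "(\<lambda>n. h (u n) y) \<longlonglongrightarrow> h a y" for y
      using continuous_on_tendsto_compose[OF c1, of u a] by simp
    then show "(\<lambda>n. LINT y|\<mu>. h (u n) y) \<longlonglongrightarrow> (LINT y|\<mu>. h a y)"
      by (intro integral_dominated_convergence[where w = "\<lambda>_. B"])
        (auto intro: measurable_haar c2 B)
  qed
qed

end

section \<open>Convolution and continuous idempotents\<close>

text \<open>Log-convexity makes the ratios of consecutive terms increase, and submultiplicativity
  bounds them by \<open>c 0\<close>; L is their limit. Ratios stay below L, so the normalised
  sequence decreases. The lower bound follows from c (m + n + 1) / c m, which tends to
  \<open>L ^ Suc n\<close> as m grows and never exceeds \<open>c n\<close>.\<close>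

lemma log_convex_submultiplicative:
  fixes c :: "nat \<Rightarrow> real"
  assumes pos: "\<And>n. c n > 0"
    and lc: "\<And>n. (c (Suc n))\<^sup>2 \<le> c n * c (Suc (Suc n))"
    and sub: "\<And>m n. c (Suc (m + n)) \<le> c m * c n"
  obtains L where "L > 0" "decseq (\<lambda>n. c n / L ^ Suc n)" "\<And>n. L ^ Suc n \<le> c n"
proof -
  define r where "r = (\<lambda>n. c (Suc n) / c n)"
  have r_pos: "r n > 0" for n using pos by (simp add: r_def)
  have inc: "incseq r"
    unfolding incseq_Suc_iff r_def using lc pos
    by (auto simp: field_simps power2_eq_square)
  have r_le: "r n \<le> c 0" for n
    using sub[of n 0] pos[of n] by (simp add: r_def field_simps)
  obtain L where L: "r \<longlonglongrightarrow> L" "\<And>n. r n \<le> L"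
    using incseq_convergent[OF inc, of "c 0"] r_le by auto
  have L_pos: "L > 0" using r_pos[of 0] L(2)[of 0] by linarith
  have "decseq (\<lambda>n. c n / L ^ Suc n)"
  proof (rule decseq_SucI)
    fix n
    have "c (Suc n) \<le> L * c n" using L(2)[of n] pos[of n] by (simp add: r_def field_simps)
    then have "c (Suc n) / L ^ Suc (Suc n) \<le> L * c n / L ^ Suc (Suc n)"
      using L_pos by (intro divide_right_mono) auto
    also have "\<dots> = c n / L ^ Suc n" using L_pos by (simp add: field_simps)
    finally show "c (Suc n) / L ^ Suc (Suc n) \<le> c n / L ^ Suc n" .
  qed
  moreover have "L ^ Suc n \<le> c n" for n
  proof -
    have "(\<lambda>m. c (m + k) / c m) \<longlonglongrightarrow> L ^ k" for k
    proof (induction k)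
      case 0
      have "c m \<noteq> 0" for m using pos[of m] by simp
      then show ?case by simp
    next
      case (Suc k)
      have "(\<lambda>m. c (m + k) / c m * r (m + k)) \<longlonglongrightarrow> L ^ k * L"
        using Suc L(1) by (intro tendsto_mult LIMSEQ_ignore_initial_segment)
      moreover have "(\<lambda>m. c (m + k) / c m * r (m + k)) = (\<lambda>m. c (m + Suc k) / c m)"
        using pos[of "_ + k"] by (auto simp: r_def less_imp_neq[symmetric])
      ultimately show ?case by (simp only: power_Suc mult.commute)
    qed
    moreover have "c (m + Suc n) / c m \<le> c n" for m
      using sub[of m n] pos[of m] by (simp add: field_simps)
    ultimately show ?thesis
      by (intro LIMSEQ_le_const2[where X = "\<lambda>m. c (m + Suc n) / c m"]) blast+
  qed
  ultimately show thesis using that L_pos by blast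
qed

context compact_haar
begin

section \<open>Real inner product and convolution of continuous functions\<close>

definition inner_prod :: "('g \<Rightarrow> real) \<Rightarrow> ('g \<Rightarrow> real) \<Rightarrow> real" where
  "inner_prod f g = (LINT x|\<mu>. f x * g x)"

text \<open>The group need not be commutative, so the side matters: with this order, g \<mapsto>
  \<open>conv f g\<close> commutes with right translations.\<close>

definition conv :: "('g \<Rightarrow> real) \<Rightarrow> ('g \<Rightarrow> real) \<Rightarrow> 'g \<Rightarrow> real" where
  "conv f g x = (LINT z|\<mu>. f (x - z) * g z)"

lemma continuous_conv:
  assumes f: "continuous_on UNIV f" and g: "continuous_on UNIV g"
  shows "continuous_on UNIV (conv f g)"
  unfolding conv_def
  by (intro continuous_on_integral continuous_on_compose_UNIV[OF f]
      continuous_on_compose_UNIV[OF g] continuous_intros)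

lemma inner_prod_commute: "inner_prod f g = inner_prod g f"
  by (simp add: inner_prod_def mult.commute)

lemma inner_prod_ge_0: "inner_prod f f \<ge> 0"
  unfolding inner_prod_def by (intro integral_nonneg_AE) auto

lemma inner_prod_pos:
  assumes f: "continuous_on UNIV f" and "f a \<noteq> 0"
  shows "inner_prod f f > 0"
  unfolding inner_prod_def
  by (rule integral_pos[of _ a]) (use assms in \<open>auto intro!: continuous_intros simp: zero_less_mult_iff\<close>)

lemma inner_prod_scale_left: "inner_prod (\<lambda>x. t * f x) h = t * inner_prod f h"
  unfolding inner_prod_def by (simp add: mult.assoc)

lemma inner_prod_scale_right: "inner_prod f (\<lambda>x. t * g x) = t * inner_prod f g"
  using inner_prod_scale_left[of t g f] by (simp only: inner_prod_commute[of f])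

lemma inner_prod_sum_left:
  assumes "\<And>i. i \<in> I \<Longrightarrow> continuous_on UNIV (f i)" "continuous_on UNIV h"
  shows "inner_prod (\<lambda>x. \<Sum>i\<in>I. t i * f i x) h = (\<Sum>i\<in>I. t i * inner_prod (f i) h)"
  unfolding inner_prod_def sum_distrib_right using assms
  by (subst Bochner_Integration.integral_sum)
    (auto intro!: integrable_continuous continuous_intros simp: mult.assoc)

lemma inner_prod_diff_self:
  assumes f: "continuous_on UNIV f" and g: "continuous_on UNIV g"
  shows "inner_prod (\<lambda>x. f x - g x) (\<lambda>x. f x - g x) =
    inner_prod f f - 2 * inner_prod f g + inner_prod g g"
proof -
  have "inner_prod (\<lambda>x. f x - g x) (\<lambda>x. f x - g x) =
      (LINT x|\<mu>. f x * f x - 2 * (f x * g x) + g x * g x)"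
    unfolding inner_prod_def by (intro Bochner_Integration.integral_cong) (auto simp: algebra_simps)
  also have "\<dots> = inner_prod f f - 2 * inner_prod f g + inner_prod g g"
    unfolding inner_prod_def using f g
    by (simp add: integrable_continuous continuous_intros)
  finally show ?thesis .
qed

lemma Cauchy_Schwarz_inner_prod:
  assumes f: "continuous_on UNIV f" and g: "continuous_on UNIV g"
  shows "(inner_prod f g)\<^sup>2 \<le> inner_prod f f * inner_prod g g"
proof -
  let ?a = "inner_prod f f" and ?b = "inner_prod f g" and ?c = "inner_prod g g"
  have *: "0 \<le> ?a - 2 * (t * ?b) + t * (t * ?c)" for t
  proof -
    have "0 \<le> inner_prod (\<lambda>x. f x - t * g x) (\<lambda>x. f x - t * g x)"
      by (rule inner_prod_ge_0)
    also have "\<dots> = ?a - 2 * (t * ?b) + t * (t * ?c)"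
      using f g by (subst inner_prod_diff_self)
        (auto intro!: continuous_intros simp: inner_prod_scale_left inner_prod_scale_right)
    finally show ?thesis .
  qed
  show ?thesis
  proof (cases "?c = 0")
    case True
    have "?b = 0"
    proof (rule ccontr)
      assume "?b \<noteq> 0"
      \<comment> \<open>With ?c = 0 the quadratic in t is linear, and this t gives it the value
        -1.\<close>
      then show False using *[of "(?a + 1) / (2 * ?b)"] True inner_prod_ge_0[of f]
        by (simp add: field_simps)
    qed
    then show ?thesis using True by simp
  next
    case False
    then have "?c > 0" using inner_prod_ge_0[of g] by simp
    then show ?thesis using *[of "?b / ?c"] by (simp add: field_simps power2_eq_square)
  qed
qed

lemma inner_prod_reflect:
  assumes f: "continuous_on UNIV f"
  shows "inner_prod (\<lambda>z. f (x - z)) (\<lambda>z. f (x - z)) = inner_prod f f"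
  unfolding inner_prod_def
  by (rule integral_reflect[of "\<lambda>z. f z * f z"]) (intro continuous_intros f)

text \<open>Cauchy-Schwarz at each point. This is the device that turns L2 estimates into uniform
  ones: convolving once more replaces the L2 norm by the supremum norm.\<close>

lemma conv_square_le:
  assumes f: "continuous_on UNIV f" and g: "continuous_on UNIV g"
  shows "(conv f g x)\<^sup>2 \<le> inner_prod f f * inner_prod g g"
proof -
  have "conv f g x = inner_prod (\<lambda>z. f (x - z)) g" by (simp add: conv_def inner_prod_def)
  then show ?thesis
    using Cauchy_Schwarz_inner_prod[OF _ g, of "\<lambda>z. f (x - z)"]
    by (simp add: inner_prod_reflect f continuous_on_compose_UNIV[OF f] continuous_intros)
qed

text \<open>The assumption \<open>sym\<close> makes the kernel k (x - z) symmetric in x and z, so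
  convolution with k is self-adjoint.\<close>

lemma inner_prod_conv:
  assumes k: "continuous_on UNIV k" and f: "continuous_on UNIV f" and g: "continuous_on UNIV g"
    and sym: "\<And>x. k (- x) = k x"
  shows "inner_prod (conv k f) g = inner_prod f (conv k g)"
proof -
  have "inner_prod (conv k f) g = (LINT x|\<mu>. LINT z|\<mu>. k (x - z) * f z * g x)"
    unfolding inner_prod_def conv_def by simp
  also have "\<dots> = (LINT z|\<mu>. LINT x|\<mu>. k (x - z) * f z * g x)"
    by (intro Fubini_continuous continuous_on_compose_UNIV[OF k] continuous_on_compose_UNIV[OF f]
        continuous_on_compose_UNIV[OF g] continuous_intros)
  also have "\<dots> = (LINT z|\<mu>. LINT x|\<mu>. f z * (k (z - x) * g x))"
    using sym[of "_ - _"] by (simp add: mult_ac)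
  also have "\<dots> = inner_prod f (conv k g)"
    unfolding inner_prod_def conv_def by simp
  finally show ?thesis .
qed

lemma conv_assoc:
  assumes f: "continuous_on UNIV f" and g: "continuous_on UNIV g" and h: "continuous_on UNIV h"
  shows "conv (conv f g) h = conv f (conv g h)"
proof
  fix x
  have "conv f (conv g h) x = (LINT v|\<mu>. LINT z|\<mu>. f (x - v) * (g (v - z) * h z))"
    unfolding conv_def by simp
  also have "\<dots> = (LINT z|\<mu>. LINT v|\<mu>. f (x - v) * (g (v - z) * h z))"
    by (intro Fubini_continuous continuous_on_compose_UNIV[OF h] continuous_on_compose_UNIV[OF f]
        continuous_on_compose_UNIV[OF g] continuous_intros)
  also have "\<dots> = (LINT z|\<mu>. LINT w|\<mu>. f (x - z - w) * g w * h z)"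
  proof (rule Bochner_Integration.integral_cong[OF refl])
    fix z
    have "(LINT v|\<mu>. f (x - v) * (g (v - z) * h z)) =
        (LINT w|\<mu>. f (x - (w + z)) * (g (w + z - z) * h z))"
      by (rule integral_right_translate[of "\<lambda>v. f (x - v) * (g (v - z) * h z)" z, symmetric])
        (intro continuous_on_compose_UNIV[OF f] continuous_on_compose_UNIV[OF g] continuous_intros)
    then show "(LINT v|\<mu>. f (x - v) * (g (v - z) * h z)) = (LINT w|\<mu>. f (x - z - w) * g w * h z)"
      by (simp add: diff_diff_eq2 diff_add_eq_diff_diff_swap mult.assoc)
  qed
  also have "\<dots> = conv (conv f g) h x"
    unfolding conv_def by simp
  finally show "conv (conv f g) h x = conv f (conv g h) x" ..
qed

text \<open>Index n holds the (n + 1)-fold power, because continuous functions need not contain a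
  unit for convolution. This is the source of the \<open>Suc\<close> in sums of indices.\<close>

primrec conv_power :: "('g \<Rightarrow> real) \<Rightarrow> nat \<Rightarrow> 'g \<Rightarrow> real" where
  "conv_power k 0 = k"
| "conv_power k (Suc n) = conv k (conv_power k n)"

lemma continuous_conv_power:
  "continuous_on UNIV k \<Longrightarrow> continuous_on UNIV (conv_power k n)"
  by (induction n) (auto intro: continuous_conv)

lemma conv_power_add:
  assumes "continuous_on UNIV k"
  shows "conv (conv_power k m) (conv_power k n) = conv_power k (Suc (m + n))"
  by (induction m) (auto simp: conv_assoc assms continuous_conv_power)

text \<open>Self-adjointness makes the inner product of two powers depend only on the sum of their
  indices. After normalisation, squared L2 distances are therefore second differences of one
  convergent sequence \<open>b\<close>, so the even powers are Cauchy in L2, and a further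
  convolution makes them uniformly Cauchy. Orthogonality to \<phi> passes from the powers to the
  uniform limit.\<close>

lemma conv_idempotent_exists:
  assumes k: "continuous_on UNIV k" and sym: "\<And>x. k (- x) = k x" and k0: "k 0 \<noteq> 0"
  obtains p where "continuous_on UNIV p" "conv p p = p" "inner_prod p p > 0"
    "\<And>\<phi> :: 'g \<Rightarrow> complex. continuous_on UNIV \<phi> \<Longrightarrow>
      (\<And>n. (LINT x|\<mu>. of_real (conv_power k n x) * \<phi> x) = 0) \<Longrightarrow>
      (LINT x|\<mu>. of_real (p x) * \<phi> x) = 0"
proof -
  define K where "K = conv_power k"
  have K: "continuous_on UNIV (K n)" for n
    unfolding K_def by (rule continuous_conv_power[OF k])
  have K_conv: "conv (K m) (K n) = K (Suc (m + n))" for m n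
    unfolding K_def by (rule conv_power_add[OF k])
  have shift: "inner_prod (K m) (K n) = inner_prod (K 0) (K (m + n))" for m n
  proof (induction m arbitrary: n)
    case (Suc m)
    have "inner_prod (K (Suc m)) (K n) = inner_prod (K m) (K (Suc n))"
      using inner_prod_conv[OF k K K sym] by (simp add: K_def)
    then show ?case using Suc[of "Suc n"] by simp
  qed simp
  define c where "c = (\<lambda>n. inner_prod (K n) (K n))"
  have K_inner: "inner_prod (K m) (K n) = c i" if "m + n = 2 * i" for m n i
    unfolding c_def using shift[of m n] shift[of i i] that by (simp add: mult_2)
  have lc: "(c (Suc n))\<^sup>2 \<le> c n * c (Suc (Suc n))" for n
    using Cauchy_Schwarz_inner_prod[OF K K, of n "Suc (Suc n)"] K_inner[of n "Suc (Suc n)" "Suc n"]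
    by (simp add: c_def)
  have c0: "c 0 > 0" unfolding c_def by (rule inner_prod_pos[OF K, of _ 0]) (simp add: K_def k0)
  \<comment> \<open>The twofold power is nonzero because its value at 0 is the squared norm of k.
    With \<open>c 0\<close> and \<open>c 1\<close> positive, log-convexity carries positivity on to
    every index.\<close>
  have "K 1 0 = c 0"
    by (simp add: K_def c_def conv_def inner_prod_def sym)
  then have c1: "c 1 > 0"
    unfolding c_def by (intro inner_prod_pos[OF K, of _ 0]) (use c0 in \<open>simp add: c_def\<close>)
  have pos2: "c n > 0 \<and> c (Suc n) > 0" for n
  proof (induction n)
    case 0
    then show ?case using c0 c1 by simp
  next
    case (Suc n)
    then have "0 < (c (Suc n))\<^sup>2" by simp
    then have "0 < c n * c (Suc (Suc n))" using lc[of n] by linarith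
    then show ?case using Suc by (simp add: zero_less_mult_iff)
  qed
  have sub: "c (Suc (m + n)) \<le> c m * c n" for m n
  proof -
    have "c (Suc (m + n)) = (LINT x|\<mu>. (conv (K m) (K n) x)\<^sup>2)"
      unfolding c_def inner_prod_def K_conv by (simp add: power2_eq_square)
    also have "\<dots> \<le> (LINT x|\<mu>. c m * c n)"
      unfolding c_def
      by (intro integral_mono conv_square_le K integrable_continuous continuous_intros continuous_conv)
    finally show ?thesis by simp
  qed
  obtain L where L: "L > 0" "decseq (\<lambda>n. c n / L ^ Suc n)" "\<And>n. L ^ Suc n \<le> c n"
    using log_convex_submultiplicative[of c] pos2 lc sub by blast
  define b where "b = (\<lambda>n. c n / L ^ Suc n)"
  have b1: "b n \<ge> 1" for n using L(1) L(3)[of n] by (simp add: b_def)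
  have bdec: "decseq b" using L(2) by (simp add: b_def)
  obtain \<beta> where \<beta>: "b \<longlonglongrightarrow> \<beta>" "\<And>n. \<beta> \<le> b n"
    using decseq_convergent[OF bdec, of 1] b1 by auto
  have \<beta>1: "\<beta> \<ge> 1" using \<beta>(1) b1 by (intro LIMSEQ_le_const) auto
  \<comment> \<open>The (2n + 2)-fold power, with one factor L for every two factors k. Even powers
    make each inner product of two terms a value of \<open>b\<close>, which is at least 1.\<close>
  define e where "e = (\<lambda>n x. K (2 * n + 1) x / L ^ Suc n)"
  have e: "continuous_on UNIV (e n)" for n
    unfolding e_def using L(1) by (intro continuous_intros K) auto
  have e_inner: "inner_prod (e m) (e n) = b (Suc (m + n))" for m n
  proof -
    have "inner_prod (e m) (e n) = inner_prod (K (2 * m + 1)) (K (2 * n + 1)) / (L ^ Suc m * L ^ Suc n)"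
      unfolding e_def inner_prod_def by simp
    also have "L ^ Suc m * L ^ Suc n = L ^ Suc (Suc (m + n))" by (simp add: power_add mult_ac)
    also have "inner_prod (K (2 * m + 1)) (K (2 * n + 1)) = c (Suc (m + n))"
      by (rule K_inner) simp
    finally show ?thesis by (simp add: b_def)
  qed
  have e_conv: "conv (e m) (e n) = e (Suc (m + n))" for m n
  proof
    fix x
    have "conv (e m) (e n) x = conv (K (2 * m + 1)) (K (2 * n + 1)) x / (L ^ Suc m * L ^ Suc n)"
      unfolding e_def conv_def by simp
    also have "L ^ Suc m * L ^ Suc n = L ^ Suc (Suc (m + n))" by (simp add: power_add mult_ac)
    also have "conv (K (2 * m + 1)) (K (2 * n + 1)) = K (2 * Suc (m + n) + 1)"
      unfolding K_conv by (rule arg_cong[of _ _ K]) simp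
    finally show "conv (e m) (e n) x = e (Suc (m + n)) x" by (simp add: e_def)
  qed
  have e0: "inner_prod (e 0) (e 0) \<le> b 0"
    using e_inner[of 0 0] decseqD[OF bdec, of 0 1] by simp
  \<comment> \<open>Splitting off a factor \<open>e 0\<close> bounds a pointwise difference by an L2
    distance; the bracket is the squared L2 distance of \<open>e n\<close> and
    \<open>e m\<close>.\<close>
  have diff: "(e (Suc n) x - e (Suc m) x)\<^sup>2 \<le> b 0 * (b (Suc (n + n)) - 2 * b (Suc (n + m)) + b (Suc (m + m)))"
    for m n x
  proof -
    have "e (Suc n) x - e (Suc m) x = conv (e 0) (\<lambda>x. e n x - e m x) x"
    proof -
      have "conv (e 0) (\<lambda>x. e n x - e m x) x = (LINT z|\<mu>. e 0 (x - z) * e n z - e 0 (x - z) * e m z)"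
        unfolding conv_def by (simp add: algebra_simps)
      also have "\<dots> = conv (e 0) (e n) x - conv (e 0) (e m) x"
        unfolding conv_def
        by (intro Bochner_Integration.integral_diff integrable_continuous continuous_intros
            continuous_on_compose_UNIV[OF e] e)
      finally show ?thesis by (simp add: e_conv)
    qed
    then have "(e (Suc n) x - e (Suc m) x)\<^sup>2 \<le>
        inner_prod (e 0) (e 0) * inner_prod (\<lambda>x. e n x - e m x) (\<lambda>x. e n x - e m x)"
      using conv_square_le[OF e[of 0], of "\<lambda>x. e n x - e m x" x] e by (simp add: continuous_intros)
    also have "\<dots> \<le> b 0 * inner_prod (\<lambda>x. e n x - e m x) (\<lambda>x. e n x - e m x)"
      by (intro mult_right_mono e0 inner_prod_ge_0)
    finally show ?thesis by (simp add: inner_prod_diff_self[OF e e] e_inner)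
  qed
  have "uniformly_Cauchy_on UNIV (\<lambda>n. e (Suc n))"
  proof (rule uniformly_Cauchy_onI)
    fix \<epsilon> :: real assume \<epsilon>: "\<epsilon> > 0"
    \<comment> \<open>The two outer terms of the bracket are below \<beta> + \<delta> and the middle
      one is at least \<beta>, so the bracket is below 2 * \<delta>; multiplied by
      \<open>b 0\<close> this is the square of \<epsilon>.\<close>
    define \<delta> where "\<delta> = \<epsilon>\<^sup>2 / (2 * b 0)"
    have b0: "b 0 > 0" using b1[of 0] by simp
    then have \<delta>: "\<delta> > 0" using \<epsilon> by (simp add: \<delta>_def)
    obtain N where N: "\<And>n. n \<ge> N \<Longrightarrow> \<bar>b n - \<beta>\<bar> < \<delta>"
      using LIMSEQ_D[OF \<beta>(1) \<delta>] by auto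
    show "\<exists>M. \<forall>x\<in>UNIV. \<forall>m\<ge>M. \<forall>n\<ge>M. dist (e (Suc m) x) (e (Suc n) x) < \<epsilon>"
    proof (intro exI[of _ N] ballI allI impI)
      fix x m n assume mn: "m \<ge> N" "n \<ge> N"
      have "b (Suc (m + m)) - 2 * b (Suc (m + n)) + b (Suc (n + n)) < 2 * \<delta>"
        using N[of "Suc (m + m)"] N[of "Suc (n + n)"] \<beta>(2)[of "Suc (m + n)"] mn by linarith
      then have "b 0 * (b (Suc (m + m)) - 2 * b (Suc (m + n)) + b (Suc (n + n))) < b 0 * (2 * \<delta>)"
        using b0 by simp
      also have "\<dots> = \<epsilon>\<^sup>2" using b0 by (simp add: \<delta>_def)
      finally have "(e (Suc m) x - e (Suc n) x)\<^sup>2 < \<epsilon>\<^sup>2"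
        using diff[of m x n] by linarith
      then show "dist (e (Suc m) x) (e (Suc n) x) < \<epsilon>"
        using \<epsilon> by (simp add: dist_real_def abs_less_iff power2_less_imp_less[of "\<bar>_\<bar>", simplified])
          (metis abs_less_iff minus_diff_eq power2_abs power_less_imp_less_base less_imp_le)
    qed
  qed
  then obtain p where p: "uniform_limit UNIV (\<lambda>n. e (Suc n)) p sequentially"
    using Cauchy_uniformly_convergent uniformly_convergent_uniform_limit_iff by blast
  have p_cont: "continuous_on UNIV p"
    by (rule uniform_limit_theorem[OF _ p]) (auto simp: e)
  have lim: "(\<lambda>n. e (Suc n) x) \<longlonglongrightarrow> p x" for x
    using tendsto_uniform_limitI[OF p] by simp
  have bound: "\<bar>e (Suc n) x\<bar> \<le> b 0" for n x
  proof -
    have "(e (Suc n) x)\<^sup>2 \<le> inner_prod (e 0) (e 0) * inner_prod (e n) (e n)"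
      using conv_square_le[OF e e, of 0 n x] by (simp add: e_conv)
    also have "\<dots> \<le> b 0 * b 0"
      using e0 e_inner[of n n] decseqD[OF bdec, of 0 "Suc (n + n)"] b1[of 0]
      by (intro mult_mono) (auto intro: inner_prod_ge_0 order_trans[OF _ b1])
    finally have "(e (Suc n) x)\<^sup>2 \<le> (b 0)\<^sup>2" by (simp add: power2_eq_square)
    then have "\<bar>e (Suc n) x\<bar> \<le> \<bar>b 0\<bar>" by (simp only: abs_le_square_iff)
    then show ?thesis using b1[of 0] by simp
  qed
  have bound2: "\<bar>e (Suc n) x * e (Suc m) y\<bar> \<le> b 0 * b 0" for n m x y
    unfolding abs_mult using bound b1[of 0] by (intro mult_mono) auto
  have "conv p p = p"
  proof
    fix x
    have "(\<lambda>n. conv (e (Suc n)) (e (Suc n)) x) \<longlonglongrightarrow> conv p p x"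
      unfolding conv_def
      by (rule integral_dominated_convergence[where w = "\<lambda>_. b 0 * b 0"])
        (auto intro!: measurable_haar continuous_intros continuous_on_compose_UNIV[OF e] e p_cont
          continuous_on_compose_UNIV[OF p_cont] tendsto_mult lim bound2)
    \<comment> \<open>The convolution square of a term is a later term of the same sequence, so it
      has the same limit.\<close>
    moreover have "(\<lambda>n. conv (e (Suc n)) (e (Suc n)) x) \<longlonglongrightarrow> p x"
    proof -
      have "filterlim (\<lambda>n. Suc (Suc (n + n))) sequentially sequentially"
        by (rule filterlim_subseq) (auto simp: strict_mono_def)
      from filterlim_compose[OF lim[of x] this] show ?thesis by (simp add: e_conv)
    qed
    ultimately show "conv p p x = p x" by (rule LIMSEQ_unique)
  qed
  moreover have "inner_prod p p > 0"
  proof -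
    \<comment> \<open>All squared norms along the sequence are values of \<open>b\<close>, hence at
      least 1, and the limit inherits this bound.\<close>
    have "(\<lambda>n. inner_prod (e (Suc n)) (e (Suc n))) \<longlonglongrightarrow> inner_prod p p"
      unfolding inner_prod_def
      by (rule integral_dominated_convergence[where w = "\<lambda>_. b 0 * b 0"])
        (auto intro!: measurable_haar continuous_intros e p_cont tendsto_mult lim
          abs_le_D1[OF bound2])
    then have "inner_prod p p \<ge> 1"
      by (rule LIMSEQ_le_const) (auto simp: e_inner b1)
    then show ?thesis by simp
  qed
  moreover have "(LINT x|\<mu>. of_real (p x) * \<phi> x) = 0"
    if \<phi>: "continuous_on UNIV \<phi>" and 0: "\<And>n. (LINT x|\<mu>. of_real (conv_power k n x) * \<phi> x) = 0"
    for \<phi> :: "'g \<Rightarrow> complex"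
  proof -
    have "(\<lambda>n. LINT x|\<mu>. of_real (e (Suc n) x) * \<phi> x) \<longlonglongrightarrow> (LINT x|\<mu>. of_real (p x) * \<phi> x)"
    proof (rule integral_dominated_convergence[where w = "\<lambda>x. b 0 * norm (\<phi> x)"])
      show "integrable \<mu> (\<lambda>x. b 0 * norm (\<phi> x))"
        by (intro integrable_continuous continuous_intros \<phi>)
      show "AE x in \<mu>. norm (of_real (e (Suc n) x) * \<phi> x) \<le> b 0 * norm (\<phi> x)" for n
        using bound by (auto simp: norm_mult intro!: mult_right_mono)
      show "AE x in \<mu>. (\<lambda>n. of_real (e (Suc n) x) * \<phi> x) \<longlonglongrightarrow> of_real (p x) * \<phi> x"
        using lim by (intro AE_I2 tendsto_mult tendsto_of_real tendsto_const)
    qed (auto intro!: measurable_haar continuous_intros e p_cont \<phi>)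
    moreover have "(LINT x|\<mu>. of_real (e (Suc n) x) * \<phi> x) = 0" for n
    proof -
      have "(LINT x|\<mu>. of_real (e (Suc n) x) * \<phi> x) =
          (LINT x|\<mu>. of_real (conv_power k (2 * Suc n + 1) x) * \<phi> x) / of_real (L ^ Suc (Suc n))"
        unfolding e_def K_def by (simp only: of_real_divide times_divide_eq_left integral_divide_zero)
      then show ?thesis by (simp only: 0 div_0)
    qed
    ultimately show ?thesis using LIMSEQ_unique[OF _ tendsto_const] by fastforce
  qed
  ultimately show thesis using that p_cont by blast
qed

end

section \<open>Separation of points by unitary representations\<close>

text \<open>\<open>unitary_rep\<close> demands multiplicativity only. The matrix \<pi> 0 is an
  invertible idempotent, hence the identity, and then \<pi> (- g) is the inverse of the unitary
  matrix \<pi> g.\<close>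

lemma unitary_rep_minus:
  assumes "unitary_rep \<pi>"
  shows "\<pi> (- g) = mat_adjoint (\<pi> g)" "\<pi> 0 = 1\<^sub>m (rdim \<pi>)"
proof -
  let ?d = "rdim \<pi>"
  have u: "\<pi> g \<in> carrier_mat ?d ?d" "\<pi> g * mat_adjoint (\<pi> g) = 1\<^sub>m ?d"
    "mat_adjoint (\<pi> g) * \<pi> g = 1\<^sub>m ?d" for g
    using assms unfolding unitary_rep_def unitary_mat_def by auto
  have h: "\<pi> (g + h) = \<pi> g * \<pi> h" for g h
    using assms unfolding unitary_rep_def by auto
  have a: "mat_adjoint (\<pi> g) \<in> carrier_mat ?d ?d" for g using u(1) by auto
  have "\<pi> 0 = mat_adjoint (\<pi> 0) * \<pi> 0 * \<pi> 0"
    using u[of 0] by simp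
  also have "\<dots> = mat_adjoint (\<pi> 0) * \<pi> 0"
    using h[of 0 0] u(1)[of 0] a[of 0] by (simp add: assoc_mult_mat[OF a u(1) u(1)])
  finally show one: "\<pi> 0 = 1\<^sub>m ?d" using u(3) by simp
  have "\<pi> (- g) = mat_adjoint (\<pi> g) * \<pi> g * \<pi> (- g)"
    using u(1)[of "- g"] u(3)[of g] by simp
  also have "\<dots> = mat_adjoint (\<pi> g) * \<pi> 0"
    using h[of g "- g"] by (simp add: assoc_mult_mat[OF a u(1) u(1)])
  also have "\<dots> = mat_adjoint (\<pi> g)" using right_mult_one_mat[OF a[of g]] by (simp add: one)
  finally show "\<pi> (- g) = mat_adjoint (\<pi> g)" .
qed

lemma unitary_rep_carrier: "unitary_rep \<pi> \<Longrightarrow> \<pi> g \<in> carrier_mat (rdim \<pi>) (rdim \<pi>)"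
  unfolding unitary_rep_def unitary_mat_def by auto

lemma unitary_rep_dims:
  assumes "unitary_rep \<pi>"
  shows "dim_row (\<pi> g) = rdim \<pi>" "dim_col (\<pi> g) = rdim \<pi>"
  using unitary_rep_carrier[OF assms, of g] by auto

lemma unitary_rep_add: "unitary_rep \<pi> \<Longrightarrow> \<pi> (g + h) = \<pi> g * \<pi> h"
  unfolding unitary_rep_def by auto

lemma unitary_rep_continuous:
  "unitary_rep \<pi> \<Longrightarrow> i < rdim \<pi> \<Longrightarrow> j < rdim \<pi> \<Longrightarrow> continuous_on UNIV (\<lambda>g. \<pi> g $$ (i, j))"
  unfolding unitary_rep_def by auto

lemma unitary_rep_add_index:
  assumes "unitary_rep \<pi>" "i < rdim \<pi>" "j < rdim \<pi>"
  shows "\<pi> (g + h) $$ (i, j) = (\<Sum>r<rdim \<pi>. \<pi> g $$ (i, r) * \<pi> h $$ (r, j))"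
  unfolding unitary_rep_add[OF assms(1)]
  by (rule mat_mult_index[OF unitary_rep_carrier unitary_rep_carrier]) (use assms in auto)

context compact_haar
begin

section \<open>Finite-dimensional range of convolution with an idempotent\<close>

definition orthonormal_family :: "('g \<Rightarrow> real) set \<Rightarrow> nat \<Rightarrow> (nat \<Rightarrow> 'g \<Rightarrow> real) \<Rightarrow> bool" where
  "orthonormal_family V m b \<longleftrightarrow>
     (\<forall>i<m. b i \<in> V) \<and> (\<forall>i<m. \<forall>j<m. inner_prod (b i) (b j) = (if i = j then 1 else 0))"

lemma Bessel_inequality:
  assumes f: "continuous_on UNIV f" and b: "orthonormal_family V m b"
    and V: "\<And>h. h \<in> V \<Longrightarrow> continuous_on UNIV h"
  shows "(\<Sum>i<m. (inner_prod (b i) f)\<^sup>2) \<le> inner_prod f f"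
proof -
  let ?s = "\<lambda>x. \<Sum>i<m. inner_prod (b i) f * b i x"
  have b_cont: "i < m \<Longrightarrow> continuous_on UNIV (b i)" for i
    using b V by (auto simp: orthonormal_family_def)
  have s_cont: "continuous_on UNIV ?s" by (intro continuous_intros b_cont) auto
  have fs: "inner_prod ?s f = (\<Sum>i<m. (inner_prod (b i) f)\<^sup>2)"
    by (subst inner_prod_sum_left) (auto simp: b_cont f power2_eq_square)
  have bs: "inner_prod (b j) ?s = inner_prod (b j) f" if "j < m" for j
  proof -
    have "inner_prod ?s (b j) = (\<Sum>i<m. inner_prod (b i) f * inner_prod (b i) (b j))"
      by (subst inner_prod_sum_left) (auto simp: b_cont that)
    also have "\<dots> = (\<Sum>i<m. if i = j then inner_prod (b j) f else 0)"
      using b that by (intro sum.cong) (auto simp: orthonormal_family_def)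
    finally show ?thesis using that by (simp add: inner_prod_commute)
  qed
  have ss: "inner_prod ?s ?s = (\<Sum>i<m. (inner_prod (b i) f)\<^sup>2)"
    by (subst inner_prod_sum_left) (auto simp: b_cont s_cont bs power2_eq_square)
  have "0 \<le> inner_prod (\<lambda>x. f x - ?s x) (\<lambda>x. f x - ?s x)" by (rule inner_prod_ge_0)
  then show ?thesis
    unfolding inner_prod_diff_self[OF f s_cont] ss
    using fs by (simp add: inner_prod_commute[of f ?s])
qed

text \<open>
  The range of convolution with a continuous idempotent \<open>p\<close> is finite-dimensional because
  Bessel's inequality for the functions \<open>z \<mapsto> p (x - z)\<close>, integrated over \<open>x\<close>, bounds the size of
  an orthonormal family by \<open>\<parallel>p\<parallel>\<^sup>2\<close>.
\<close>

lemma conv_fixed_basis: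
  assumes p: "continuous_on UNIV p"
  defines "V \<equiv> {f. continuous_on UNIV f \<and> conv p f = f}"
  obtains m b where "orthonormal_family V m b"
    "\<And>f x. f \<in> V \<Longrightarrow> f x = (\<Sum>i<m. inner_prod (b i) f * b i x)"
proof -
  have V: "\<And>f. f \<in> V \<Longrightarrow> continuous_on UNIV f" by (simp add: V_def)
  have bound: "real m \<le> inner_prod p p" if b: "orthonormal_family V m b" for m b
  proof -
    have b_cont: "i < m \<Longrightarrow> continuous_on UNIV (b i)" for i
      using b by (auto simp: orthonormal_family_def V_def)
    have "(\<Sum>i<m. (b i x)\<^sup>2) \<le> inner_prod p p" for x
    proof -
      have "b i x = inner_prod (b i) (\<lambda>z. p (x - z))" if "i < m" for i
      proof -
        have "b i x = conv p (b i) x" using b that by (simp add: orthonormal_family_def V_def)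
        then show ?thesis by (simp add: conv_def inner_prod_def mult.commute)
      qed
      then have "(\<Sum>i<m. (b i x)\<^sup>2) = (\<Sum>i<m. (inner_prod (b i) (\<lambda>z. p (x - z)))\<^sup>2)"
        by simp
      also have "\<dots> \<le> inner_prod (\<lambda>z. p (x - z)) (\<lambda>z. p (x - z))"
        by (intro Bessel_inequality[OF _ b V] continuous_on_compose_UNIV[OF p] continuous_intros)
      finally show ?thesis by (simp add: inner_prod_reflect p)
    qed
    then have "(LINT x|\<mu>. (\<Sum>i<m. (b i x)\<^sup>2)) \<le> (LINT x|\<mu>. inner_prod p p)"
      by (intro integral_mono integrable_continuous continuous_intros b_cont) auto
    also have "(LINT x|\<mu>. (\<Sum>i<m. (b i x)\<^sup>2)) = (\<Sum>i<m. inner_prod (b i) (b i))"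
      unfolding inner_prod_def power2_eq_square
      by (intro Bochner_Integration.integral_sum integrable_continuous continuous_intros b_cont) auto
    also have "\<dots> = real m" using b by (simp add: orthonormal_family_def)
    finally show ?thesis by simp
  qed
  have "\<exists>b. orthonormal_family V 0 b" by (simp add: orthonormal_family_def)
  \<comment> \<open>The bound on the size yields an orthonormal family of maximal size, which is
    then shown to span V.\<close>
  moreover have "\<forall>m. (\<exists>b. orthonormal_family V m b) \<longrightarrow> m \<le> nat \<lfloor>inner_prod p p\<rfloor>"
    using bound le_nat_floor by blast
  ultimately obtain m where m: "\<exists>b. orthonormal_family V m b"
    and max: "\<And>m'. \<exists>b. orthonormal_family V m' b \<Longrightarrow> m' \<le> m"
    using Greatest_le_nat[of "\<lambda>m. \<exists>b. orthonormal_family V m b"]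
      GreatestI_nat[of "\<lambda>m. \<exists>b. orthonormal_family V m b"] by metis
  then obtain b where b: "orthonormal_family V m b" by blast
  have b_cont: "i < m \<Longrightarrow> continuous_on UNIV (b i)" for i
    using b by (auto simp: orthonormal_family_def V_def)
  have b_conv: "i < m \<Longrightarrow> conv p (b i) = b i" for i
    using b by (auto simp: orthonormal_family_def V_def)
  have "f x = (\<Sum>i<m. inner_prod (b i) f * b i x)" if f: "f \<in> V" for f x
  proof -
    have fc: "continuous_on UNIV f" and ff: "conv p f = f" using f by (auto simp: V_def)
    define s where "s = (\<lambda>x. \<Sum>i<m. inner_prod (b i) f * b i x)"
    define u where "u = (\<lambda>x. f x - s x)"
    have s_cont: "continuous_on UNIV s" unfolding s_def by (intro continuous_intros b_cont) auto
    have u_cont: "continuous_on UNIV u" unfolding u_def by (intro continuous_intros fc s_cont)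
    have sx: "conv p s x = s x" for x
    proof -
      have "conv p s x = (LINT z|\<mu>. (\<Sum>i<m. inner_prod (b i) f * (p (x - z) * b i z)))"
        unfolding conv_def s_def by (simp add: sum_distrib_left mult_ac)
      also have "\<dots> = (\<Sum>i<m. LINT z|\<mu>. inner_prod (b i) f * (p (x - z) * b i z))"
        by (intro Bochner_Integration.integral_sum integrable_continuous continuous_intros b_cont
            continuous_on_compose_UNIV[OF p]) auto
      also have "\<dots> = (\<Sum>i<m. inner_prod (b i) f * conv p (b i) x)"
        unfolding conv_def by simp
      finally show ?thesis by (simp add: b_conv s_def)
    qed
    have ux: "conv p u x = u x" for x
    proof -
      have "conv p u x = (LINT z|\<mu>. p (x - z) * f z - p (x - z) * s z)"
        unfolding conv_def u_def by (simp add: algebra_simps)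
      also have "\<dots> = conv p f x - conv p s x"
        unfolding conv_def
        by (intro Bochner_Integration.integral_diff integrable_continuous continuous_intros
            continuous_on_compose_UNIV[OF p] fc s_cont)
      finally show ?thesis by (simp add: ff sx u_def)
    qed
    have ub: "inner_prod u (b j) = 0" if j: "j < m" for j
    proof -
      have "inner_prod s (b j) = (\<Sum>i<m. inner_prod (b i) f * inner_prod (b i) (b j))"
        unfolding s_def by (subst inner_prod_sum_left) (auto simp: b_cont j)
      also have "\<dots> = (\<Sum>i<m. if i = j then inner_prod (b j) f else 0)"
        using b j by (intro sum.cong) (auto simp: orthonormal_family_def)
      also have "\<dots> = inner_prod f (b j)" using j by (simp add: inner_prod_commute)
      finally have "inner_prod s (b j) = inner_prod f (b j)" .
      moreover have "inner_prod u (b j) = inner_prod f (b j) - inner_prod s (b j)"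
        unfolding u_def inner_prod_def left_diff_distrib
        by (intro Bochner_Integration.integral_diff integrable_continuous continuous_intros
            fc s_cont b_cont j)
      ultimately show ?thesis by simp
    qed
    have "inner_prod u u = 0"
    proof (rule ccontr)
      assume "inner_prod u u \<noteq> 0"
      then have pos: "inner_prod u u > 0" using inner_prod_ge_0[of u] by simp
      define t where "t = 1 / sqrt (inner_prod u u)"
      have t: "t * (t * inner_prod u u) = 1"
        using pos by (simp add: t_def field_simps real_sqrt_mult_self)
      define w where "w = (\<lambda>x. t * u x)"
      have "conv p w x = t * conv p u x" for x
        unfolding conv_def w_def by (simp add: mult.left_commute)
      then have "w \<in> V"
        unfolding V_def by (auto simp: w_def ux intro!: continuous_intros u_cont)
      \<comment> \<open>A nonzero remainder u lies in V and is orthogonal to the family, so its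
        normalisation would enlarge a maximal family.\<close>
      then have "orthonormal_family V (Suc m) (\<lambda>i. if i = m then w else b i)"
        using b ub t unfolding orthonormal_family_def
        by (auto simp: less_Suc_eq w_def inner_prod_scale_left inner_prod_scale_right
            inner_prod_commute[of "b _" u])
      then show False using max[of "Suc m"] by auto
    qed
    \<comment> \<open>A vanishing L2 norm forces u to vanish at every point because u equals its own
      convolution with p.\<close>
    then have "(u x)\<^sup>2 \<le> 0"
      using conv_square_le[OF p u_cont, of x] by (simp add: ux)
    then show ?thesis by (simp add: u_def s_def)
  qed
  then show thesis using that b by blast
qed

lemma conv_translate:
  assumes p: "continuous_on UNIV p" and f: "continuous_on UNIV f"
  shows "conv p (\<lambda>x. f (x + g)) x = conv p f (x + g)"
proof -
  have "conv p f (x + g) = (LINT z|\<mu>. p (x + g - (z + g)) * f (z + g))"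
    unfolding conv_def
    by (rule integral_right_translate[of "\<lambda>z. p (x + g - z) * f z" g, symmetric])
      (intro continuous_on_compose_UNIV[OF p] continuous_on_compose_UNIV[OF f] continuous_intros)
  then show ?thesis by (simp add: conv_def diff_add_eq_diff_diff_swap)
qed

lemma inner_prod_translate:
  assumes f: "continuous_on UNIV f" and h: "continuous_on UNIV h"
  shows "inner_prod (\<lambda>x. f (x + g)) (\<lambda>x. h (x + g)) = inner_prod f h"
  unfolding inner_prod_def
  by (rule integral_right_translate) (intro continuous_intros f h)

text \<open>
  Right translations act on the range of convolution with \<open>p\<close>; the resulting orthogonal
  representation has \<open>p\<close> in the span of its matrix coefficients.
\<close>

lemma conv_idempotent_not_orthogonal:
  assumes p: "continuous_on UNIV p" and pp: "conv p p = p" and pos: "inner_prod p p > 0"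
  obtains \<rho> :: "'g \<Rightarrow> complex mat" and i j where "unitary_rep \<rho>" "i < rdim \<rho>" "j < rdim \<rho>"
    "(LINT x|\<mu>. of_real (p x) * \<rho> x $$ (i, j)) \<noteq> 0"
proof -
  define V where "V = {f. continuous_on UNIV f \<and> conv p f = f}"
  obtain m b where b: "orthonormal_family V m b"
    and expand: "\<And>f x. f \<in> V \<Longrightarrow> f x = (\<Sum>i<m. inner_prod (b i) f * b i x)"
    using conv_fixed_basis[OF p] unfolding V_def by blast
  have b_V: "i < m \<Longrightarrow> b i \<in> V" for i using b by (auto simp: orthonormal_family_def)
  then have b_cont: "i < m \<Longrightarrow> continuous_on UNIV (b i)" for i by (auto simp: V_def)
  \<comment> \<open>The matrix of right translation by g in the orthonormal basis b. It is real and,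
    by invariance of the inner product, orthogonal.\<close>
  define r where "r = (\<lambda>g i j. inner_prod (b i) (\<lambda>x. b j (x + g)))"
  define \<rho> where "\<rho> = (\<lambda>g. mat m m (\<lambda>(i, j). complex_of_real (r g i j)))"
  have shift_V: "(\<lambda>x. f (x + g)) \<in> V" if "f \<in> V" for f g
    using that conv_translate[OF p, of f g] unfolding V_def
    by (auto intro!: continuous_on_compose_UNIV[of f] continuous_intros)
  have shift: "b j (x + g) = (\<Sum>i<m. r g i j * b i x)" if "j < m" for j g x
    unfolding r_def using expand[OF shift_V[OF b_V[OF that]]] .
  have r_cont: "continuous_on UNIV (\<lambda>g. r g i j)" if "i < m" "j < m" for i j
    unfolding r_def inner_prod_def
    by (intro continuous_on_integral continuous_on_compose_UNIV[OF b_cont] that continuous_intros)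
  have r_add: "r (g + h) i j = (\<Sum>k<m. r g i k * r h k j)" if ij: "i < m" "j < m" for g h i j
  proof -
    have "r (g + h) i j = inner_prod (\<lambda>x. b j ((x + g) + h)) (b i)"
      unfolding r_def by (simp add: inner_prod_commute add.assoc)
    also have "\<dots> = inner_prod (\<lambda>x. \<Sum>k<m. r h k j * b k (x + g)) (b i)"
      by (simp add: shift[OF ij(2), of "_ + g" h])
    also have "\<dots> = (\<Sum>k<m. r h k j * inner_prod (\<lambda>x. b k (x + g)) (b i))"
      by (rule inner_prod_sum_left)
        (auto intro!: continuous_on_compose_UNIV[OF b_cont] continuous_intros b_cont ij)
    finally show ?thesis by (simp add: r_def inner_prod_commute mult.commute)
  qed
  have r_minus: "r (- g) i j = r g j i" if "i < m" "j < m" for g i j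
  proof -
    have "r (- g) i j = inner_prod (\<lambda>x. b i (x + g)) (\<lambda>x. b j (x + g + - g))"
      unfolding r_def
      by (rule inner_prod_translate[symmetric, of "b i" "\<lambda>x. b j (x + - g)"])
        (auto intro!: continuous_on_compose_UNIV[OF b_cont] continuous_intros b_cont that)
    then show ?thesis by (simp add: r_def inner_prod_commute add.assoc)
  qed
  have r_0: "r 0 i j = (if i = j then 1 else 0)" if "i < m" "j < m" for i j
    using b that by (simp add: r_def orthonormal_family_def)
  have \<rho>: "\<rho> g \<in> carrier_mat m m" for g by (simp add: \<rho>_def)
  have dim: "rdim \<rho> = m" by (simp add: rdim_def \<rho>_def)
  have \<rho>_add: "\<rho> (g + h) = \<rho> g * \<rho> h" for g h
  proof (rule eq_matI)
    fix i j assume "i < dim_row (\<rho> g * \<rho> h)" "j < dim_col (\<rho> g * \<rho> h)"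
    then have ij: "i < m" "j < m" by (auto simp: \<rho>_def)
    show "\<rho> (g + h) $$ (i, j) = (\<rho> g * \<rho> h) $$ (i, j)"
      unfolding mat_mult_index[OF \<rho> \<rho> ij] using ij by (simp add: \<rho>_def r_add)
  qed (auto simp: \<rho>_def)
  have \<rho>_minus: "\<rho> (- g) = mat_adjoint (\<rho> g)" for g
    by (rule eq_matI) (auto simp: \<rho>_def r_minus)
  have \<rho>_0: "\<rho> 0 = 1\<^sub>m m"
    by (rule eq_matI) (auto simp: \<rho>_def r_0)
  have "unitary_mat m (\<rho> g)" for g
    unfolding unitary_mat_def using \<rho>_add[of g "- g"] \<rho>_add[of "- g" g]
    by (simp add: \<rho> \<rho>_minus \<rho>_0)
  moreover have "continuous_on UNIV (\<lambda>g. \<rho> g $$ (i, j))" if "i < m" "j < m" for i j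
    using r_cont[OF that] that by (auto simp: \<rho>_def intro!: continuous_intros)
  ultimately have rep: "unitary_rep \<rho>"
    unfolding unitary_rep_def dim using \<rho>_add by auto
  have "\<exists>i<m. \<exists>j<m. (LINT x|\<mu>. of_real (p x) * \<rho> x $$ (i, j)) \<noteq> 0"
  proof (rule ccontr)
    assume "\<not> ?thesis"
    then have 0: "(LINT x|\<mu>. p x * r x i j) = 0" if "i < m" "j < m" for i j
      using that by (auto simp: \<rho>_def simp flip: of_real_mult)
    \<comment> \<open>Read p x as the value at 0 of p translated by x: expanding p in the basis and
      translating expresses p through the entries of r x.\<close>
    have px: "p x = (\<Sum>j<m. \<Sum>i<m. inner_prod (b j) p * b i 0 * r x i j)" for x
    proof -
      have "p \<in> V" using p pp by (simp add: V_def)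
      from expand[OF this, of x] have "p x = (\<Sum>j<m. inner_prod (b j) p * b j (0 + x))" by simp
      also have "\<dots> = (\<Sum>j<m. \<Sum>i<m. inner_prod (b j) p * b i 0 * r x i j)"
        using shift[of _ 0 x] by (intro sum.cong) (auto simp: sum_distrib_left mult_ac)
      finally show ?thesis .
    qed
    have "p x * p x = (\<Sum>j<m. \<Sum>i<m. inner_prod (b j) p * b i 0 * (p x * r x i j))" for x
      by (subst (2) px) (simp add: sum_distrib_left mult_ac)
    then have "inner_prod p p = (LINT x|\<mu>. (\<Sum>j<m. \<Sum>i<m. inner_prod (b j) p * b i 0 * (p x * r x i j)))"
      by (simp add: inner_prod_def[of p p])
    also have "\<dots> = (\<Sum>j<m. \<Sum>i<m. inner_prod (b j) p * b i 0 * (LINT x|\<mu>. p x * r x i j))"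
    proof -
      have "integrable \<mu> (\<lambda>x. p x * r x i j)" if "i < m" "j < m" for i j
        by (intro integrable_continuous continuous_intros p r_cont that)
      then show ?thesis
        by (subst Bochner_Integration.integral_sum)
          (auto intro!: sum.cong simp: Bochner_Integration.integral_sum)
    qed
    also have "\<dots> = 0" using 0 by simp
    finally show False using pos by simp
  qed
  then show thesis using that rep dim by blast
qed

text \<open>After the translation x \<mapsto> x + z, multiplicativity of \<rho> turns the inner
  integral into a combination of integrals of k against coefficients of \<rho>, all of which vanish.
  The leftmost factor k already does this, so a case split on n replaces an induction.\<close>

lemma conv_power_orthogonal:
  assumes k: "continuous_on UNIV k" and \<rho>: "unitary_rep \<rho>"
    and 0: "\<And>i j. i < rdim \<rho> \<Longrightarrow> j < rdim \<rho> \<Longrightarrow> (LINT x|\<mu>. of_real (k x) * \<rho> x $$ (i, j)) = 0"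
    and ij: "i < rdim \<rho>" "j < rdim \<rho>"
  shows "(LINT x|\<mu>. of_real (conv_power k n x) * \<rho> x $$ (i, j)) = 0"
proof (cases n)
  case 0
  then show ?thesis using assms by simp
next
  case (Suc n)
  let ?h = "conv_power k n"
  note h = continuous_conv_power[OF k, of n]
  note \<rho>_cont = unitary_rep_continuous[OF \<rho>]
  have "(LINT x|\<mu>. of_real (conv_power k (Suc n) x) * \<rho> x $$ (i, j)) =
      (LINT x|\<mu>. LINT z|\<mu>. of_real (k (x - z) * ?h z) * \<rho> x $$ (i, j))"
    by (simp add: conv_def del: of_real_mult flip: integral_complex_of_real)
  also have "\<dots> = (LINT z|\<mu>. LINT x|\<mu>. of_real (k (x - z) * ?h z) * \<rho> x $$ (i, j))"
    by (intro Fubini_continuous continuous_on_compose_UNIV[OF k] continuous_on_compose_UNIV[OF h]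
        continuous_on_compose_UNIV[OF \<rho>_cont[OF ij]] continuous_intros)
  also have "\<dots> = (LINT z|\<mu>. 0)"
  proof (rule Bochner_Integration.integral_cong[OF refl])
    fix z
    have "(LINT x|\<mu>. of_real (k (x - z) * ?h z) * \<rho> x $$ (i, j)) =
        (LINT x|\<mu>. of_real (k (x + z - z) * ?h z) * \<rho> (x + z) $$ (i, j))"
      by (rule integral_right_translate[of "\<lambda>x. of_real (k (x - z) * ?h z) * \<rho> x $$ (i, j)" z, symmetric])
        (intro continuous_on_compose_UNIV[OF k] continuous_on_compose_UNIV[OF \<rho>_cont[OF ij]]
          continuous_intros)
    also have "\<dots> = (LINT x|\<mu>. (\<Sum>l<rdim \<rho>. of_real (?h z) * \<rho> z $$ (l, j) * (of_real (k x) * \<rho> x $$ (i, l))))"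
      unfolding unitary_rep_add_index[OF \<rho> ij] by (simp add: sum_distrib_left mult_ac)
    also have "\<dots> = (\<Sum>l<rdim \<rho>. LINT x|\<mu>. of_real (?h z) * \<rho> z $$ (l, j) * (of_real (k x) * \<rho> x $$ (i, l)))"
      by (intro Bochner_Integration.integral_sum integrable_continuous continuous_intros k \<rho>_cont ij) auto
    also have "\<dots> = 0" by (simp add: assms(3) ij)
    finally show "(LINT x|\<mu>. of_real (k (x - z) * ?h z) * \<rho> x $$ (i, j)) = 0" .
  qed
  finally show ?thesis using Suc by simp
qed

lemma continuous_separates:
  assumes "(a :: 'g) \<noteq> b"
  obtains u :: "'g \<Rightarrow> real" where "continuous_on UNIV u" "u a \<noteq> u b"
proof -
  have "Hausdorff_space (euclidean :: 'g topology)"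
    unfolding Hausdorff_space_def using hausdorff by (fastforce simp: disjnt_def)
  moreover have "compact_space (euclidean :: 'g topology)"
    using compact_UNIV by (simp add: compact_space_def)
  ultimately have "normal_space (euclidean :: 'g topology)"
    by (simp add: compact_Hausdorff_or_regular_imp_normal_space)
  then obtain u where "continuous_map euclidean (top_of_set {0..1::real}) u" "u ` {a} \<subseteq> {0}" "u ` {b} \<subseteq> {1}"
    using Urysohn_lemma[of euclidean "{a}" "{b}" 0 1] assms by auto
  then show thesis
    using that[of u] by (auto simp: continuous_map_in_subtopology)
qed

lemma unitary_rep_separates:
  assumes y: "(y :: 'g) \<noteq> 0"
  obtains \<rho> where "unitary_rep \<rho>" "\<rho> y \<noteq> 1\<^sub>m (rdim \<rho>)"
proof (rule ccontr)
  assume "\<not> thesis"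
  with that have triv: "\<And>\<rho> :: 'g \<Rightarrow> complex mat. unitary_rep \<rho> \<Longrightarrow> \<rho> y = 1\<^sub>m (rdim \<rho>)" by blast
  obtain u :: "'g \<Rightarrow> real" where u: "continuous_on UNIV u" and uy: "u 0 \<noteq> u y"
    using continuous_separates y by metis
  \<comment> \<open>If all representations are trivial at y, their coefficients have period y, and
    right invariance makes v orthogonal to them. Moreover v 0 = u 0 - u y is nonzero, and the
    symmetrisation k satisfies k 0 = 2 * v 0.\<close>
  define v where "v = (\<lambda>x. u x - u (x + y))"
  define k where "k = (\<lambda>x. v x + v (- x))"
  have v: "continuous_on UNIV v"
    unfolding v_def by (intro continuous_intros continuous_on_compose_UNIV[OF u])
  have k: "continuous_on UNIV k"
    unfolding k_def by (intro continuous_intros continuous_on_compose_UNIV[OF v])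
  obtain p where p: "continuous_on UNIV p" "conv p p = p" "inner_prod p p > 0"
    and p_orth: "\<And>\<phi> :: 'g \<Rightarrow> complex. continuous_on UNIV \<phi> \<Longrightarrow>
      (\<And>n. (LINT x|\<mu>. of_real (conv_power k n x) * \<phi> x) = 0) \<Longrightarrow>
      (LINT x|\<mu>. of_real (p x) * \<phi> x) = 0"
    by (rule conv_idempotent_exists[OF k]) (use uy in \<open>auto simp: k_def v_def\<close>)
  obtain \<rho> i j where \<rho>: "unitary_rep \<rho>" and ij: "i < rdim \<rho>" "j < rdim \<rho>"
    and ne: "(LINT x|\<mu>. of_real (p x) * \<rho> x $$ (i, j)) \<noteq> 0"
    using conv_idempotent_not_orthogonal[OF p] by metis
  note \<rho>_cont = unitary_rep_continuous[OF \<rho>]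
  have per: "\<rho> (x + y) = \<rho> x" for x
    using unitary_rep_add[OF \<rho>, of x y] triv[OF \<rho>] unitary_rep_carrier[OF \<rho>, of x] by simp
  have v0: "(LINT x|\<mu>. of_real (v x) * \<rho> x $$ (i, j)) = 0" if "i < rdim \<rho>" "j < rdim \<rho>" for i j
  proof -
    have "(LINT x|\<mu>. of_real (v x) * \<rho> x $$ (i, j)) =
        (LINT x|\<mu>. of_real (u x) * \<rho> x $$ (i, j) - of_real (u (x + y)) * \<rho> (x + y) $$ (i, j))"
      by (simp add: v_def per algebra_simps)
    also have "\<dots> = (LINT x|\<mu>. of_real (u x) * \<rho> x $$ (i, j)) -
        (LINT x|\<mu>. of_real (u (x + y)) * \<rho> (x + y) $$ (i, j))"
      by (intro Bochner_Integration.integral_diff integrable_continuous continuous_intros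
          u \<rho>_cont that continuous_on_compose_UNIV[OF u] continuous_on_compose_UNIV[OF \<rho>_cont[OF that]])
    also have "(LINT x|\<mu>. of_real (u (x + y)) * \<rho> (x + y) $$ (i, j)) =
        (LINT x|\<mu>. of_real (u x) * \<rho> x $$ (i, j))"
      by (rule integral_right_translate[of "\<lambda>x. of_real (u x) * \<rho> x $$ (i, j)"])
        (intro continuous_intros u \<rho>_cont that)
    finally show ?thesis by simp
  qed
  have k0: "(LINT x|\<mu>. of_real (k x) * \<rho> x $$ (i, j)) = 0" if ij: "i < rdim \<rho>" "j < rdim \<rho>" for i j
  proof -
    have v': "continuous_on UNIV (\<lambda>x. v (- x))"
      by (intro continuous_on_compose_UNIV[OF v] continuous_intros)
    \<comment> \<open>Inversion sends each coefficient of \<rho> to the conjugate of the transposed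
      coefficient. As v is real, the integral is the conjugate of one that is already known to
      vanish.\<close>
    have "(LINT x|\<mu>. of_real (v (- x)) * \<rho> x $$ (i, j)) =
        (LINT x|\<mu>. of_real (v (- (- x))) * \<rho> (- x) $$ (i, j))"
      by (rule integral_uminus[of "\<lambda>x. of_real (v (- x)) * \<rho> x $$ (i, j)", symmetric])
        (intro continuous_intros v' \<rho>_cont ij)
    also have "\<dots> = (LINT x|\<mu>. cnj (of_real (v x) * \<rho> x $$ (j, i)))"
      by (simp add: unitary_rep_minus(1)[OF \<rho>] unitary_rep_dims[OF \<rho>] ij)
    also have "\<dots> = cnj (LINT x|\<mu>. of_real (v x) * \<rho> x $$ (j, i))"
      by (rule Bochner_Integration.integral_cnj)
    finally have v'0: "(LINT x|\<mu>. of_real (v (- x)) * \<rho> x $$ (i, j)) = 0" by (simp add: v0 ij)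
    have "(LINT x|\<mu>. of_real (k x) * \<rho> x $$ (i, j)) =
        (LINT x|\<mu>. of_real (v x) * \<rho> x $$ (i, j) + of_real (v (- x)) * \<rho> x $$ (i, j))"
      by (simp add: k_def algebra_simps)
    also have "\<dots> = (LINT x|\<mu>. of_real (v x) * \<rho> x $$ (i, j)) +
        (LINT x|\<mu>. of_real (v (- x)) * \<rho> x $$ (i, j))"
      by (intro Bochner_Integration.integral_add integrable_continuous continuous_intros
          v v' \<rho>_cont ij)
    finally show ?thesis by (simp add: v0 ij v'0)
  qed
  have "(LINT x|\<mu>. of_real (p x) * \<rho> x $$ (i, j)) = 0"
    by (intro p_orth \<rho>_cont ij conv_power_orthogonal[OF k \<rho> k0])
  then show False using ne by simp
qed

end

section \<open>Schur's lemma\<close>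

text \<open>
  Variants of the matrix laws with dimension conditions that the simplifier can discharge
  (the carrier conditions of the library leave dimensions uninstantiated).
\<close>

lemma mat_mult_assoc:
  fixes A B C :: "complex mat"
  assumes "dim_col A = dim_row B" "dim_col B = dim_row C"
  shows "A * B * C = A * (B * C)"
  by (rule assoc_mult_mat[of A "dim_row A" "dim_row B" B "dim_row C" C "dim_col C"])
    (use assms in auto)

lemma mat_mult_vec_assoc:
  fixes A B :: "complex mat"
  assumes "dim_col A = dim_row B" "dim_col B = dim_vec v"
  shows "(A * B) *\<^sub>v v = A *\<^sub>v (B *\<^sub>v v)"
  by (rule assoc_mult_mat_vec[of A "dim_row A" "dim_row B" B "dim_vec v" v])
    (use assms in \<open>auto intro: carrier_vecI\<close>)

lemma mat_mult_one_left:
  fixes A :: "complex mat"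
  shows "dim_row A = n \<Longrightarrow> 1\<^sub>m n * A = A"
  by (rule left_mult_one_mat[of A n "dim_col A"]) auto

lemma mat_mult_one_right:
  fixes A :: "complex mat"
  shows "dim_col A = n \<Longrightarrow> A * 1\<^sub>m n = A"
  by (rule right_mult_one_mat[of A "dim_row A" n]) auto

lemma mat_adjoint_mult:
  fixes A B :: "complex mat"
  assumes "dim_col A = dim_row B"
  shows "mat_adjoint (A * B) = mat_adjoint B * mat_adjoint A"
proof (rule eq_matI)
  fix i j assume "i < dim_row (mat_adjoint B * mat_adjoint A)" "j < dim_col (mat_adjoint B * mat_adjoint A)"
  then have ij: "i < dim_col B" "j < dim_row A" by auto
  then show "mat_adjoint (A * B) $$ (i, j) = (mat_adjoint B * mat_adjoint A) $$ (i, j)"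
    using assms by (auto simp: scalar_prod_def mult.commute intro!: sum.cong)
qed auto

lemma mat_adjoint_adjoint [simp]:
  fixes A :: "complex mat"
  shows "mat_adjoint (mat_adjoint A) = A"
  by (rule eq_matI) auto

lemma mat_vec_index:
  assumes "A \<in> carrier_mat n m" "v \<in> carrier_vec m" "i < n"
  shows "vec_index (A *\<^sub>v v) i = (\<Sum>j<m. A $$ (i, j) * vec_index v j)"
  using assms by (auto simp: scalar_prod_def lessThan_atLeast0)

lemma mat_eqI_vec:
  fixes A B :: "complex mat"
  assumes A: "A \<in> carrier_mat n k" and B: "B \<in> carrier_mat n k"
    and eq: "\<And>v. v \<in> carrier_vec k \<Longrightarrow> A *\<^sub>v v = B *\<^sub>v v"
  shows "A = B"
proof (rule eq_matI)
  fix i j assume "i < dim_row B" "j < dim_col B"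
  then have ij: "i < n" "j < k" using B by auto
  have *: "vec_index (C *\<^sub>v unit_vec k j) i = C $$ (i, j)" if C: "C \<in> carrier_mat n k" for C :: "complex mat"
  proof -
    have "vec_index (C *\<^sub>v unit_vec k j) i = (\<Sum>l<k. C $$ (i, l) * vec_index (unit_vec k j) l)"
      by (rule mat_vec_index[OF C]) (use ij in auto)
    also have "\<dots> = (\<Sum>l<k. if l = j then C $$ (i, j) else 0)"
      using ij by (intro sum.cong) auto
    finally show ?thesis using ij by simp
  qed
  show "A $$ (i, j) = B $$ (i, j)" using *[OF A] *[OF B] eq[of "unit_vec k j"] by simp
qed (use A B in auto)

section \<open>Traces, isometries and Schur's lemma\<close>

definition mtrace :: "complex mat \<Rightarrow> complex" where
  "mtrace A = (\<Sum>i<dim_row A. A $$ (i, i))"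

lemma mtrace_commute:
  assumes A: "A \<in> carrier_mat n m" and B: "B \<in> carrier_mat m n"
  shows "mtrace (A * B) = mtrace (B * A)"
proof -
  have "mtrace (A * B) = (\<Sum>i<n. \<Sum>j<m. A $$ (i, j) * B $$ (j, i))"
    unfolding mtrace_def using A by (intro sum.cong) (auto simp del: index_mult_mat(1) simp: mat_mult_index[OF A B])
  also have "\<dots> = (\<Sum>j<m. \<Sum>i<n. B $$ (j, i) * A $$ (i, j))"
    by (subst sum.swap) (simp add: mult.commute)
  also have "\<dots> = mtrace (B * A)"
    unfolding mtrace_def using B by (intro sum.cong) (auto simp del: index_mult_mat(1) simp: mat_mult_index[OF B A])
  finally show ?thesis .
qed

lemma mtrace_one: "mtrace (1\<^sub>m n) = of_nat n"
  by (simp add: mtrace_def)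

text \<open>The matrix P = A A* is a self-adjoint idempotent. Its n diagonal entries have real part
  at most 1, and its trace is that of A* A, namely k.\<close>

lemma isometry_dim_le:
  fixes A :: "complex mat"
  assumes A: "A \<in> carrier_mat n k" and iso: "mat_adjoint A * A = 1\<^sub>m k"
  shows "k \<le> n"
proof -
  define P where "P = A * mat_adjoint A"
  have P: "P \<in> carrier_mat n n" using A by (auto simp: P_def)
  have adj: "mat_adjoint P = P" using A by (simp add: P_def mat_adjoint_mult)
  have PP: "P * P = P"
  proof -
    have "P * P = A * (mat_adjoint A * A) * mat_adjoint A"
      using A by (simp add: P_def mat_mult_assoc)
    then show ?thesis using A by (simp add: iso P_def mat_mult_one_right)
  qed
  have le: "Re (P $$ (i, i)) \<le> 1" if i: "i < n" for i
  proof -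
    have sym: "P $$ (r, i) = cnj (P $$ (i, r))" if "r < n" for r
      using mat_adjoint_index[of r P i] P i that by (simp add: adj)
    have "P $$ (i, i) = (\<Sum>r<n. P $$ (i, r) * P $$ (r, i))"
      using mat_mult_index[OF P P i i] by (simp add: PP)
    also have "\<dots> = (\<Sum>r<n. of_real ((cmod (P $$ (i, r)))\<^sup>2))"
      by (intro sum.cong) (auto simp: sym complex_norm_square simp del: of_real_power)
    finally have eq: "P $$ (i, i) = of_real (\<Sum>r<n. (cmod (P $$ (i, r)))\<^sup>2)" by simp
    have "cmod (P $$ (i, i)) = \<bar>\<Sum>r<n. (cmod (P $$ (i, r)))\<^sup>2\<bar>"
      using arg_cong[OF eq, of cmod] by (simp only: norm_of_real)
    also have "\<dots> = (\<Sum>r<n. (cmod (P $$ (i, r)))\<^sup>2)"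
      by (simp add: sum_nonneg)
    \<comment> \<open>The sum of squares over row i contains the square of the diagonal entry, so
      that entry has modulus at least the square of its modulus, hence at most 1.\<close>
    also have "\<dots> \<ge> (cmod (P $$ (i, i)))\<^sup>2"
      using i by (intro member_le_sum[of i "{..<n}" "\<lambda>r. (cmod (P $$ (i, r)))\<^sup>2"]) auto
    finally have "cmod (P $$ (i, i)) \<le> 1"
      by (cases "cmod (P $$ (i, i)) = 0") (auto simp: power2_eq_square mult_le_cancel_left)
    then show ?thesis using complex_Re_le_cmod[of "P $$ (i, i)"] by linarith
  qed
  have "mtrace P = of_nat k"
    unfolding P_def using mtrace_commute[of A n k "mat_adjoint A"] A by (simp add: iso mtrace_one)
  then have "real k = (\<Sum>i<n. Re (P $$ (i, i)))"
    using P by (simp add: mtrace_def complex_eq_iff)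
  also have "\<dots> \<le> (\<Sum>i<n. 1)" using le by (intro sum_mono) auto
  finally show ?thesis by simp
qed

lemma subspace_vecI:
  assumes "W \<subseteq> carrier_vec n" "0\<^sub>v n \<in> W" "\<And>u v. u \<in> W \<Longrightarrow> v \<in> W \<Longrightarrow> u + v \<in> W"
    "\<And>c v. v \<in> W \<Longrightarrow> c \<cdot>\<^sub>v v \<in> W"
  shows "subspace class_ring W (module_vec TYPE(complex) n)"
  using assms vec_vs[of n, where 'a = complex] vec_module[of n, where 'a = complex]
  unfolding subspace_def submodule_def by (auto simp: module_vec_simps)

lemma subspace_vecD:
  assumes "subspace class_ring W (module_vec TYPE(complex) n)"
  shows "W \<subseteq> carrier_vec n" "0\<^sub>v n \<in> W" "\<And>u v. u \<in> W \<Longrightarrow> v \<in> W \<Longrightarrow> u + v \<in> W"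
    "\<And>c v. v \<in> W \<Longrightarrow> c \<cdot>\<^sub>v v \<in> W"
  using assms unfolding subspace_def submodule_def
  by (auto simp: module_vec_simps class_ring_simps)

text \<open>The columns of A are an orthonormal basis of W; coding subspaces by isometries keeps the
  later arguments inside matrix algebra. A has the maximal number of columns, which exists by
  \<open>isometry_dim_le\<close>; a vector of W outside its range would supply one more
  column.\<close>

lemma subspace_isometry:
  assumes W: "subspace class_ring W (module_vec TYPE(complex) n)"
  obtains k A where "A \<in> carrier_mat n k" "mat_adjoint A * A = 1\<^sub>m k"
    "\<And>v. v \<in> carrier_vec k \<Longrightarrow> A *\<^sub>v v \<in> W"
    "\<And>w. w \<in> W \<Longrightarrow> A *\<^sub>v (mat_adjoint A *\<^sub>v w) = w"
proof -
  note W = subspace_vecD[OF W]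
  define Q where "Q = (\<lambda>k A. A \<in> carrier_mat n k \<and> mat_adjoint A * A = 1\<^sub>m k \<and>
    (\<forall>v\<in>carrier_vec k. A *\<^sub>v v \<in> W))"
  have "Q 0 (0\<^sub>m n 0)"
  proof -
    have "0\<^sub>m n 0 *\<^sub>v v = (0\<^sub>v n :: complex vec)" if "v \<in> carrier_vec 0" for v
      using that by (intro eq_vecI) (auto simp: scalar_prod_def)
    then show ?thesis
      unfolding Q_def using W(2) by (auto intro!: eq_matI)
  qed
  moreover have "\<forall>k. (\<exists>A. Q k A) \<longrightarrow> k \<le> n"
    unfolding Q_def using isometry_dim_le by blast
  ultimately obtain k where k: "\<exists>A. Q k A" and max: "\<And>k'. \<exists>A. Q k' A \<Longrightarrow> k' \<le> k"
    using Greatest_le_nat[of "\<lambda>k. \<exists>A. Q k A"] GreatestI_nat[of "\<lambda>k. \<exists>A. Q k A"] by metis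
  then obtain A where A: "A \<in> carrier_mat n k" and iso: "mat_adjoint A * A = 1\<^sub>m k"
    and AW: "\<And>v. v \<in> carrier_vec k \<Longrightarrow> A *\<^sub>v v \<in> W"
    unfolding Q_def by blast
  have A': "mat_adjoint A \<in> carrier_mat k n" using A by auto
  have "A *\<^sub>v (mat_adjoint A *\<^sub>v w) = w" if w: "w \<in> W" for w
  proof -
    have wc: "w \<in> carrier_vec n" using w W(1) by auto
    let ?y = "mat_adjoint A *\<^sub>v w"
    have y: "?y \<in> carrier_vec k" using A by (auto intro!: carrier_vecI)
    \<comment> \<open>The component of w orthogonal to the columns of A; it has to be shown to
      vanish.\<close>
    define u where "u = w + (- 1) \<cdot>\<^sub>v (A *\<^sub>v ?y)"
    have uW: "u \<in> W" unfolding u_def by (intro W w AW y)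
    then have uc: "u \<in> carrier_vec n" using W(1) by auto
    have Ay: "A *\<^sub>v ?y \<in> carrier_vec n" using A by (auto intro!: carrier_vecI)
    have "mat_adjoint A *\<^sub>v (A *\<^sub>v ?y) = (mat_adjoint A * A) *\<^sub>v ?y"
      using A wc by (simp add: mat_mult_vec_assoc)
    then have yy: "mat_adjoint A *\<^sub>v (A *\<^sub>v ?y) = ?y" using y by (simp add: iso)
    have "mat_adjoint A *\<^sub>v u = ?y + (- 1) \<cdot>\<^sub>v ?y"
      unfolding u_def using A' Ay wc
      by (simp add: mult_add_distrib_mat_vec[OF A' wc] mult_mat_vec[OF A' Ay] yy)
    then have Au: "vec_index (mat_adjoint A *\<^sub>v u) a = 0" if "a < k" for a
      using that carrier_matD[OF A] by simp
    have orth: "(\<Sum>r<n. cnj (A $$ (r, a)) * vec_index u r) = 0" if "a < k" for a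
    proof -
      have "(\<Sum>r<n. cnj (A $$ (r, a)) * vec_index u r) =
          (\<Sum>r<n. mat_adjoint A $$ (a, r) * vec_index u r)"
        using A that by (intro sum.cong) auto
      then show ?thesis using Au[OF that] mat_vec_index[OF A' uc that] by simp
    qed
    have "u = 0\<^sub>v n"
    proof (rule ccontr)
      assume "u \<noteq> 0\<^sub>v n"
      then obtain i where i: "i < n" "vec_index u i \<noteq> 0"
        using uc by (metis carrier_vecD eq_vecI index_zero_vec)
      define s where "s = (\<Sum>r<n. (cmod (vec_index u r))\<^sup>2)"
      have s: "s > 0" unfolding s_def using i by (intro sum_pos2[of _ i]) auto
      define t where "t = complex_of_real (1 / sqrt s)"
      define u' where "u' = t \<cdot>\<^sub>v u"
      have u'W: "u' \<in> W" unfolding u'_def by (intro W uW)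
      have u'c: "u' \<in> carrier_vec n" using u'W W(1) by auto
      have u'i: "vec_index u' r = t * vec_index u r" if "r < n" for r
        using uc that by (simp add: u'_def)
      have orth': "(\<Sum>r<n. cnj (A $$ (r, a)) * vec_index u' r) = 0" if "a < k" for a
      proof -
        have "(\<Sum>r<n. cnj (A $$ (r, a)) * vec_index u' r) = t * (\<Sum>r<n. cnj (A $$ (r, a)) * vec_index u r)"
          by (simp add: u'i sum_distrib_left mult.left_commute)
        then show ?thesis by (simp add: orth[OF that])
      qed
      have norm': "(\<Sum>r<n. cnj (vec_index u' r) * vec_index u' r) = 1"
      proof -
        have "(\<Sum>r<n. cnj (vec_index u' r) * vec_index u' r) =
            (\<Sum>r<n. cnj t * t * of_real ((cmod (vec_index u r))\<^sup>2))"
          by (intro sum.cong) (auto simp: u'i complex_norm_square mult_ac simp del: of_real_power)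
        also have "\<dots> = cnj t * t * of_real s"
          by (simp add: s_def sum_distrib_left)
        also have "\<dots> = 1"
          using s by (simp add: t_def flip: of_real_mult)
        finally show ?thesis .
      qed
      \<comment> \<open>The matrix A with the normalised remainder appended as column k.\<close>
      define B where "B = mat n (Suc k) (\<lambda>(i, j). if j < k then A $$ (i, j) else vec_index u' i)"
      have B: "B \<in> carrier_mat n (Suc k)" by (simp add: B_def)
      have B': "mat_adjoint B \<in> carrier_mat (Suc k) n" using B by auto
      have "mat_adjoint B * B = 1\<^sub>m (Suc k)"
      proof (rule eq_matI)
        fix a b assume "a < dim_row (1\<^sub>m (Suc k))" "b < dim_col (1\<^sub>m (Suc k))"
        then have ab: "a < Suc k" "b < Suc k" by auto
        have AA: "(\<Sum>r<n. cnj (A $$ (r, a)) * A $$ (r, b)) = (if a = b then 1 else 0)" if "a < k" "b < k"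
        proof -
          have "(\<Sum>r<n. cnj (A $$ (r, a)) * A $$ (r, b)) = (mat_adjoint A * A) $$ (a, b)"
            unfolding mat_mult_index[OF A' A that] using A that by (intro sum.cong) auto
          then show ?thesis using that by (simp add: iso)
        qed
        have orth'': "(\<Sum>r<n. cnj (vec_index u' r) * A $$ (r, b)) = 0" if "b < k"
        proof -
          have "(\<Sum>r<n. cnj (vec_index u' r) * A $$ (r, b)) = cnj (\<Sum>r<n. cnj (A $$ (r, b)) * vec_index u' r)"
            by (simp add: mult.commute)
          then show ?thesis by (simp only: orth'[OF that] complex_cnj_zero)
        qed
        have "(mat_adjoint B * B) $$ (a, b) = (\<Sum>r<n. cnj (B $$ (r, a)) * B $$ (r, b))"
          unfolding mat_mult_index[OF B' B ab] using B ab by (intro sum.cong) auto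
        also have "\<dots> = (if a = b then 1 else 0)"
          using ab AA orth' orth'' norm' by (cases "a < k"; cases "b < k") (auto simp: B_def less_Suc_eq)
        finally show "(mat_adjoint B * B) $$ (a, b) = 1\<^sub>m (Suc k) $$ (a, b)" using ab by simp
      qed (use B in auto)
      moreover have "B *\<^sub>v v \<in> W" if v: "v \<in> carrier_vec (Suc k)" for v
      proof -
        let ?v = "Matrix.vec k (vec_index v)"
        have vk: "?v \<in> carrier_vec k" by simp
        have "B *\<^sub>v v = A *\<^sub>v ?v + vec_index v k \<cdot>\<^sub>v u'"
        proof (rule eq_vecI)
          fix i assume "i < dim_vec (A *\<^sub>v ?v + vec_index v k \<cdot>\<^sub>v u')"
          then have i: "i < n" using u'c by simp
          show "vec_index (B *\<^sub>v v) i = vec_index (A *\<^sub>v ?v + vec_index v k \<cdot>\<^sub>v u') i"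
            unfolding mat_vec_index[OF B v i] using i u'c A
            by (simp add: B_def mat_vec_index[OF A vk i] del: index_mult_mat_vec)
        qed (use B u'c in auto)
        then show ?thesis using W AW[OF vk] u'W by simp
      qed
      ultimately have "Q (Suc k) B" using B by (simp add: Q_def)
      then show False using max[of "Suc k"] by auto
    qed
    then have "vec_index u i = 0" if "i < n" for i using that by simp
    then have "vec_index w i = vec_index (A *\<^sub>v ?y) i" if "i < n" for i
      using that wc carrier_vecD[OF Ay] by (simp add: u_def del: index_mult_mat_vec dim_mult_mat_vec)
    then show ?thesis
      using carrier_vecD[OF wc] carrier_vecD[OF Ay]
      by (intro eq_vecI) (simp_all del: index_mult_mat_vec dim_mult_mat_vec)
  qed
  then show thesis using that A iso AW by blast
qed

lemma smult_smult_assoc_mat: "a \<cdot>\<^sub>m (b \<cdot>\<^sub>m A) = (a * b :: complex) \<cdot>\<^sub>m A"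
  by (rule eq_matI) auto

lemma irrep_unitary_rep: "irrep \<pi> \<Longrightarrow> unitary_rep \<pi>"
  by (simp add: irrep_def)

text \<open>An eigenvalue exists over the complex numbers. Its eigenspace is nonzero and invariant
  because X commutes with the representation, so irreducibility makes it the whole space.\<close>

lemma irrep_commute_scalar:
  assumes \<pi>: "irrep \<pi>" and X: "X \<in> carrier_mat (rdim \<pi>) (rdim \<pi>)"
    and comm: "\<And>g. \<pi> g * X = X * \<pi> g"
  obtains c where "X = c \<cdot>\<^sub>m 1\<^sub>m (rdim \<pi>)"
proof -
  let ?d = "rdim \<pi>"
  note \<pi>c = unitary_rep_carrier[OF irrep_unitary_rep[OF \<pi>]]
  have "?d > 0" using \<pi> by (simp add: irrep_def)
  then obtain c where "c \<in> spectrum X" using spectrum_non_empty[OF X] by auto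
  then obtain v where v: "v \<in> carrier_vec ?d" "v \<noteq> 0\<^sub>v ?d" "X *\<^sub>v v = c \<cdot>\<^sub>v v"
    using X unfolding spectrum_def eigenvalue_def eigenvector_def by auto
  define W where "W = {w \<in> carrier_vec ?d. X *\<^sub>v w = c \<cdot>\<^sub>v w}"
  have "subspace class_ring W (module_vec TYPE(complex) ?d)"
    by (rule subspace_vecI)
      (use X in \<open>auto simp: W_def mult_add_distrib_mat_vec[OF X] mult_mat_vec[OF X] smult_add_distrib_vec
        smult_smult_assoc mult.commute intro!: eq_vecI\<close>)
  moreover have "\<pi> g *\<^sub>v w \<in> W" if "w \<in> W" for g w
  proof -
    have w: "w \<in> carrier_vec ?d" "X *\<^sub>v w = c \<cdot>\<^sub>v w" using that by (auto simp: W_def)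
    have "X *\<^sub>v (\<pi> g *\<^sub>v w) = (\<pi> g * X) *\<^sub>v w"
      unfolding comm using X \<pi>c[of g] w(1) by (subst mat_mult_vec_assoc) auto
    also have "\<dots> = \<pi> g *\<^sub>v (c \<cdot>\<^sub>v w)"
      using X \<pi>c[of g] w by (subst mat_mult_vec_assoc) auto
    also have "\<dots> = c \<cdot>\<^sub>v (\<pi> g *\<^sub>v w)" by (rule mult_mat_vec[OF \<pi>c w(1)])
    finally show ?thesis using \<pi>c[of g] by (auto simp: W_def intro!: carrier_vecI)
  qed
  ultimately have "W = {0\<^sub>v ?d} \<or> W = carrier_vec ?d"
    using \<pi> by (simp add: irrep_def)
  moreover have "v \<in> W" using v by (simp add: W_def)
  ultimately have all: "W = carrier_vec ?d" using v by auto
  have "X = c \<cdot>\<^sub>m 1\<^sub>m ?d"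
  proof (rule mat_eqI_vec[OF X])
    fix w :: "complex vec" assume w: "w \<in> carrier_vec ?d"
    then have "X *\<^sub>v w = c \<cdot>\<^sub>v w" using all by (auto simp: W_def)
    also have "\<dots> = (c \<cdot>\<^sub>m 1\<^sub>m ?d) *\<^sub>v w"
    proof (rule eq_vecI)
      fix i assume "i < dim_vec ((c \<cdot>\<^sub>m 1\<^sub>m ?d) *\<^sub>v w)"
      then have i: "i < ?d" by simp
      have "vec_index ((c \<cdot>\<^sub>m 1\<^sub>m ?d) *\<^sub>v w) i = (\<Sum>j<?d. (c \<cdot>\<^sub>m 1\<^sub>m ?d) $$ (i, j) * vec_index w j)"
        by (rule mat_vec_index[OF _ w i]) simp
      also have "\<dots> = (\<Sum>j<?d. if j = i then c * vec_index w i else 0)"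
        using i by (intro sum.cong) auto
      finally show "vec_index (c \<cdot>\<^sub>v w) i = vec_index ((c \<cdot>\<^sub>m 1\<^sub>m ?d) *\<^sub>v w) i"
        using i w by simp
    qed (use w in auto)
    finally show "X *\<^sub>v w = (c \<cdot>\<^sub>m 1\<^sub>m ?d) *\<^sub>v w" .
  qed simp
  then show thesis using that by blast
qed

text \<open>\<open>rep_equiv\<close> asks for a unitary matrix, so Y must be rescaled. Both Y Y* and
  Y* Y commute with the representations and are scalar; computing Y Y* Y in two ways shows that the
  scalars agree, and comparing traces shows that the dimensions agree. Dividing Y by the square root
  of the scalar gives the unitary.\<close>

lemma Schur_equiv:
  assumes \<pi>: "irrep \<pi>" and \<sigma>: "irrep \<sigma>" and Y: "Y \<in> carrier_mat (rdim \<pi>) (rdim \<sigma>)"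
    and inter: "\<And>g. \<pi> g * Y = Y * \<sigma> g" and ne: "Y \<noteq> 0\<^sub>m (rdim \<pi>) (rdim \<sigma>)"
  shows "rep_equiv \<sigma> \<pi>"
proof -
  let ?m = "rdim \<pi>" and ?n = "rdim \<sigma>" and ?Y' = "mat_adjoint Y"
  note \<pi>r = irrep_unitary_rep[OF \<pi>] and \<sigma>r = irrep_unitary_rep[OF \<sigma>]
  note dims = unitary_rep_dims[OF \<pi>r] unitary_rep_dims[OF \<sigma>r]
  have Yd: "dim_row Y = ?m" "dim_col Y = ?n" using Y by auto
  have Y': "?Y' \<in> carrier_mat ?n ?m" using Y by auto
  have inter': "?Y' * \<pi> g = \<sigma> g * ?Y'" for g
  proof -
    have "mat_adjoint (\<pi> (- g) * Y) = mat_adjoint (Y * \<sigma> (- g))" by (simp add: inter)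
    then show ?thesis
      by (simp add: mat_adjoint_mult Yd dims flip: unitary_rep_minus(1)[OF \<pi>r] unitary_rep_minus(1)[OF \<sigma>r])
  qed
  have "\<pi> g * (Y * ?Y') = (Y * ?Y') * \<pi> g" for g
  proof -
    have "\<pi> g * (Y * ?Y') = (\<pi> g * Y) * ?Y'" by (simp add: mat_mult_assoc Yd dims)
    also have "\<dots> = (Y * ?Y') * \<pi> g" by (simp add: mat_mult_assoc Yd dims inter inter')
    finally show ?thesis .
  qed
  then obtain c where c: "Y * ?Y' = c \<cdot>\<^sub>m 1\<^sub>m ?m"
    using irrep_commute_scalar[OF \<pi>, of "Y * ?Y'"] Y Y' by (metis mult_carrier_mat)
  have "\<sigma> g * (?Y' * Y) = (?Y' * Y) * \<sigma> g" for g
  proof -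
    have "\<sigma> g * (?Y' * Y) = (\<sigma> g * ?Y') * Y" by (simp add: mat_mult_assoc Yd dims)
    also have "\<dots> = ?Y' * (\<pi> g * Y)" by (simp add: mat_mult_assoc Yd dims flip: inter')
    also have "\<dots> = (?Y' * Y) * \<sigma> g" by (simp add: mat_mult_assoc Yd dims inter)
    finally show ?thesis .
  qed
  then obtain c' where c': "?Y' * Y = c' \<cdot>\<^sub>m 1\<^sub>m ?n"
    using irrep_commute_scalar[OF \<sigma>, of "?Y' * Y"] Y Y' by (metis mult_carrier_mat)
  obtain i j where ij: "i < ?m" "j < ?n" "Y $$ (i, j) \<noteq> 0"
    using ne Y by (metis carrier_matD eq_matI index_zero_mat)
  \<comment> \<open>The squared norm of row i of Y. It is the diagonal entry (i, i) of Y Y*, hence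
    equal to c, and it is positive because the row has a nonzero entry.\<close>
  define s where "s = (\<Sum>r<?n. (cmod (Y $$ (i, r)))\<^sup>2)"
  have s: "s > 0" unfolding s_def using ij by (intro sum_pos2[of _ j]) auto
  have "(Y * ?Y') $$ (i, i) = (\<Sum>r<?n. Y $$ (i, r) * cnj (Y $$ (i, r)))"
    unfolding mat_mult_index[OF Y Y' ij(1) ij(1)] using Y ij by (intro sum.cong) auto
  also have "\<dots> = of_real s" by (simp add: s_def complex_norm_square del: of_real_power)
  finally have cs: "c = of_real s" using ij by (simp add: c)
  have "c \<cdot>\<^sub>m Y = Y * ?Y' * Y"
    using Y by (simp add: c mult_smult_assoc_mat[OF one_carrier_mat Y] mat_mult_one_left Yd)
  also have "\<dots> = Y * (?Y' * Y)" by (simp add: mat_mult_assoc Yd)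
  also have "\<dots> = c' \<cdot>\<^sub>m Y"
    using Y by (simp add: c' mult_smult_distrib[OF Y one_carrier_mat] mat_mult_one_right Yd)
  finally have "(c \<cdot>\<^sub>m Y) $$ (i, j) = (c' \<cdot>\<^sub>m Y) $$ (i, j)" by simp
  then have cc': "c' = c" using ij Yd by simp
  have "mtrace (Y * ?Y') = mtrace (?Y' * Y)" by (rule mtrace_commute[OF Y Y'])
  then have "c * of_nat ?m = c * of_nat ?n"
    by (simp add: c c' cc' mtrace_def mult.commute)
  then have dim: "?m = ?n" using s by (simp add: cs)
  define t where "t = complex_of_real (1 / sqrt s)"
  have tt: "t * t * c = 1"
    using s unfolding t_def cs of_real_mult[symmetric] by (simp add: field_simps)
  define U where "U = t \<cdot>\<^sub>m Y"
  have U: "U \<in> carrier_mat ?n ?n" using Y dim by (simp add: U_def)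
  have U': "mat_adjoint U = t \<cdot>\<^sub>m ?Y'"
    by (rule eq_matI) (auto simp: U_def Yd t_def)
  have "U * mat_adjoint U = (t * t * c) \<cdot>\<^sub>m 1\<^sub>m ?m"
    unfolding U' unfolding U_def
    using Y Y' by (simp add: mult_smult_assoc_mat[OF Y] mult_smult_distrib[OF Y Y'] c smult_smult_assoc_mat mult.assoc
        mult_smult_assoc_mat[OF Y smult_carrier_mat[OF Y']])
  moreover have "mat_adjoint U * U = (t * t * c) \<cdot>\<^sub>m 1\<^sub>m ?n"
    unfolding U' unfolding U_def
    using Y Y' by (simp add: mult_smult_distrib[OF Y' Y] c' cc' smult_smult_assoc_mat mult.assoc
        mult_smult_assoc_mat[OF Y' smult_carrier_mat[OF Y]])
  moreover have "(1 :: complex) \<cdot>\<^sub>m 1\<^sub>m k = 1\<^sub>m k" for k by (rule eq_matI) auto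
  ultimately have "unitary_mat ?n U"
    unfolding unitary_mat_def using U dim by (simp add: tt)
  moreover have "U * \<sigma> g = \<pi> g * U" for g
    unfolding U_def using unitary_rep_carrier[OF \<pi>r, of g] unitary_rep_carrier[OF \<sigma>r, of g] Y
    by (simp add: inter mult_smult_distrib[of _ ?m ?m _ ?n] mult_smult_assoc_mat[of _ ?m ?n _ ?n])
  ultimately show ?thesis unfolding rep_equiv_def dim by auto
qed

lemma rep_equiv_refl:
  assumes "unitary_rep \<pi>"
  shows "rep_equiv \<pi> \<pi>"
proof -
  have "mat_adjoint (1\<^sub>m (rdim \<pi>)) = (1\<^sub>m (rdim \<pi>) :: complex mat)" by (rule eq_matI) auto
  then have "unitary_mat (rdim \<pi>) (1\<^sub>m (rdim \<pi>))" by (simp add: unitary_mat_def)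
  then show ?thesis
    unfolding rep_equiv_def
    by (auto intro!: exI[of _ "1\<^sub>m (rdim \<pi>)"]
        simp: mat_mult_one_left mat_mult_one_right unitary_rep_dims[OF assms])
qed

text \<open>A nonzero intertwiner would make both \<pi> and \<sigma> representatives of the class of
  \<pi>, and a transversal has only one.\<close>

lemma Schur_transversal:
  assumes G: "dual_transversal Ghat" and mem: "\<pi> \<in> Ghat" "\<sigma> \<in> Ghat"
    and Y: "Y \<in> carrier_mat (rdim \<pi>) (rdim \<sigma>)" and inter: "\<And>g. \<pi> g * Y = Y * \<sigma> g"
  shows "\<pi> \<noteq> \<sigma> \<Longrightarrow> Y = 0\<^sub>m (rdim \<pi>) (rdim \<sigma>)"
    and "\<pi> = \<sigma> \<Longrightarrow> \<exists>c. Y = c \<cdot>\<^sub>m 1\<^sub>m (rdim \<pi>)"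
proof -
  have irr: "irrep \<pi>" "irrep \<sigma>" using G mem by (auto simp: dual_transversal_def)
  show "Y = 0\<^sub>m (rdim \<pi>) (rdim \<sigma>)" if "\<pi> \<noteq> \<sigma>"
  proof (rule ccontr)
    assume "Y \<noteq> 0\<^sub>m (rdim \<pi>) (rdim \<sigma>)"
    then have "rep_equiv \<sigma> \<pi>" by (rule Schur_equiv[OF irr Y inter])
    moreover have "rep_equiv \<pi> \<pi>" by (rule rep_equiv_refl[OF irrep_unitary_rep[OF irr(1)]])
    ultimately show False using G irr mem that unfolding dual_transversal_def by metis
  qed
  show "\<exists>c. Y = c \<cdot>\<^sub>m 1\<^sub>m (rdim \<pi>)" if "\<pi> = \<sigma>"
    using irrep_commute_scalar[OF irr(1), of Y] Y inter that by metis
qed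

section \<open>Complete reducibility\<close>

lemma zero_mat_mult_vec:
  assumes "v \<in> carrier_vec m"
  shows "0\<^sub>m n m *\<^sub>v v = (0\<^sub>v n :: complex vec)"
  using assms by (intro eq_vecI) (auto simp: scalar_prod_def)

text \<open>Matrices of all sizes share one type, so the sum carries its dimensions explicitly; this
  gives the empty sum the right zero matrix.\<close>

definition msum :: "nat \<Rightarrow> nat \<Rightarrow> (nat \<Rightarrow> complex mat) \<Rightarrow> nat \<Rightarrow> complex mat" where
  "msum n m f N = mat n m (\<lambda>(i, j). \<Sum>k<N. f k $$ (i, j))"

lemma msum_carrier [simp]: "msum n m f N \<in> carrier_mat n m"
  by (simp add: msum_def)

lemma msum_cong:
  assumes "\<And>k. k < N \<Longrightarrow> f k = g k"
  shows "msum n m f N = msum n m g N"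
  using assms by (simp add: msum_def)

lemma msum_mult_left:
  assumes A: "A \<in> carrier_mat p n" and f: "\<And>k. k < N \<Longrightarrow> f k \<in> carrier_mat n m"
  shows "A * msum n m f N = msum p m (\<lambda>k. A * f k) N"
proof (rule eq_matI)
  fix i j assume "i < dim_row (msum p m (\<lambda>k. A * f k) N)" "j < dim_col (msum p m (\<lambda>k. A * f k) N)"
  then have ij: "i < p" "j < m" by (auto simp: msum_def)
  have "(A * msum n m f N) $$ (i, j) = (\<Sum>r<n. \<Sum>k<N. A $$ (i, r) * f k $$ (r, j))"
    unfolding mat_mult_index[OF A msum_carrier ij] using ij by (simp add: msum_def sum_distrib_left)
  also have "\<dots> = (\<Sum>k<N. \<Sum>r<n. A $$ (i, r) * f k $$ (r, j))" by (rule sum.swap)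
  also have "\<dots> = (\<Sum>k<N. (A * f k) $$ (i, j))"
    by (rule sum.cong) (simp_all add: mat_mult_index[OF A f ij] del: index_mult_mat)
  also have "\<dots> = msum p m (\<lambda>k. A * f k) N $$ (i, j)"
    using ij by (simp add: msum_def)
  finally show "(A * msum n m f N) $$ (i, j) = msum p m (\<lambda>k. A * f k) N $$ (i, j)" .
qed (use A in \<open>auto simp: msum_def\<close>)

lemma msum_mult_right:
  assumes f: "\<And>k. k < N \<Longrightarrow> f k \<in> carrier_mat n m" and B: "B \<in> carrier_mat m p"
  shows "msum n m f N * B = msum n p (\<lambda>k. f k * B) N"
proof (rule eq_matI)
  fix i j assume "i < dim_row (msum n p (\<lambda>k. f k * B) N)" "j < dim_col (msum n p (\<lambda>k. f k * B) N)"
  then have ij: "i < n" "j < p" by (auto simp: msum_def)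
  have "(msum n m f N * B) $$ (i, j) = (\<Sum>r<m. \<Sum>k<N. f k $$ (i, r) * B $$ (r, j))"
    unfolding mat_mult_index[OF msum_carrier B ij] using ij by (simp add: msum_def sum_distrib_right)
  also have "\<dots> = (\<Sum>k<N. \<Sum>r<m. f k $$ (i, r) * B $$ (r, j))" by (rule sum.swap)
  also have "\<dots> = (\<Sum>k<N. (f k * B) $$ (i, j))"
    by (rule sum.cong) (simp_all add: mat_mult_index[OF f B ij] del: index_mult_mat)
  also have "\<dots> = msum n p (\<lambda>k. f k * B) N $$ (i, j)"
    using ij by (simp add: msum_def)
  finally show "(msum n m f N * B) $$ (i, j) = msum n p (\<lambda>k. f k * B) N $$ (i, j)" .
qed (use B in \<open>auto simp: msum_def\<close>)

lemma sum_append: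
  fixes f :: "nat \<Rightarrow> complex"
  shows "(\<Sum>k<N + M. if k < N then f k else g (k - N)) = (\<Sum>k<N. f k) + (\<Sum>k<M. g k)"
proof (induction M)
  case 0
  show ?case by (auto intro!: sum.cong)
qed simp

lemma msum_append:
  "msum n m (\<lambda>k. if k < N then f k else g (k - N)) (N + M) = msum n m f N + msum n m g M"
proof (rule eq_matI)
  fix i j assume "i < dim_row (msum n m f N + msum n m g M)" "j < dim_col (msum n m f N + msum n m g M)"
  then have ij: "i < n" "j < m" by (auto simp: msum_def)
  then show "msum n m (\<lambda>k. if k < N then f k else g (k - N)) (N + M) $$ (i, j) =
      (msum n m f N + msum n m g M) $$ (i, j)"
    using sum_append[of N "\<lambda>k. f k $$ (i, j)" "\<lambda>k. g k $$ (i, j)" M]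
    by (simp add: msum_def if_distrib[of "\<lambda>X. X $$ _"])
qed (auto simp: msum_def)

lemma mtrace_msum:
  assumes "\<And>k. k < N \<Longrightarrow> f k \<in> carrier_mat n n"
  shows "mtrace (msum n n f N) = (\<Sum>k<N. mtrace (f k))"
proof -
  have "mtrace (msum n n f N) = (\<Sum>i<n. \<Sum>k<N. f k $$ (i, i))"
    by (simp add: mtrace_def msum_def)
  also have "\<dots> = (\<Sum>k<N. \<Sum>i<n. f k $$ (i, i))" by (rule sum.swap)
  also have "\<dots> = (\<Sum>k<N. mtrace (f k))"
    using assms by (intro sum.cong) (auto simp: mtrace_def)
  finally show ?thesis .
qed

text \<open>A A* is the identity on W, and \<rho> g A v stays in W by invariance, so compressing
  \<rho> g with A loses nothing on the range of A.\<close>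

lemma invariant_isometry:
  assumes \<rho>: "unitary_rep \<rho>" and W: "subspace class_ring W (module_vec TYPE(complex) (rdim \<rho>))"
    and inv: "\<And>g v. v \<in> W \<Longrightarrow> \<rho> g *\<^sub>v v \<in> W"
  obtains k A where "A \<in> carrier_mat (rdim \<rho>) k" "mat_adjoint A * A = 1\<^sub>m k"
    "\<And>v. v \<in> carrier_vec k \<Longrightarrow> A *\<^sub>v v \<in> W"
    "\<And>w. w \<in> W \<Longrightarrow> A *\<^sub>v (mat_adjoint A *\<^sub>v w) = w"
    "\<And>g. A * (mat_adjoint A * \<rho> g * A) = \<rho> g * A"
proof -
  obtain k A where A: "A \<in> carrier_mat (rdim \<rho>) k" and iso: "mat_adjoint A * A = 1\<^sub>m k"
    and AW: "\<And>v. v \<in> carrier_vec k \<Longrightarrow> A *\<^sub>v v \<in> W"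
    and proj: "\<And>w. w \<in> W \<Longrightarrow> A *\<^sub>v (mat_adjoint A *\<^sub>v w) = w"
    using subspace_isometry[OF W] by metis
  have Ad: "dim_row A = rdim \<rho>" "dim_col A = k" using A by auto
  have "A * (mat_adjoint A * \<rho> g * A) = \<rho> g * A" for g
  proof (rule mat_eqI_vec)
    fix v :: "complex vec" assume v: "v \<in> carrier_vec k"
    then have vd: "dim_vec v = k" by simp
    have "(A * (mat_adjoint A * \<rho> g * A)) *\<^sub>v v = A *\<^sub>v (mat_adjoint A *\<^sub>v (\<rho> g *\<^sub>v (A *\<^sub>v v)))"
      by (simp add: mat_mult_vec_assoc Ad vd unitary_rep_dims[OF \<rho>])
    also have "\<dots> = \<rho> g *\<^sub>v (A *\<^sub>v v)" by (intro proj inv AW v)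
    also have "\<dots> = (\<rho> g * A) *\<^sub>v v"
      by (simp add: mat_mult_vec_assoc Ad vd unitary_rep_dims[OF \<rho>])
    finally show "(A * (mat_adjoint A * \<rho> g * A)) *\<^sub>v v = (\<rho> g * A) *\<^sub>v v" .
  qed (use Ad unitary_rep_dims[OF \<rho>] in auto)
  then show thesis using that A iso AW proj by blast
qed

text \<open>A compression is not multiplicative in general; \<open>inter\<close> absorbs the factor
  A A* that appears in the middle of a product of two compressions.\<close>

lemma subrep:
  assumes \<rho>: "unitary_rep \<rho>" and A: "A \<in> carrier_mat (rdim \<rho>) k"
    and iso: "mat_adjoint A * A = 1\<^sub>m k"
    and inter: "\<And>g. A * (mat_adjoint A * \<rho> g * A) = \<rho> g * A"
  shows "unitary_rep (\<lambda>g. mat_adjoint A * \<rho> g * A)" "rdim (\<lambda>g. mat_adjoint A * \<rho> g * A) = k"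
proof -
  let ?n = "rdim \<rho>" and ?\<tau> = "\<lambda>g. mat_adjoint A * \<rho> g * A"
  have Ad: "dim_row A = ?n" "dim_col A = k" using A by auto
  note \<rho>d = unitary_rep_dims[OF \<rho>]
  show dim: "rdim ?\<tau> = k" by (simp add: rdim_def Ad)
  have c: "?\<tau> g \<in> carrier_mat k k" for g by (auto simp: Ad)
  have add: "?\<tau> (g + h) = ?\<tau> g * ?\<tau> h" for g h
  proof -
    have "?\<tau> g * ?\<tau> h = mat_adjoint A * \<rho> g * (A * ?\<tau> h)"
      by (simp add: mat_mult_assoc Ad \<rho>d)
    also have "\<dots> = mat_adjoint A * \<rho> g * (\<rho> h * A)" by (simp only: inter)
    also have "\<dots> = ?\<tau> (g + h)"
      by (simp add: unitary_rep_add[OF \<rho>] mat_mult_assoc Ad \<rho>d)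
    finally show ?thesis by simp
  qed
  have adj: "mat_adjoint (?\<tau> g) = ?\<tau> (- g)" for g
    by (simp add: mat_adjoint_mult Ad \<rho>d unitary_rep_minus(1)[OF \<rho>] mat_mult_assoc)
  have zero: "?\<tau> 0 = 1\<^sub>m k"
    by (simp add: unitary_rep_minus(2)[OF \<rho>] mat_mult_one_right Ad iso)
  have "unitary_mat k (?\<tau> g)" for g
    unfolding unitary_mat_def using c[of g] add[of g "- g"] add[of "- g" g]
    by (simp add: adj zero)
  moreover have "continuous_on UNIV (\<lambda>g. ?\<tau> g $$ (i, j))" if ij: "i < k" "j < k" for i j
  proof -
    have A': "mat_adjoint A \<in> carrier_mat k ?n" using A by auto
    have m: "mat_adjoint A * \<rho> g \<in> carrier_mat k ?n" for g by (auto simp: Ad \<rho>d)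
    have "?\<tau> g $$ (i, j) = (\<Sum>b<?n. (\<Sum>a<?n. mat_adjoint A $$ (i, a) * \<rho> g $$ (a, b)) * A $$ (b, j))" for g
      unfolding mat_mult_index[OF m A ij]
      by (intro sum.cong refl) (simp add: mat_mult_index[OF A' unitary_rep_carrier[OF \<rho>] ij(1)] del: index_mult_mat)
    then show ?thesis
      by (auto intro!: continuous_intros unitary_rep_continuous[OF \<rho>])
  qed
  ultimately show "unitary_rep ?\<tau>"
    unfolding unitary_rep_def dim using add by blast
qed

text \<open>An orthogonal direct sum decomposition: \<open>T k\<close> embeds the k-th summand
  isometrically, and the range projections add up to the identity. The list s may repeat a
  representation; the number of repetitions is its multiplicity.\<close>

definition decomposes ::
  "('g::topological_group_add \<Rightarrow> complex mat) set \<Rightarrow> ('g \<Rightarrow> complex mat) \<Rightarrow> nat \<Rightarrow>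
    (nat \<Rightarrow> 'g \<Rightarrow> complex mat) \<Rightarrow> (nat \<Rightarrow> complex mat) \<Rightarrow> bool" where
  "decomposes Ghat \<rho> N s T \<longleftrightarrow>
     (\<forall>k<N. s k \<in> Ghat \<and> T k \<in> carrier_mat (rdim \<rho>) (rdim (s k)) \<and> (\<forall>g. T k * s k g = \<rho> g * T k)) \<and>
     (\<forall>k<N. \<forall>l<N. mat_adjoint (T k) * T l =
        (if k = l then 1\<^sub>m (rdim (s k)) else 0\<^sub>m (rdim (s k)) (rdim (s l)))) \<and>
     msum (rdim \<rho>) (rdim \<rho>) (\<lambda>k. T k * mat_adjoint (T k)) N = 1\<^sub>m (rdim \<rho>)"

text \<open>Composing the embeddings with A moves a decomposition of the compressed representation
  into \<rho>. The range projections then add up to the projection onto the range of A instead of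
  the identity.\<close>

lemma decomposes_push:
  assumes G: "dual_transversal Ghat" and \<rho>: "unitary_rep \<rho>"
    and A: "A \<in> carrier_mat (rdim \<rho>) a" "mat_adjoint A * A = 1\<^sub>m a"
      "\<And>g. A * (mat_adjoint A * \<rho> g * A) = \<rho> g * A"
    and dec: "decomposes Ghat (\<lambda>g. mat_adjoint A * \<rho> g * A) N s S"
  shows "\<And>k. k < N \<Longrightarrow> s k \<in> Ghat" "\<And>k. k < N \<Longrightarrow> S k \<in> carrier_mat a (rdim (s k))"
    "\<And>k g. k < N \<Longrightarrow> A * S k * s k g = \<rho> g * (A * S k)"
    "\<And>k l. k < N \<Longrightarrow> l < N \<Longrightarrow> mat_adjoint (A * S k) * (A * S l) =
      (if k = l then 1\<^sub>m (rdim (s k)) else 0\<^sub>m (rdim (s k)) (rdim (s l)))"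
    "msum (rdim \<rho>) (rdim \<rho>) (\<lambda>k. A * S k * mat_adjoint (A * S k)) N = A * mat_adjoint A"
proof -
  let ?n = "rdim \<rho>"
  note r = subrep[OF \<rho> A]
  note \<rho>d = unitary_rep_dims[OF \<rho>]
  have d: "dim_row A = ?n" "dim_col A = a" using A by auto
  show sG: "s k \<in> Ghat" and S: "S k \<in> carrier_mat a (rdim (s k))" if "k < N" for k
    using dec that unfolding decomposes_def r(2) by blast+
  have Sd: "dim_row (S k) = a" "dim_col (S k) = rdim (s k)" if "k < N" for k using S[OF that] by auto
  have sd: "dim_row (s k g) = rdim (s k)" if "k < N" for k g
    using unitary_rep_dims(1)[of "s k"] sG[OF that] G by (auto simp: dual_transversal_def irrep_unitary_rep)
  show "A * S k * s k g = \<rho> g * (A * S k)" if k: "k < N" for k g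
  proof -
    have "S k * s k g = mat_adjoint A * \<rho> g * A * S k"
      using dec k unfolding decomposes_def by blast
    then have "A * S k * s k g = A * (mat_adjoint A * \<rho> g * A) * S k"
      by (simp add: mat_mult_assoc d \<rho>d Sd[OF k] sd[OF k])
    also have "\<dots> = \<rho> g * (A * S k)"
      unfolding A(3) by (simp add: mat_mult_assoc d \<rho>d Sd[OF k])
    finally show ?thesis .
  qed
  show "mat_adjoint (A * S k) * (A * S l) =
      (if k = l then 1\<^sub>m (rdim (s k)) else 0\<^sub>m (rdim (s k)) (rdim (s l)))" if kl: "k < N" "l < N" for k l
  proof -
    have "mat_adjoint (A * S k) * (A * S l) = mat_adjoint (S k) * ((mat_adjoint A * A) * S l)"
      by (simp add: mat_adjoint_mult mat_mult_assoc d Sd kl)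
    also have "\<dots> = mat_adjoint (S k) * S l"
      by (simp add: A(2) mat_mult_one_left Sd kl)
    finally show ?thesis using dec kl unfolding decomposes_def by auto
  qed
  have SS: "S k * mat_adjoint (S k) \<in> carrier_mat a a" if "k < N" for k
    by (rule mult_carrier_mat[OF S mat_adjoint_carrier[OF S]]) (fact that)+
  have "msum ?n ?n (\<lambda>k. A * S k * mat_adjoint (A * S k)) N =
      msum ?n ?n (\<lambda>k. A * (S k * mat_adjoint (S k)) * mat_adjoint A) N"
    by (rule msum_cong) (simp add: mat_adjoint_mult mat_mult_assoc d Sd)
  also have "\<dots> = msum ?n a (\<lambda>k. A * (S k * mat_adjoint (S k))) N * mat_adjoint A"
    by (rule msum_mult_right[symmetric]) (use A(1) SS in auto)
  also have "\<dots> = A * msum a a (\<lambda>k. S k * mat_adjoint (S k)) N * mat_adjoint A"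
    by (subst msum_mult_left[OF A(1) SS]) auto
  also have "msum a a (\<lambda>k. S k * mat_adjoint (S k)) N = 1\<^sub>m a"
    using dec unfolding decomposes_def r(2) by blast
  finally show "msum ?n ?n (\<lambda>k. A * S k * mat_adjoint (A * S k)) N = A * mat_adjoint A"
    by (simp add: mat_mult_one_right d)
qed

lemma decomposes_append:
  assumes G: "dual_transversal Ghat" and \<rho>: "unitary_rep \<rho>"
    and A: "A \<in> carrier_mat (rdim \<rho>) a" "mat_adjoint A * A = 1\<^sub>m a"
      "\<And>g. A * (mat_adjoint A * \<rho> g * A) = \<rho> g * A"
    and B: "B \<in> carrier_mat (rdim \<rho>) b" "mat_adjoint B * B = 1\<^sub>m b"
      "\<And>g. B * (mat_adjoint B * \<rho> g * B) = \<rho> g * B"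
    and AB: "mat_adjoint A * B = 0\<^sub>m a b" "A * mat_adjoint A + B * mat_adjoint B = 1\<^sub>m (rdim \<rho>)"
    and dA: "decomposes Ghat (\<lambda>g. mat_adjoint A * \<rho> g * A) N s S"
    and dB: "decomposes Ghat (\<lambda>g. mat_adjoint B * \<rho> g * B) M t T"
  shows "decomposes Ghat \<rho> (N + M) (\<lambda>k. if k < N then s k else t (k - N))
    (\<lambda>k. if k < N then A * S k else B * T (k - N))"
proof -
  let ?n = "rdim \<rho>"
  note pA = decomposes_push[OF G \<rho> A dA] and pB = decomposes_push[OF G \<rho> B dB]
  have d: "dim_row A = ?n" "dim_col A = a" "dim_row B = ?n" "dim_col B = b" using A B by auto
  have BA: "mat_adjoint B * A = 0\<^sub>m b a"
  proof -
    have "mat_adjoint (mat_adjoint A * B) = mat_adjoint B * A" by (simp add: mat_adjoint_mult d)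
    moreover have "mat_adjoint (0\<^sub>m a b) = (0\<^sub>m b a :: complex mat)" by (rule eq_matI) auto
    ultimately show ?thesis by (simp add: AB)
  qed
  have Sd: "dim_row (S k) = a" "dim_col (S k) = rdim (s k)" if "k < N" for k using pA(2)[OF that] by auto
  have Td: "dim_row (T k) = b" "dim_col (T k) = rdim (t k)" if "k < M" for k using pB(2)[OF that] by auto
  have "mat_adjoint (A * S k) * (B * T l) = 0\<^sub>m (rdim (s k)) (rdim (t l))" if kl: "k < N" "l < M" for k l
  proof -
    have "mat_adjoint (A * S k) * (B * T l) = mat_adjoint (S k) * ((mat_adjoint A * B) * T l)"
      by (simp add: mat_adjoint_mult mat_mult_assoc d Sd Td kl)
    also have "\<dots> = 0\<^sub>m (rdim (s k)) (rdim (t l))"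
      unfolding AB(1) left_mult_zero_mat[OF pB(2)[OF kl(2)]]
      by (rule right_mult_zero_mat[OF mat_adjoint_carrier[OF pA(2)[OF kl(1)]]])
    finally show ?thesis .
  qed
  moreover have "mat_adjoint (B * T l) * (A * S k) = 0\<^sub>m (rdim (t l)) (rdim (s k))" if kl: "k < N" "l < M" for k l
  proof -
    have "mat_adjoint (B * T l) * (A * S k) = mat_adjoint (T l) * ((mat_adjoint B * A) * S k)"
      by (simp add: mat_adjoint_mult mat_mult_assoc d Sd Td kl)
    also have "\<dots> = 0\<^sub>m (rdim (t l)) (rdim (s k))"
      unfolding BA left_mult_zero_mat[OF pA(2)[OF kl(1)]]
      by (rule right_mult_zero_mat[OF mat_adjoint_carrier[OF pB(2)[OF kl(2)]]])
    finally show ?thesis .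
  qed
  moreover have "msum ?n ?n (\<lambda>k. (if k < N then A * S k else B * T (k - N)) *
      mat_adjoint (if k < N then A * S k else B * T (k - N))) (N + M) = 1\<^sub>m ?n"
  proof -
    have "(\<lambda>k. (if k < N then A * S k else B * T (k - N)) * mat_adjoint (if k < N then A * S k else B * T (k - N))) =
        (\<lambda>k. if k < N then A * S k * mat_adjoint (A * S k) else B * T (k - N) * mat_adjoint (B * T (k - N)))"
      by auto
    then show ?thesis
      using msum_append[of ?n ?n N "\<lambda>k. A * S k * mat_adjoint (A * S k)" "\<lambda>k. B * T k * mat_adjoint (B * T k)" M]
      by (simp only: pA(5) pB(5) AB(2))
  qed
  moreover have "A * S k \<in> carrier_mat ?n (rdim (s k))" if "k < N" for k
    by (rule mult_carrier_mat[OF A(1) pA(2)[OF that]])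
  moreover have "B * T k \<in> carrier_mat ?n (rdim (t k))" if "k < M" for k
    by (rule mult_carrier_mat[OF B(1) pB(2)[OF that]])
  ultimately show ?thesis
    unfolding decomposes_def using pA(1,3,4) pB(1,3,4) by auto
qed

text \<open>By unitarity, the orthogonal complement of an invariant subspace is invariant. A
  reducible \<rho> therefore splits into two compressions of smaller dimension, to which strong
  induction on the dimension applies.\<close>

lemma complete_reducibility:
  assumes G: "dual_transversal Ghat" and \<rho>: "unitary_rep \<rho>"
  shows "\<exists>N s T. decomposes Ghat \<rho> N s T"
  using \<rho>
proof (induction "rdim \<rho>" arbitrary: \<rho> rule: less_induct)
  case less
  note \<rho> = less.prems
  let ?n = "rdim \<rho>"
  note \<rho>d = unitary_rep_dims[OF \<rho>]
  consider "?n = 0" | "irrep \<rho>" | "?n > 0" "\<not> irrep \<rho>" by blast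
  then show ?case
  proof cases
    case 1
    then have "decomposes Ghat \<rho> 0 s T" for s T
      by (auto simp: decomposes_def msum_def intro!: eq_matI)
    then show ?thesis by blast
  next
    case 2
    then obtain \<pi> where \<pi>: "\<pi> \<in> Ghat" "rep_equiv \<pi> \<rho>"
      using G unfolding dual_transversal_def by blast
    then obtain U where U: "unitary_mat ?n U" "\<And>g. U * \<pi> g = \<rho> g * U" and dim: "rdim \<pi> = ?n"
      unfolding rep_equiv_def by auto
    have Uc: "U \<in> carrier_mat ?n ?n" using U(1) by (simp add: unitary_mat_def)
    have "msum ?n ?n (\<lambda>k. U * mat_adjoint U) 1 = 1\<^sub>m ?n"
      using U(1) by (auto simp: unitary_mat_def msum_def intro!: eq_matI)
    then have "decomposes Ghat \<rho> 1 (\<lambda>_. \<pi>) (\<lambda>_. U)"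
      using U Uc \<pi>(1) by (auto simp: decomposes_def dim unitary_mat_def)
    then show ?thesis by blast
  next
    case 3
    then obtain W where W: "subspace class_ring W (module_vec TYPE(complex) ?n)"
      and inv: "\<And>g v. v \<in> W \<Longrightarrow> \<rho> g *\<^sub>v v \<in> W"
      and proper: "W \<noteq> {0\<^sub>v ?n}" "W \<noteq> carrier_vec ?n"
      using \<rho> unfolding irrep_def by blast
    note WD = subspace_vecD[OF W]
    obtain a A where A: "A \<in> carrier_mat ?n a" "mat_adjoint A * A = 1\<^sub>m a"
      "\<And>g. A * (mat_adjoint A * \<rho> g * A) = \<rho> g * A"
      and AW: "\<And>v. v \<in> carrier_vec a \<Longrightarrow> A *\<^sub>v v \<in> W"
      and Aproj: "\<And>w. w \<in> W \<Longrightarrow> A *\<^sub>v (mat_adjoint A *\<^sub>v w) = w"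
      using invariant_isometry[OF \<rho> W inv] by metis
    have Ad: "dim_row A = ?n" "dim_col A = a" using A by auto
    have A': "mat_adjoint A \<in> carrier_mat a ?n" using A by auto
    \<comment> \<open>The orthogonal complement of W, written as the kernel of the adjoint of
      A.\<close>
    define W' where "W' = {v \<in> carrier_vec ?n. mat_adjoint A *\<^sub>v v = 0\<^sub>v a}"
    have W': "subspace class_ring W' (module_vec TYPE(complex) ?n)"
    proof (rule subspace_vecI)
      show "0\<^sub>v ?n \<in> W'"
        unfolding W'_def using Ad by (auto simp: scalar_prod_def intro!: eq_vecI)
    qed (auto simp: W'_def mult_add_distrib_mat_vec[OF A'] mult_mat_vec[OF A'])
    have inv': "\<rho> g *\<^sub>v v \<in> W'" if "v \<in> W'" for g v
    proof -
      have v: "v \<in> carrier_vec ?n" "mat_adjoint A *\<^sub>v v = 0\<^sub>v a" using that by (auto simp: W'_def)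
      then have vd: "dim_vec v = ?n" by simp
      \<comment> \<open>Taking adjoints in the intertwining relation at - g expresses A* \<rho> g as
        a multiple of A*, so \<rho> g preserves the kernel of A*.\<close>
      have "mat_adjoint (A * (mat_adjoint A * \<rho> (- g) * A)) = mat_adjoint (\<rho> (- g) * A)"
        by (simp only: A(3))
      then have eq: "mat_adjoint A * \<rho> g * A * mat_adjoint A = mat_adjoint A * \<rho> g"
        by (simp add: mat_adjoint_mult Ad \<rho>d mat_mult_assoc flip: unitary_rep_minus(1)[OF \<rho>])
      have "mat_adjoint A *\<^sub>v (\<rho> g *\<^sub>v v) = (mat_adjoint A * \<rho> g) *\<^sub>v v"
        by (simp add: mat_mult_vec_assoc Ad \<rho>d vd)
      also have "\<dots> = (mat_adjoint A * \<rho> g * A) *\<^sub>v (mat_adjoint A *\<^sub>v v)"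
        by (subst eq[symmetric], rule mat_mult_vec_assoc) (auto simp: Ad \<rho>d vd)
      also have "\<dots> = 0\<^sub>v a"
        unfolding v(2) by (rule eq_vecI) (auto simp: Ad scalar_prod_def)
      finally show ?thesis using \<rho>d by (auto simp: W'_def intro!: carrier_vecI)
    qed
    obtain b B where B: "B \<in> carrier_mat ?n b" "mat_adjoint B * B = 1\<^sub>m b"
      "\<And>g. B * (mat_adjoint B * \<rho> g * B) = \<rho> g * B"
      and BW: "\<And>v. v \<in> carrier_vec b \<Longrightarrow> B *\<^sub>v v \<in> W'"
      and Bproj: "\<And>w. w \<in> W' \<Longrightarrow> B *\<^sub>v (mat_adjoint B *\<^sub>v w) = w"
      using invariant_isometry[OF \<rho> W' inv'] by metis
    have Bd: "dim_row B = ?n" "dim_col B = b" using B by auto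
    have B': "mat_adjoint B \<in> carrier_mat b ?n" using B by auto
    have AB: "mat_adjoint A * B = 0\<^sub>m a b"
    proof (rule mat_eqI_vec)
      fix v :: "complex vec" assume v: "v \<in> carrier_vec b"
      then have "(mat_adjoint A * B) *\<^sub>v v = mat_adjoint A *\<^sub>v (B *\<^sub>v v)"
        by (simp add: mat_mult_vec_assoc Ad Bd)
      also have "\<dots> = 0\<^sub>v a" using BW[OF v] by (simp add: W'_def)
      also have "\<dots> = 0\<^sub>m a b *\<^sub>v v" using zero_mat_mult_vec[OF v] by simp
      finally show "(mat_adjoint A * B) *\<^sub>v v = 0\<^sub>m a b *\<^sub>v v" .
    qed (use Ad Bd in auto)
    have BA: "mat_adjoint B * A = 0\<^sub>m b a"
    proof -
      have "mat_adjoint (mat_adjoint A * B) = mat_adjoint B * A" by (simp add: mat_adjoint_mult Ad Bd)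
      moreover have "mat_adjoint (0\<^sub>m a b) = (0\<^sub>m b a :: complex mat)" by (rule eq_matI) auto
      ultimately show ?thesis by (simp add: AB)
    qed
    have sum1: "A * mat_adjoint A + B * mat_adjoint B = 1\<^sub>m ?n"
    proof (rule mat_eqI_vec)
      fix v :: "complex vec" assume v: "v \<in> carrier_vec ?n"
      then have vd: "dim_vec v = ?n" by simp
      let ?p = "A *\<^sub>v (mat_adjoint A *\<^sub>v v)"
      have y: "mat_adjoint A *\<^sub>v v \<in> carrier_vec a" using Ad by (auto intro!: carrier_vecI)
      have p: "?p \<in> carrier_vec ?n" using Ad by (auto intro!: carrier_vecI)
      define u where "u = v + (- 1) \<cdot>\<^sub>v ?p"
      have uc: "u \<in> carrier_vec ?n" using v p by (simp add: u_def)
      have "mat_adjoint A *\<^sub>v ?p = (mat_adjoint A * A) *\<^sub>v (mat_adjoint A *\<^sub>v v)"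
        using y by (subst mat_mult_vec_assoc) (auto simp: Ad)
      then have Ap: "mat_adjoint A *\<^sub>v ?p = mat_adjoint A *\<^sub>v v" using y by (simp add: A(2))
      have "mat_adjoint A *\<^sub>v u = mat_adjoint A *\<^sub>v v + (- 1) \<cdot>\<^sub>v (mat_adjoint A *\<^sub>v v)"
        unfolding u_def using p v
        by (simp add: mult_add_distrib_mat_vec[OF A'] mult_mat_vec[OF A' p] Ap)
      also have "\<dots> = 0\<^sub>v a"
        using carrier_vecD[OF y] by (intro eq_vecI) (simp_all del: index_mult_mat_vec dim_mult_mat_vec)
      finally have "u \<in> W'" using uc by (simp add: W'_def)
      then have Bu: "B *\<^sub>v (mat_adjoint B *\<^sub>v u) = u" by (rule Bproj)
      have Bp: "mat_adjoint B *\<^sub>v ?p = 0\<^sub>v b"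
      proof -
        have "mat_adjoint B *\<^sub>v ?p = (mat_adjoint B * A) *\<^sub>v (mat_adjoint A *\<^sub>v v)"
          by (subst mat_mult_vec_assoc) (auto simp: Ad Bd)
        also have "\<dots> = 0\<^sub>v b"
          unfolding BA by (rule zero_mat_mult_vec[OF y])
        finally show ?thesis .
      qed
      have z: "mat_adjoint B *\<^sub>v v \<in> carrier_vec b" using Bd by (auto intro!: carrier_vecI)
      have "mat_adjoint B *\<^sub>v u = mat_adjoint B *\<^sub>v v + (- 1) \<cdot>\<^sub>v 0\<^sub>v b"
        unfolding u_def using p v
        by (simp add: mult_add_distrib_mat_vec[OF B'] mult_mat_vec[OF B' p] Bp)
      also have "\<dots> = mat_adjoint B *\<^sub>v v"
        using carrier_vecD[OF z] by (intro eq_vecI) (simp_all del: index_mult_mat_vec dim_mult_mat_vec)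
      finally have Bv: "B *\<^sub>v (mat_adjoint B *\<^sub>v v) = u" using Bu by simp
      have "(A * mat_adjoint A + B * mat_adjoint B) *\<^sub>v v = (A * mat_adjoint A) *\<^sub>v v + (B * mat_adjoint B) *\<^sub>v v"
        by (rule add_mult_distrib_mat_vec[of _ ?n ?n]) (use Ad Bd v in auto)
      also have "\<dots> = ?p + u"
        by (simp add: mat_mult_vec_assoc Ad Bd vd Bv)
      also have "\<dots> = v"
        using carrier_vecD[OF p] carrier_vecD[OF v]
        by (intro eq_vecI) (simp_all add: u_def del: index_mult_mat_vec dim_mult_mat_vec)
      finally show "(A * mat_adjoint A + B * mat_adjoint B) *\<^sub>v v = 1\<^sub>m ?n *\<^sub>v v" using v by simp
    qed (use Ad Bd in auto)
    \<comment> \<open>The traces of the two complementary projections are a and b, which gives ?n =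
      a + b; neither is 0 because W is proper.\<close>
    have "mtrace (A * mat_adjoint A + B * mat_adjoint B) = mtrace (A * mat_adjoint A) + mtrace (B * mat_adjoint B)"
      by (simp add: mtrace_def Ad Bd sum.distrib)
    then have "of_nat ?n = (of_nat a + of_nat b :: complex)"
      unfolding sum1 mtrace_commute[OF A(1) A'] mtrace_commute[OF B(1) B']
      by (simp add: A(2) B(2) mtrace_one)
    then have nab: "?n = a + b" by (metis of_nat_add of_nat_eq_iff)
    have "a \<noteq> 0"
    proof
      assume "a = 0"
      have all0: "w = 0\<^sub>v ?n" if "w \<in> W" for w
        using Aproj[OF that] \<open>a = 0\<close> Ad by (metis (no_types, lifting) eq_vecI dim_mult_mat_vec
            index_zero_vec index_mult_mat_vec scalar_prod_def sum.empty atLeastLessThan_empty_iff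
            mat_adjoint_dim(1) not_less_zero)
      have "W = {0\<^sub>v ?n}" using all0 WD(2) by blast
      then show False using proper(1) by contradiction
    qed
    moreover have "b \<noteq> 0"
    proof
      assume b0: "b = 0"
      have allW: "v \<in> W" if v: "v \<in> carrier_vec ?n" for v
      proof -
        have "B * mat_adjoint B = 0\<^sub>m ?n ?n"
          by (rule eq_matI) (auto simp: Bd b0 scalar_prod_def)
        then have "A * mat_adjoint A = 1\<^sub>m ?n"
          using sum1 right_add_zero_mat[OF mult_carrier_mat[OF A(1) A']] by simp
        then have eq: "A *\<^sub>v (mat_adjoint A *\<^sub>v v) = v"
          using v mat_mult_vec_assoc[of A "mat_adjoint A" v] Ad by simp
        have "mat_adjoint A *\<^sub>v v \<in> carrier_vec a" using Ad by (auto intro!: carrier_vecI)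
        from AW[OF this] show ?thesis by (simp only: eq)
      qed
      have "W = carrier_vec ?n" using allW WD(1) by blast
      then show False using proper(2) by contradiction
    qed
    ultimately have lt: "a < ?n" "b < ?n" using nab by auto
    note rA = subrep[OF \<rho> A] and rB = subrep[OF \<rho> B]
    obtain N s S where "decomposes Ghat (\<lambda>g. mat_adjoint A * \<rho> g * A) N s S"
      using less.hyps[of "\<lambda>g. mat_adjoint A * \<rho> g * A"] rA lt by metis
    moreover obtain M t T where "decomposes Ghat (\<lambda>g. mat_adjoint B * \<rho> g * B) M t T"
      using less.hyps[of "\<lambda>g. mat_adjoint B * \<rho> g * B"] rB lt by metis
    ultimately show ?thesis
      using decomposes_append[OF G \<rho> A B AB sum1] by blast
  qed
qed

text \<open>Multiply the resolution of the identity by \<rho> g and move \<rho> g past each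
  \<open>T k\<close>. Cyclicity of the trace then cancels the isometries.\<close>

lemma decomposes_values:
  assumes G: "dual_transversal Ghat" and \<rho>: "unitary_rep \<rho>" and dec: "decomposes Ghat \<rho> N s T"
  shows "\<rho> g = msum (rdim \<rho>) (rdim \<rho>) (\<lambda>k. T k * s k g * mat_adjoint (T k)) N"
    and "mtrace (\<rho> g) = (\<Sum>k<N. mtrace (s k g))"
proof -
  let ?n = "rdim \<rho>"
  note \<rho>d = unitary_rep_dims[OF \<rho>]
  have T: "T k \<in> carrier_mat ?n (rdim (s k))" and Ts: "T k * s k g = \<rho> g * T k"
    and TT: "mat_adjoint (T k) * T k = 1\<^sub>m (rdim (s k))" and s: "s k g \<in> carrier_mat (rdim (s k)) (rdim (s k))"
    if "k < N" for k
    using dec that G unfolding decomposes_def dual_transversal_def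
    by (auto intro!: unitary_rep_carrier irrep_unitary_rep)
  have Td: "dim_row (T k) = ?n" "dim_col (T k) = rdim (s k)" "dim_row (s k g) = rdim (s k)"
    "dim_col (s k g) = rdim (s k)" if "k < N" for k
    using T[OF that] s[OF that] by auto
  have TT': "T k * mat_adjoint (T k) \<in> carrier_mat ?n ?n" if "k < N" for k
    using Td[OF that] by auto
  have "\<rho> g = \<rho> g * msum ?n ?n (\<lambda>k. T k * mat_adjoint (T k)) N"
    using dec \<rho>d by (simp add: decomposes_def mat_mult_one_right)
  also have "\<dots> = msum ?n ?n (\<lambda>k. \<rho> g * (T k * mat_adjoint (T k))) N"
    by (rule msum_mult_left[OF unitary_rep_carrier[OF \<rho>] TT'])
  also have "\<dots> = msum ?n ?n (\<lambda>k. T k * s k g * mat_adjoint (T k)) N"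
    by (rule msum_cong) (simp add: Ts mat_mult_assoc \<rho>d Td)
  finally show *: "\<rho> g = msum ?n ?n (\<lambda>k. T k * s k g * mat_adjoint (T k)) N" .
  have "mtrace (T k * s k g * mat_adjoint (T k)) = mtrace (s k g)" if k: "k < N" for k
  proof -
    have "mtrace (T k * (s k g * mat_adjoint (T k))) = mtrace (s k g * mat_adjoint (T k) * T k)"
      by (rule mtrace_commute[OF T[OF k]]) (use Td[OF k] in auto)
    then show ?thesis
      by (simp add: mat_mult_assoc Td k TT mat_mult_one_right)
  qed
  moreover have "mtrace (\<rho> g) = (\<Sum>k<N. mtrace (T k * s k g * mat_adjoint (T k)))"
    by (subst *, rule mtrace_msum) (use Td in auto)
  ultimately show "mtrace (\<rho> g) = (\<Sum>k<N. mtrace (s k g))" by simp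
qed

section \<open>Multiplicities and tensor products\<close>

lemma intertwiners_subspace:
  assumes "unitary_rep \<sigma>" "unitary_rep \<rho>"
  shows "subspace class_ring (intertwiners \<sigma> \<rho>) (module_mat TYPE(complex) (rdim \<rho>) (rdim \<sigma>))"
proof -
  let ?V = "module_mat TYPE(complex) (rdim \<rho>) (rdim \<sigma>)"
  note \<sigma> = unitary_rep_carrier[OF assms(1)] and \<rho> = unitary_rep_carrier[OF assms(2)]
  have vs: "vectorspace class_ring ?V" by (rule matrix_vs)
  have "module class_ring ?V" using vs by (simp add: vectorspace_def)
  then have "submodule class_ring (intertwiners \<sigma> \<rho>) ?V"
    unfolding submodule_def
    using add_mult_distrib_mat[OF _ _ \<sigma>] mult_add_distrib_mat[OF \<rho>]
      mult_smult_assoc_mat[OF _ \<sigma>] mult_smult_distrib[OF \<rho>] left_mult_zero_mat[OF \<sigma>] right_mult_zero_mat[OF \<rho>]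
    by (auto simp: intertwiners_def module_mat_simps)
  then show ?thesis using vs by (simp add: subspace_def)
qed

text \<open>The embeddings \<open>T k\<close> with s k = \<sigma> form a basis of the intertwiners.
  For an intertwiner S, Schur's lemma makes each (T k)* S scalar or zero, so inserting the
  resolution of the identity in front of S writes S as a combination of them. Independence follows
  from the orthogonality of their ranges.\<close>

lemma dim_Hom_eq_multiplicity:
  assumes G: "dual_transversal Ghat" and \<rho>: "unitary_rep \<rho>" and dec: "decomposes Ghat \<rho> N s T"
    and \<sigma>G: "\<sigma> \<in> Ghat"
  shows "dim_Hom \<sigma> \<rho> = card {k. k < N \<and> s k = \<sigma>}"
proof -
  let ?n = "rdim \<rho>" and ?d = "rdim \<sigma>" and ?H = "intertwiners \<sigma> \<rho>"
  define I where "I = {k. k < N \<and> s k = \<sigma>}"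
  define V where "V = (module_mat TYPE(complex) ?n ?d) \<lparr>carrier := ?H\<rparr>"
  have irr: "irrep \<sigma>" and s_irr: "k < N \<Longrightarrow> irrep (s k)" and sG: "k < N \<Longrightarrow> s k \<in> Ghat" for k
    using G dec \<sigma>G unfolding dual_transversal_def decomposes_def by auto
  note \<sigma>r = irrep_unitary_rep[OF irr]
  have d_pos: "?d > 0" using irr by (simp add: irrep_def)
  note \<rho>d = unitary_rep_dims[OF \<rho>] and \<sigma>d = unitary_rep_dims[OF \<sigma>r]
  have T: "T k \<in> carrier_mat ?n (rdim (s k))" and Ts: "T k * s k g = \<rho> g * T k" if "k < N" for k g
    using dec that unfolding decomposes_def by auto
  have TT: "mat_adjoint (T k) * T l = (if k = l then 1\<^sub>m (rdim (s k)) else 0\<^sub>m (rdim (s k)) (rdim (s l)))"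
    if "k < N" "l < N" for k l
    using dec that unfolding decomposes_def by blast
  have Td: "dim_row (T k) = ?n" "dim_col (T k) = rdim (s k)"
    "dim_row (s k g) = rdim (s k)" "dim_col (s k g) = rdim (s k)" if "k < N" for k g
    using T[OF that] unitary_rep_dims[OF irrep_unitary_rep[OF s_irr[OF that]], of g] by auto
  interpret V0: vectorspace class_ring "module_mat TYPE(complex) ?n ?d" by (rule matrix_vs)
  interpret W: vectorspace class_ring V
    unfolding V_def by (rule V0.subspace_is_vs[OF intertwiners_subspace[OF \<sigma>r \<rho>]])
  have V_simps: "carrier V = ?H" "add V = (+)" "zero V = 0\<^sub>m ?n ?d" "smult V = (\<cdot>\<^sub>m)"
    by (simp_all add: V_def module_mat_simps)
  have H: "?H \<subseteq> carrier_mat ?n ?d" by (auto simp: intertwiners_def)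
  \<comment> \<open>Translates the linear combinations of the abstract module into sums of matrix
    entries.\<close>
  have lincomb: "W.lincomb a B \<in> ?H \<and>
      (\<forall>i<?n. \<forall>j<?d. W.lincomb a B $$ (i, j) = (\<Sum>M\<in>B. a M * M $$ (i, j)))"
    if "finite B" "B \<subseteq> ?H" for a B
    using that
  proof (induction rule: finite_induct)
    case empty
    have "W.lincomb a {} = 0\<^sub>m ?n ?d" by (simp add: W.lincomb_def V_simps)
    moreover have "0\<^sub>m ?n ?d \<in> ?H" using W.zero_closed by (simp add: V_simps)
    ultimately show ?case by simp
  next
    case (insert M B)
    have smult: "a X \<cdot>\<^sub>m X \<in> ?H" if "X \<in> ?H" for X
      using W.smult_closed[of "a X" X] that by (simp add: V_simps class_ring_simps)
    have "W.lincomb a (insert M B) = a M \<cdot>\<^sub>m M + W.lincomb a B"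
      unfolding W.lincomb_def using insert smult
      by (subst W.finsum_insert) (auto simp: V_simps)
    moreover have "a M \<cdot>\<^sub>m M + W.lincomb a B \<in> ?H"
      using W.a_closed[of "a M \<cdot>\<^sub>m M" "W.lincomb a B"] insert smult by (simp add: V_simps)
    moreover have "dim_row (W.lincomb a B) = ?n" "dim_col (W.lincomb a B) = ?d"
      using insert H by auto
    moreover have "dim_row M = ?n" "dim_col M = ?d" using insert H by auto
    ultimately show ?case using insert by simp
  qed
  have inj: "inj_on T I"
  proof (rule inj_onI)
    fix k l assume kl: "k \<in> I" "l \<in> I" "T k = T l"
    have "mat_adjoint (T k) * T k = 1\<^sub>m ?d" using TT[of k k] kl by (simp add: I_def)
    then have "mat_adjoint (T k) * T l = 1\<^sub>m ?d" using kl by simp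
    moreover have "mat_adjoint (T k) * T l = 0\<^sub>m ?d ?d" if "k \<noteq> l"
      using TT[of k l] kl that by (simp add: I_def)
    moreover have "(1\<^sub>m ?d :: complex mat) $$ (0, 0) \<noteq> (0\<^sub>m ?d ?d) $$ (0, 0)" using d_pos by simp
    ultimately show "k = l" by metis
  qed
  have TI: "T ` I \<subseteq> ?H" using T Ts by (auto simp: I_def intertwiners_def)
  have fin: "finite (T ` I)" by (simp add: I_def)
  have "W.span (T ` I) = ?H"
  proof
    show "W.span (T ` I) \<subseteq> ?H"
      using W.span_is_subset2[of "T ` I"] TI by (simp add: V_simps)
    show "?H \<subseteq> W.span (T ` I)"
    proof
      fix S assume S: "S \<in> ?H"
      then have Sc: "S \<in> carrier_mat ?n ?d" and Si: "\<And>g. S * \<sigma> g = \<rho> g * S"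
        by (auto simp: intertwiners_def)
      then have Sd: "dim_row S = ?n" "dim_col S = ?d" by auto
      \<comment> \<open>For s k = \<sigma> the matrix (T k)* S is scalar, so its entry (0, 0) is the
        coefficient of \<open>T k\<close> in S.\<close>
      define a where "a = (\<lambda>M. (mat_adjoint M * S) $$ (0, 0))"
      have coef: "T k * (mat_adjoint (T k) * S) = (if s k = \<sigma> then a (T k) \<cdot>\<^sub>m T k else 0\<^sub>m ?n ?d)"
        if k: "k < N" for k
      proof -
        have "s k g * mat_adjoint (T k) = mat_adjoint (T k) * \<rho> g" for g
        proof -
          have "mat_adjoint (T k * s k (- g)) = mat_adjoint (\<rho> (- g) * T k)" by (simp only: Ts[OF k])
          then show ?thesis
            by (simp add: mat_adjoint_mult Td[OF k] \<rho>d flip: unitary_rep_minus(1)[OF \<rho>]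
                unitary_rep_minus(1)[OF irrep_unitary_rep[OF s_irr[OF k]]])
        qed
        note adj = this
        have "s k g * (mat_adjoint (T k) * S) = mat_adjoint (T k) * S * \<sigma> g" for g
        proof -
          have "s k g * (mat_adjoint (T k) * S) = (s k g * mat_adjoint (T k)) * S"
            by (simp add: mat_mult_assoc Td[OF k] Sd)
          also have "\<dots> = mat_adjoint (T k) * (\<rho> g * S)"
            by (simp add: adj mat_mult_assoc Td[OF k] Sd \<rho>d)
          also have "\<dots> = mat_adjoint (T k) * S * \<sigma> g"
            by (simp add: mat_mult_assoc Td[OF k] Sd \<sigma>d flip: Si)
          finally show ?thesis .
        qed
        note Schur = Schur_transversal[OF G sG[OF k] \<sigma>G _ this]
        have c: "mat_adjoint (T k) * S \<in> carrier_mat (rdim (s k)) ?d"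
          using Td[OF k] Sd by auto
        show ?thesis
        proof (cases "s k = \<sigma>")
          case True
          then obtain c' where c': "mat_adjoint (T k) * S = c' \<cdot>\<^sub>m 1\<^sub>m ?d"
            using Schur(2)[OF c] by auto
          then have "a (T k) = c'" using d_pos by (simp add: a_def)
          moreover have "T k * (c' \<cdot>\<^sub>m 1\<^sub>m ?d) = c' \<cdot>\<^sub>m T k"
            using T[OF k] True by (subst mult_smult_distrib[of _ ?n ?d _ ?d]) (auto simp: mat_mult_one_right)
          ultimately show ?thesis using c' True by simp
        next
          case False
          then show ?thesis using Schur(1)[OF c] T[OF k] by simp
        qed
      qed
      have TTc: "T k * mat_adjoint (T k) \<in> carrier_mat ?n ?n" if "k < N" for k
        using Td[OF that] by auto
      have "S = msum ?n ?n (\<lambda>k. T k * mat_adjoint (T k)) N * S"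
        using dec Sd unfolding decomposes_def by (simp add: mat_mult_one_left)
      also have "\<dots> = msum ?n ?d (\<lambda>k. T k * mat_adjoint (T k) * S) N"
        by (rule msum_mult_right[OF TTc Sc])
      also have "\<dots> = msum ?n ?d (\<lambda>k. if s k = \<sigma> then a (T k) \<cdot>\<^sub>m T k else 0\<^sub>m ?n ?d) N"
        by (rule msum_cong) (simp add: mat_mult_assoc Td Sd coef)
      finally have S_eq: "S = msum ?n ?d (\<lambda>k. if s k = \<sigma> then a (T k) \<cdot>\<^sub>m T k else 0\<^sub>m ?n ?d) N" .
      have lc: "W.lincomb a (T ` I) \<in> ?H"
        "\<And>i j. i < ?n \<Longrightarrow> j < ?d \<Longrightarrow> W.lincomb a (T ` I) $$ (i, j) = (\<Sum>M\<in>T ` I. a M * M $$ (i, j))"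
        using lincomb[OF fin TI] by auto
      have "S = W.lincomb a (T ` I)"
      proof (rule eq_matI)
        fix i j assume "i < dim_row (W.lincomb a (T ` I))" "j < dim_col (W.lincomb a (T ` I))"
        then have ij: "i < ?n" "j < ?d" using lc(1) H by auto
        have "S $$ (i, j) = (\<Sum>k<N. if s k = \<sigma> then a (T k) * T k $$ (i, j) else 0)"
          using ij Td by (subst S_eq) (auto simp: msum_def intro!: sum.cong)
        also have "\<dots> = (\<Sum>k\<in>I. a (T k) * T k $$ (i, j))"
          unfolding I_def by (subst sum.inter_filter[symmetric]) (auto intro!: sum.cong)
        also have "\<dots> = (\<Sum>M\<in>T ` I. a M * M $$ (i, j))"
          by (simp add: sum.reindex[OF inj])
        finally show "S $$ (i, j) = W.lincomb a (T ` I) $$ (i, j)" using lc(2)[OF ij] by simp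
      qed (use lc(1) H Sd in auto)
      then show "S \<in> W.span (T ` I)"
        unfolding W.span_def using fin by (auto simp: class_ring_simps)
    qed
  qed
  moreover have "W.lin_indpt (T ` I)"
  proof
    assume "W.lin_dep (T ` I)"
    then obtain B a M where B: "finite B" "B \<subseteq> T ` I" and 0: "W.lincomb a B = 0\<^sub>m ?n ?d"
      and M: "M \<in> B" "a M \<noteq> 0"
      unfolding W.lin_dep_def by (auto simp: V_simps class_ring_simps)
    have BH: "B \<subseteq> ?H" using B TI by blast
    have Mc: "X \<in> carrier_mat ?n ?d" if "X \<in> B" for X using that BH H by auto
    \<comment> \<open>Column 0 alone suffices to tell the embeddings apart, since (T k)* (T l) is
      the identity or zero and the dimension of \<sigma> is positive.\<close>
    have orth: "(\<Sum>r<?n. cnj (M $$ (r, 0)) * X $$ (r, 0)) = (if X = M then 1 else 0)" if X: "X \<in> B" for X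
    proof -
      obtain k l where kl: "k \<in> I" "l \<in> I" "M = T k" "X = T l" using M(1) X B(2) by blast
      have "(\<Sum>r<?n. cnj (M $$ (r, 0)) * X $$ (r, 0)) = (mat_adjoint M * X) $$ (0, 0)"
        using Mc[OF M(1)] d_pos
        by (subst mat_mult_index[OF mat_adjoint_carrier[OF Mc[OF M(1)]] Mc[OF X]]) (auto intro!: sum.cong)
      also have "\<dots> = (if k = l then 1 else 0)"
        using TT[of k l] kl d_pos by (auto simp: I_def)
      also have "k = l \<longleftrightarrow> X = M" using inj kl by (auto simp: inj_on_def)
      finally show ?thesis .
    qed
    have "0 = (\<Sum>r<?n. cnj (M $$ (r, 0)) * W.lincomb a B $$ (r, 0))"
      using d_pos by (simp add: 0)
    also have "\<dots> = (\<Sum>r<?n. \<Sum>X\<in>B. a X * (cnj (M $$ (r, 0)) * X $$ (r, 0)))"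
      using lincomb[OF B(1) BH, of a] d_pos by (intro sum.cong) (auto simp: sum_distrib_left mult_ac)
    also have "\<dots> = (\<Sum>X\<in>B. a X * (\<Sum>r<?n. cnj (M $$ (r, 0)) * X $$ (r, 0)))"
      by (subst sum.swap) (simp add: sum_distrib_left)
    also have "\<dots> = (\<Sum>X\<in>B. if X = M then a M else 0)"
      by (intro sum.cong) (auto simp: orth)
    also have "\<dots> = a M" using B(1) M(1) by simp
    finally show False using M(2) by simp
  qed
  ultimately have "W.basis (T ` I)" using TI by (simp add: W.basis_def V_simps)
  then have "W.dim = card (T ` I)" by (rule W.dim_basis[OF fin])
  then show ?thesis
    using card_image[OF inj] by (simp add: dim_Hom_def V_def I_def)
qed

section \<open>Kronecker products and tensor product representations\<close>

lemma sum_div_mod: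
  fixes f :: "nat \<Rightarrow> nat \<Rightarrow> 'a::comm_monoid_add"
  shows "(\<Sum>r<n * m. f (r div m) (r mod m)) = (\<Sum>a<n. \<Sum>b<m. f a b)"
proof (cases "m = 0")
  case False
  have lt: "a * m + b < n * m" if "a < n" "b < m" for a b
  proof -
    have "a * m + b < Suc a * m" using that by simp
    also have "\<dots> \<le> n * m" using that by (intro mult_le_mono1) simp
    finally show ?thesis .
  qed
  have "(\<Sum>r<n * m. f (r div m) (r mod m)) = (\<Sum>(a, b)\<in>{..<n} \<times> {..<m}. f a b)"
    by (intro sum.reindex_bij_witness[of _ "\<lambda>(a, b). a * m + b" "\<lambda>r. (r div m, r mod m)"])
      (use False lt in \<open>auto simp: less_mult_imp_div_less\<close>)
  then show ?thesis by (simp add: sum.cartesian_product)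
qed simp

lemma kronecker_carrier:
  "A \<in> carrier_mat n n \<Longrightarrow> B \<in> carrier_mat m m \<Longrightarrow> kronecker A B \<in> carrier_mat (n * m) (n * m)"
  by (auto simp: kronecker_def)

lemma kronecker_index:
  assumes "A \<in> carrier_mat n n" "B \<in> carrier_mat m m" "i < n * m" "j < n * m"
  shows "kronecker A B $$ (i, j) = A $$ (i div m, j div m) * B $$ (i mod m, j mod m)"
  using assms by (auto simp: kronecker_def)

lemma div_mod_less:
  assumes "(i :: nat) < n * m"
  shows "i div m < n" "i mod m < m"
  using assms by (auto simp: less_mult_imp_div_less intro!: mod_less_divisor gr0I)

lemma kronecker_mult:
  assumes A: "A \<in> carrier_mat n n" "C \<in> carrier_mat n n" and B: "B \<in> carrier_mat m m" "D \<in> carrier_mat m m"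
  shows "kronecker (A * C) (B * D) = kronecker A B * kronecker C D"
proof (rule eq_matI)
  note AB = kronecker_carrier[OF A(1) B(1)] and CD = kronecker_carrier[OF A(2) B(2)]
  fix i j assume "i < dim_row (kronecker A B * kronecker C D)" "j < dim_col (kronecker A B * kronecker C D)"
  then have ij: "i < n * m" "j < n * m" using AB CD by auto
  note lt = div_mod_less[OF ij(1)] div_mod_less[OF ij(2)]
  have AC: "A * C \<in> carrier_mat n n" and BD: "B * D \<in> carrier_mat m m" using A B by auto
  have "(kronecker A B * kronecker C D) $$ (i, j) =
      (\<Sum>r<n * m. (A $$ (i div m, r div m) * B $$ (i mod m, r mod m)) * (C $$ (r div m, j div m) * D $$ (r mod m, j mod m)))"
    unfolding mat_mult_index[OF AB CD ij]
    by (intro sum.cong refl) (simp add: kronecker_index[OF A(1) B(1)] kronecker_index[OF A(2) B(2)] ij)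
  also have "\<dots> = (\<Sum>a<n. \<Sum>b<m. (A $$ (i div m, a) * B $$ (i mod m, b)) * (C $$ (a, j div m) * D $$ (b, j mod m)))"
    by (rule sum_div_mod)
  also have "\<dots> = (\<Sum>a<n. A $$ (i div m, a) * C $$ (a, j div m)) * (\<Sum>b<m. B $$ (i mod m, b) * D $$ (b, j mod m))"
    by (simp add: sum_product mult_ac)
  also have "\<dots> = kronecker (A * C) (B * D) $$ (i, j)"
    unfolding kronecker_index[OF AC BD ij] mat_mult_index[OF A lt(1,3)] mat_mult_index[OF B lt(2,4)] ..
  finally show "kronecker (A * C) (B * D) $$ (i, j) = (kronecker A B * kronecker C D) $$ (i, j)" by simp
qed (use A B in \<open>auto simp: kronecker_def\<close>)

lemma kronecker_adjoint:
  assumes A: "A \<in> carrier_mat n n" and B: "B \<in> carrier_mat m m"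
  shows "kronecker (mat_adjoint A) (mat_adjoint B) = mat_adjoint (kronecker A B)"
proof (rule eq_matI)
  note AB = kronecker_carrier[OF A B]
  fix i j assume "i < dim_row (mat_adjoint (kronecker A B))" "j < dim_col (mat_adjoint (kronecker A B))"
  then have ij: "i < n * m" "j < n * m" using AB by auto
  note lt = div_mod_less[OF ij(1)] div_mod_less[OF ij(2)]
  have d: "dim_row A = n" "dim_col A = n" "dim_row B = m" "dim_col B = m"
    "dim_row (kronecker A B) = n * m" "dim_col (kronecker A B) = n * m" using A B AB by auto
  show "kronecker (mat_adjoint A) (mat_adjoint B) $$ (i, j) = mat_adjoint (kronecker A B) $$ (i, j)"
    using ij lt
    by (simp add: d kronecker_index[OF mat_adjoint_carrier[OF A] mat_adjoint_carrier[OF B]] kronecker_index[OF A B])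
qed (use A B in \<open>auto simp: kronecker_def\<close>)

lemma kronecker_one: "kronecker (1\<^sub>m n) (1\<^sub>m m) = 1\<^sub>m (n * m)"
proof (rule eq_matI)
  fix i j assume "i < dim_row (1\<^sub>m (n * m) :: complex mat)" "j < dim_col (1\<^sub>m (n * m) :: complex mat)"
  then have ij: "i < n * m" "j < n * m" by auto
  note lt = div_mod_less[OF ij(1)] div_mod_less[OF ij(2)]
  have "i = j \<longleftrightarrow> i div m = j div m \<and> i mod m = j mod m" by (metis div_mult_mod_eq)
  then show "kronecker (1\<^sub>m n) (1\<^sub>m m) $$ (i, j) = 1\<^sub>m (n * m) $$ (i, j)"
    using ij lt by (auto simp: kronecker_index[OF one_carrier_mat one_carrier_mat])
qed (auto simp: kronecker_def)

lemma mtrace_kronecker: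
  assumes A: "A \<in> carrier_mat n n" and B: "B \<in> carrier_mat m m"
  shows "mtrace (kronecker A B) = mtrace A * mtrace B"
proof -
  have "mtrace (kronecker A B) = (\<Sum>r<n * m. A $$ (r div m, r div m) * B $$ (r mod m, r mod m))"
    unfolding mtrace_def using kronecker_carrier[OF A B]
    by (intro sum.cong) (auto simp: kronecker_index[OF A B])
  also have "\<dots> = (\<Sum>a<n. \<Sum>b<m. A $$ (a, a) * B $$ (b, b))" by (rule sum_div_mod)
  finally show ?thesis using A B by (simp add: mtrace_def sum_product)
qed

lemma unitary_rep_tensor:
  assumes \<pi>: "unitary_rep \<pi>" and \<sigma>: "unitary_rep \<sigma>"
  shows "unitary_rep (tensor_rep \<pi> \<sigma>)" "rdim (tensor_rep \<pi> \<sigma>) = rdim \<pi> * rdim \<sigma>"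
proof -
  let ?\<tau> = "tensor_rep \<pi> \<sigma>" and ?n = "rdim \<pi>" and ?m = "rdim \<sigma>"
  note \<pi>c = unitary_rep_carrier[OF \<pi>] and \<sigma>c = unitary_rep_carrier[OF \<sigma>]
  show dim: "rdim ?\<tau> = ?n * ?m"
    by (simp add: tensor_rep_def rdim_def kronecker_def)
  have c: "?\<tau> g \<in> carrier_mat (?n * ?m) (?n * ?m)" for g
    unfolding tensor_rep_def by (rule kronecker_carrier[OF \<pi>c \<sigma>c])
  have add: "?\<tau> (g + h) = ?\<tau> g * ?\<tau> h" for g h
    unfolding tensor_rep_def unitary_rep_add[OF \<pi>] unitary_rep_add[OF \<sigma>]
    by (rule kronecker_mult[OF \<pi>c \<pi>c \<sigma>c \<sigma>c])
  have adj: "?\<tau> (- g) = mat_adjoint (?\<tau> g)" for g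
    unfolding tensor_rep_def unitary_rep_minus(1)[OF \<pi>] unitary_rep_minus(1)[OF \<sigma>]
    by (rule kronecker_adjoint[OF \<pi>c \<sigma>c])
  have zero: "?\<tau> 0 = 1\<^sub>m (?n * ?m)"
    unfolding tensor_rep_def unitary_rep_minus(2)[OF \<pi>] unitary_rep_minus(2)[OF \<sigma>]
    by (rule kronecker_one)
  have "unitary_mat (?n * ?m) (?\<tau> g)" for g
    unfolding unitary_mat_def using c[of g] add[of g "- g"] add[of "- g" g] by (simp add: adj zero)
  moreover have "continuous_on UNIV (\<lambda>g. ?\<tau> g $$ (i, j))" if ij: "i < ?n * ?m" "j < ?n * ?m" for i j
    unfolding tensor_rep_def kronecker_index[OF \<pi>c \<sigma>c ij]
    by (intro continuous_intros unitary_rep_continuous[OF \<pi>] unitary_rep_continuous[OF \<sigma>]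
        div_mod_less[OF ij(1)] div_mod_less[OF ij(2)])
  ultimately show "unitary_rep ?\<tau>" unfolding unitary_rep_def dim using add by blast
qed

section \<open>Characters and Schur orthogonality\<close>

abbreviation character :: "('g::topological_group_add \<Rightarrow> complex mat) \<Rightarrow> 'g \<Rightarrow> complex" where
  "character \<pi> g \<equiv> mtrace (\<pi> g)"

lemma character_eq_sum:
  assumes "unitary_rep \<pi>"
  shows "character \<pi> g = (\<Sum>i<rdim \<pi>. \<pi> g $$ (i, i))"
  by (simp add: mtrace_def unitary_rep_dims[OF assms])

lemma continuous_character:
  assumes "unitary_rep \<pi>"
  shows "continuous_on UNIV (character \<pi>)"
  unfolding character_eq_sum[OF assms]
  by (intro continuous_intros unitary_rep_continuous[OF assms]) auto

text \<open>By unitarity \<pi> (- y) is the adjoint of \<pi> y, so the trace of the product is a sum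
  over entries. This identifies the kernel of the projection onto the coefficients of \<pi>.\<close>

lemma character_diff:
  assumes \<pi>: "unitary_rep \<pi>"
  shows "character \<pi> (x - y) = (\<Sum>i<rdim \<pi>. \<Sum>j<rdim \<pi>. \<pi> x $$ (i, j) * cnj (\<pi> y $$ (i, j)))"
proof -
  have "\<pi> (x + - y) $$ (i, i) = (\<Sum>j<rdim \<pi>. \<pi> x $$ (i, j) * cnj (\<pi> y $$ (i, j)))" if "i < rdim \<pi>" for i
    unfolding unitary_rep_add_index[OF \<pi> that that]
    using that by (intro sum.cong) (auto simp: unitary_rep_minus(1)[OF \<pi>] unitary_rep_dims[OF \<pi>])
  then show ?thesis by (simp add: character_eq_sum[OF \<pi>])
qed

lemma unitary_rep_row_norm:
  assumes \<pi>: "unitary_rep \<pi>" and i: "i < rdim \<pi>"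
  shows "(\<Sum>j<rdim \<pi>. (cmod (\<pi> g $$ (i, j)))\<^sup>2) = 1"
proof -
  have "complex_of_real (\<Sum>j<rdim \<pi>. (cmod (\<pi> g $$ (i, j)))\<^sup>2) =
      (\<Sum>j<rdim \<pi>. \<pi> g $$ (i, j) * \<pi> (- g) $$ (j, i))"
    using i by (simp add: complex_norm_square unitary_rep_minus(1)[OF \<pi>] unitary_rep_dims[OF \<pi>] del: of_real_power)
  also have "\<dots> = \<pi> (g + - g) $$ (i, i)" by (rule unitary_rep_add_index[OF \<pi> i i, symmetric])
  also have "\<dots> = 1" using i by (simp add: unitary_rep_minus(2)[OF \<pi>])
  finally show ?thesis using of_real_eq_1_iff by blast
qed

text \<open>Rows of a unitary matrix have norm 1, so diagonal entries have real part at most 1. If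
  their sum attains the dimension, every diagonal entry is 1, and the unit rows leave no room off
  the diagonal.\<close>

lemma Re_characteracter_less:
  assumes \<pi>: "unitary_rep \<pi>" and ne: "\<pi> g \<noteq> 1\<^sub>m (rdim \<pi>)"
  shows "Re (character \<pi> g) < rdim \<pi>"
proof (rule ccontr)
  let ?d = "rdim \<pi>"
  assume "\<not> Re (character \<pi> g) < ?d"
  then have ge: "(\<Sum>i<?d. 1) \<le> (\<Sum>i<?d. Re (\<pi> g $$ (i, i)))"
    by (simp add: character_eq_sum[OF \<pi>])
  note row = unitary_rep_row_norm[OF \<pi>, of _ g]
  have sq: "(cmod (\<pi> g $$ (i, j)))\<^sup>2 \<le> 1" if "i < ?d" "j < ?d" for i j
    using member_le_sum[of j "{..<?d}" "\<lambda>j. (cmod (\<pi> g $$ (i, j)))\<^sup>2"] row[of i] that by auto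
  have le: "Re (\<pi> g $$ (i, i)) \<le> 1" if "i < ?d" for i
    using complex_Re_le_cmod[of "\<pi> g $$ (i, i)"] sq[OF that that] power2_le_imp_le[of "cmod (\<pi> g $$ (i, i))" 1]
    by simp
  have re1: "Re (\<pi> g $$ (i, i)) = 1" if i: "i < ?d" for i
  proof (rule ccontr)
    assume "Re (\<pi> g $$ (i, i)) \<noteq> 1"
    then have "Re (\<pi> g $$ (i, i)) < 1" using le[OF i] by simp
    then have "(\<Sum>i<?d. Re (\<pi> g $$ (i, i))) < (\<Sum>i<?d. 1)"
      using le i by (intro sum_strict_mono_ex1) auto
    then show False using ge by simp
  qed
  have "\<pi> g $$ (i, j) = (if i = j then 1 else 0)" if ij: "i < ?d" "j < ?d" for i j
  proof -
    have "1 \<le> cmod (\<pi> g $$ (i, i))"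
      using complex_Re_le_cmod[of "\<pi> g $$ (i, i)"] re1[OF ij(1)] by simp
    then have c1: "(cmod (\<pi> g $$ (i, i)))\<^sup>2 = 1"
      using sq[OF ij(1) ij(1)] by (simp add: antisym)
    show ?thesis
    proof (cases "i = j")
      case True
      have "(Re (\<pi> g $$ (i, i)))\<^sup>2 + (Im (\<pi> g $$ (i, i)))\<^sup>2 = 1"
        using c1 by (simp add: cmod_power2)
      then have "\<pi> g $$ (i, i) = 1"
        using re1[OF ij(1)] by (simp add: complex_eq_iff)
      then show ?thesis using True by simp
    next
      case False
      have "(\<Sum>l\<in>{i, j}. (cmod (\<pi> g $$ (i, l)))\<^sup>2) \<le> (\<Sum>l<?d. (cmod (\<pi> g $$ (i, l)))\<^sup>2)"
        using ij by (intro sum_mono2) auto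
      then have "(cmod (\<pi> g $$ (i, j)))\<^sup>2 \<le> 0"
        using False c1 row[OF ij(1)] by simp
      then show ?thesis using False by simp
    qed
  qed
  then have "\<pi> g = 1\<^sub>m ?d"
    by (intro eq_matI) (auto simp: unitary_rep_dims[OF \<pi>])
  then show False using ne by simp
qed

lemma finite_sum_le_infsum_ennreal:
  fixes f :: "'a \<Rightarrow> ennreal"
  assumes "finite B" "B \<subseteq> A"
  shows "sum f B \<le> infsum f A"
  unfolding nonneg_infsum_complete[OF zero_le]
  by (rule SUP_upper) (use assms in auto)

locale compact_haar_dual = compact_haar \<mu>
  for \<mu> :: "'g::{topological_group_add, t2_space, second_countable_topology} measure" +
  fixes Ghat :: "('g \<Rightarrow> complex mat) set"
  assumes transversal: "dual_transversal Ghat"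
begin

lemma Ghat_irrep: "\<pi> \<in> Ghat \<Longrightarrow> irrep \<pi>"
  using transversal by (simp add: dual_transversal_def)

lemma Ghat_rep: "\<pi> \<in> Ghat \<Longrightarrow> unitary_rep \<pi>"
  by (rule irrep_unitary_rep[OF Ghat_irrep])

lemma Ghat_dim_pos: "\<pi> \<in> Ghat \<Longrightarrow> rdim \<pi> > 0"
  using Ghat_irrep by (auto simp: irrep_def)

lemma Ghat_continuous:
  "\<pi> \<in> Ghat \<Longrightarrow> i < rdim \<pi> \<Longrightarrow> j < rdim \<pi> \<Longrightarrow> continuous_on UNIV (\<lambda>g. \<pi> g $$ (i, j))"
  by (rule unitary_rep_continuous[OF Ghat_rep])

text \<open>If every irreducible summand of a separating \<rho> were trivial at y, the resolution of
  the identity would make \<rho> y trivial too.\<close>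

lemma Ghat_separates:
  assumes "(y :: 'g) \<noteq> 0"
  obtains \<pi> where "\<pi> \<in> Ghat" "Re (character \<pi> y) < rdim \<pi>"
proof -
  obtain \<rho> where \<rho>: "unitary_rep \<rho>" and ne: "\<rho> y \<noteq> 1\<^sub>m (rdim \<rho>)"
    using unitary_rep_separates[OF assms] .
  obtain N s T where dec: "decomposes Ghat \<rho> N s T"
    using complete_reducibility[OF transversal \<rho>] by blast
  have "\<exists>k<N. s k y \<noteq> 1\<^sub>m (rdim (s k))"
  proof (rule ccontr)
    assume "\<not> ?thesis"
    then have triv: "s k y = 1\<^sub>m (rdim (s k))" if "k < N" for k using that by blast
    have "dim_col (T k) = rdim (s k)" if "k < N" for k
      using dec that unfolding decomposes_def by auto
    then have "\<rho> y = msum (rdim \<rho>) (rdim \<rho>) (\<lambda>k. T k * mat_adjoint (T k)) N"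
      unfolding decomposes_values(1)[OF transversal \<rho> dec, of y]
      by (intro msum_cong) (simp add: triv mat_mult_one_right)
    then show False using dec ne unfolding decomposes_def by simp
  qed
  then obtain k where k: "k < N" "s k y \<noteq> 1\<^sub>m (rdim (s k))" by blast
  then have "s k \<in> Ghat" using dec unfolding decomposes_def by blast
  then show thesis using that Re_characteracter_less[OF Ghat_rep k(2)] by blast
qed

text \<open>Fix the row indices i, k and let the column indices vary: right invariance makes the
  resulting matrix Y of integrals an intertwiner. Schur's lemma leaves only a scalar in the case
  \<pi> = \<sigma>, and its trace determines the scalar.\<close>

lemma Schur_orthogonality:
  assumes \<pi>: "\<pi> \<in> Ghat" and \<sigma>: "\<sigma> \<in> Ghat"
    and ij: "i < rdim \<pi>" "j < rdim \<pi>" and kl: "k < rdim \<sigma>" "l < rdim \<sigma>"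
  shows "(LINT g|\<mu>. cnj (\<pi> g $$ (i, j)) * \<sigma> g $$ (k, l)) =
    (if \<pi> = \<sigma> \<and> i = k \<and> j = l then 1 / of_nat (rdim \<pi>) else 0)"
proof -
  let ?m = "rdim \<pi>" and ?n = "rdim \<sigma>"
  note \<pi>r = Ghat_rep[OF \<pi>] and \<sigma>r = Ghat_rep[OF \<sigma>]
  note \<pi>c = Ghat_continuous[OF \<pi>] and \<sigma>c = Ghat_continuous[OF \<sigma>]
  define I where "I = (\<lambda>b d. LINT g|\<mu>. cnj (\<pi> g $$ (i, b)) * \<sigma> g $$ (k, d))"
  define Y where "Y = mat ?m ?n (\<lambda>(b, d). I b d)"
  have Y: "Y \<in> carrier_mat ?m ?n" by (simp add: Y_def)
  have "\<pi> h * Y = Y * \<sigma> h" for h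
  proof (rule eq_matI)
    fix b d assume "b < dim_row (Y * \<sigma> h)" "d < dim_col (Y * \<sigma> h)"
    then have bd: "b < ?m" "d < ?n" by (auto simp: Y_def unitary_rep_dims[OF \<sigma>r])
    have "(Y * \<sigma> h) $$ (b, d) = (\<Sum>r<?n. I b r * \<sigma> h $$ (r, d))"
      unfolding mat_mult_index[OF Y unitary_rep_carrier[OF \<sigma>r] bd] using bd by (simp add: Y_def)
    also have "\<dots> = (\<Sum>r<?n. LINT g|\<mu>. cnj (\<pi> g $$ (i, b)) * (\<sigma> g $$ (k, r) * \<sigma> h $$ (r, d)))"
      unfolding I_def by (simp flip: mult.assoc)
    also have "\<dots> = (LINT g|\<mu>. (\<Sum>r<?n. cnj (\<pi> g $$ (i, b)) * (\<sigma> g $$ (k, r) * \<sigma> h $$ (r, d))))"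
      by (rule Bochner_Integration.integral_sum[symmetric])
        (auto intro!: integrable_continuous continuous_intros \<pi>c \<sigma>c ij kl bd)
    also have "\<dots> = (LINT g|\<mu>. cnj (\<pi> g $$ (i, b)) * \<sigma> (g + h) $$ (k, d))"
      by (simp add: unitary_rep_add_index[OF \<sigma>r kl(1) bd(2)] sum_distrib_left)
    \<comment> \<open>Inserting h - h prepares the right translation by h, which moves h from
      \<sigma> to \<pi>.\<close>
    also have "\<dots> = (LINT g|\<mu>. cnj (\<pi> (g + h - h) $$ (i, b)) * \<sigma> (g + h) $$ (k, d))"
      by simp
    also have "\<dots> = (LINT g|\<mu>. cnj (\<pi> (g - h) $$ (i, b)) * \<sigma> g $$ (k, d))"
      by (rule integral_right_translate[of "\<lambda>g. cnj (\<pi> (g - h) $$ (i, b)) * \<sigma> g $$ (k, d)"])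
        (intro continuous_intros \<sigma>c kl bd continuous_on_compose_UNIV[OF \<pi>c[OF ij(1) bd(1)]])
    also have "\<dots> = (LINT g|\<mu>. (\<Sum>r<?m. \<pi> h $$ (b, r) * (cnj (\<pi> g $$ (i, r)) * \<sigma> g $$ (k, d))))"
    proof (rule Bochner_Integration.integral_cong[OF refl])
      fix g
      have "\<pi> (g + - h) $$ (i, b) = (\<Sum>r<?m. \<pi> g $$ (i, r) * cnj (\<pi> h $$ (b, r)))"
        unfolding unitary_rep_add_index[OF \<pi>r ij(1) bd(1)]
        using bd by (intro sum.cong) (auto simp: unitary_rep_minus(1)[OF \<pi>r] unitary_rep_dims[OF \<pi>r])
      then show "cnj (\<pi> (g - h) $$ (i, b)) * \<sigma> g $$ (k, d) =
          (\<Sum>r<?m. \<pi> h $$ (b, r) * (cnj (\<pi> g $$ (i, r)) * \<sigma> g $$ (k, d)))"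
        by (simp add: sum_distrib_left sum_distrib_right mult_ac)
    qed
    also have "\<dots> = (\<Sum>r<?m. LINT g|\<mu>. \<pi> h $$ (b, r) * (cnj (\<pi> g $$ (i, r)) * \<sigma> g $$ (k, d)))"
      by (rule Bochner_Integration.integral_sum)
        (auto intro!: integrable_continuous continuous_intros \<pi>c \<sigma>c ij kl bd)
    also have "\<dots> = (\<Sum>r<?m. \<pi> h $$ (b, r) * I r d)"
      unfolding I_def by simp
    also have "\<dots> = (\<pi> h * Y) $$ (b, d)"
      unfolding mat_mult_index[OF unitary_rep_carrier[OF \<pi>r] Y bd] using bd by (simp add: Y_def)
    finally show "(\<pi> h * Y) $$ (b, d) = (Y * \<sigma> h) $$ (b, d)" by simp
  qed (auto simp: Y_def unitary_rep_dims[OF \<sigma>r] unitary_rep_dims[OF \<pi>r])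
  note Schur = Schur_transversal[OF transversal \<pi> \<sigma> Y this]
  have Yjl: "Y $$ (j, l) = (LINT g|\<mu>. cnj (\<pi> g $$ (i, j)) * \<sigma> g $$ (k, l))"
    using ij kl by (simp add: Y_def I_def)
  show ?thesis
  proof (cases "\<pi> = \<sigma>")
    case False
    then have "Y $$ (j, l) = 0" using Schur(1) ij kl by simp
    then show ?thesis using False Yjl by simp
  next
    case True
    then obtain c where c: "Y = c \<cdot>\<^sub>m 1\<^sub>m ?m" using Schur(2) by blast
    have k: "k < ?m" using kl True by simp
    \<comment> \<open>The trace of Y is the integral of the inner product of rows i and k of a
      unitary matrix, which is constant.\<close>
    have "of_nat ?m * c = (\<Sum>b<?m. I b b)"
    proof -
      have "I b b = c" if "b < ?m" for b
        using arg_cong[OF c, of "\<lambda>X. X $$ (b, b)"] that True by (simp add: Y_def)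
      then show ?thesis by simp
    qed
    also have "\<dots> = (LINT g|\<mu>. (\<Sum>b<?m. cnj (\<pi> g $$ (i, b)) * \<pi> g $$ (k, b)))"
      unfolding I_def True[symmetric]
      by (rule Bochner_Integration.integral_sum[symmetric])
        (intro integrable_continuous continuous_intros \<pi>c ij k; simp)
    also have "\<dots> = (LINT g|\<mu>. (if i = k then 1 else 0))"
    proof (rule Bochner_Integration.integral_cong[OF refl])
      fix g
      have "(\<Sum>b<?m. cnj (\<pi> g $$ (i, b)) * \<pi> g $$ (k, b)) = (\<Sum>b<?m. \<pi> g $$ (k, b) * \<pi> (- g) $$ (b, i))"
        using ij by (intro sum.cong) (auto simp: unitary_rep_minus(1)[OF \<pi>r] unitary_rep_dims[OF \<pi>r])
      also have "\<dots> = \<pi> (g + - g) $$ (k, i)"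
        by (rule unitary_rep_add_index[OF \<pi>r k ij(1), symmetric])
      also have "\<dots> = (if i = k then 1 else 0)"
        using ij k by (simp add: unitary_rep_minus(2)[OF \<pi>r])
      finally show "(\<Sum>b<?m. cnj (\<pi> g $$ (i, b)) * \<pi> g $$ (k, b)) = (if i = k then 1 else 0)" .
    qed
    finally have "of_nat ?m * c = (if i = k then 1 else 0)" by simp
    then have "c = (if i = k then 1 / of_nat ?m else 0)"
      using Ghat_dim_pos[OF \<pi>] by (auto simp: field_simps)
    moreover have "Y $$ (j, l) = (if j = l then c else 0)"
      using ij kl True by (simp add: c)
    ultimately show ?thesis using Yjl True by auto
  qed
qed

lemma character_orthonormal:
  assumes \<pi>: "\<pi> \<in> Ghat" and \<sigma>: "\<sigma> \<in> Ghat"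
  shows "(LINT g|\<mu>. cnj (character \<pi> g) * character \<sigma> g) = (if \<pi> = \<sigma> then 1 else 0)"
proof -
  note \<pi>c = Ghat_continuous[OF \<pi>] and \<sigma>c = Ghat_continuous[OF \<sigma>]
  have "(LINT g|\<mu>. cnj (character \<pi> g) * character \<sigma> g) =
      (LINT g|\<mu>. (\<Sum>i<rdim \<pi>. \<Sum>k<rdim \<sigma>. cnj (\<pi> g $$ (i, i)) * \<sigma> g $$ (k, k)))"
    by (simp add: character_eq_sum[OF Ghat_rep[OF \<pi>]] character_eq_sum[OF Ghat_rep[OF \<sigma>]] sum_product)
  also have "\<dots> = (\<Sum>i<rdim \<pi>. LINT g|\<mu>. (\<Sum>k<rdim \<sigma>. cnj (\<pi> g $$ (i, i)) * \<sigma> g $$ (k, k)))"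
    by (rule Bochner_Integration.integral_sum)
      (auto intro!: integrable_continuous continuous_intros \<pi>c \<sigma>c)
  also have "\<dots> = (\<Sum>i<rdim \<pi>. \<Sum>k<rdim \<sigma>. LINT g|\<mu>. cnj (\<pi> g $$ (i, i)) * \<sigma> g $$ (k, k))"
    by (intro sum.cong refl Bochner_Integration.integral_sum)
      (auto intro!: integrable_continuous continuous_intros \<pi>c \<sigma>c)
  also have "\<dots> = (\<Sum>i<rdim \<pi>. \<Sum>k<rdim \<sigma>. if \<pi> = \<sigma> \<and> i = k then 1 / of_nat (rdim \<pi>) else 0)"
    by (intro sum.cong refl) (simp add: Schur_orthogonality[OF \<pi> \<sigma>])
  also have "\<dots> = (if \<pi> = \<sigma> then 1 else 0)"
    using Ghat_dim_pos[OF \<pi>] by (cases "\<pi> = \<sigma>") auto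
  finally show ?thesis .
qed

text \<open>Everything is read off from one decomposition of the tensor product of \<pi> and \<nu>;
  S is the set of its irreducible summands. Finiteness of S is what later reduces the infinite
  Folner sum to a finite one.\<close>

lemma fusion_facts:
  assumes \<pi>: "\<pi> \<in> Ghat" and \<nu>: "\<nu> \<in> Ghat"
  obtains S where "finite S" "S \<subseteq> Ghat"
    "rdim \<pi> * rdim \<nu> = (\<Sum>\<sigma>\<in>S. rdim \<sigma> * fusion \<pi> \<nu> \<sigma>)"
    "\<And>\<sigma>. \<sigma> \<in> Ghat - S \<Longrightarrow> fusion \<pi> \<nu> \<sigma> = 0"
    "\<And>\<sigma>. \<sigma> \<in> Ghat \<Longrightarrow>
      (LINT g|\<mu>. cnj (character \<sigma> g) * (character \<pi> g * character \<nu> g)) = of_nat (fusion \<pi> \<nu> \<sigma>)"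
proof -
  let ?\<rho> = "tensor_rep \<pi> \<nu>"
  note \<pi>r = Ghat_rep[OF \<pi>] and \<nu>r = Ghat_rep[OF \<nu>]
  note \<rho> = unitary_rep_tensor[OF \<pi>r \<nu>r]
  obtain N s T where dec: "decomposes Ghat ?\<rho> N s T"
    using complete_reducibility[OF transversal \<rho>(1)] by blast
  have sG: "s k \<in> Ghat" if "k < N" for k using dec that unfolding decomposes_def by blast
  have fus: "fusion \<pi> \<nu> \<sigma> = card {k. k < N \<and> s k = \<sigma>}" if "\<sigma> \<in> Ghat" for \<sigma>
    unfolding fusion_def by (rule dim_Hom_eq_multiplicity[OF transversal \<rho>(1) dec that])
  have tr: "(\<Sum>k<N. character (s k) g) = character \<pi> g * character \<nu> g" for g
    using decomposes_values(2)[OF transversal \<rho>(1) dec, of g]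
      mtrace_kronecker[OF unitary_rep_carrier[OF \<pi>r] unitary_rep_carrier[OF \<nu>r], of g g]
    by (simp add: tensor_rep_def)
  show thesis
  proof
    show "finite (s ` {..<N})" "s ` {..<N} \<subseteq> Ghat" using sG by auto
    have one: "character \<sigma> 0 = of_nat (rdim \<sigma>)" if "\<sigma> \<in> Ghat" for \<sigma>
      by (simp add: unitary_rep_minus(2)[OF Ghat_rep[OF that]] mtrace_one)
    \<comment> \<open>At the neutral element the character identity becomes an identity between
      dimensions.\<close>
    have "complex_of_nat (\<Sum>k<N. rdim (s k)) = of_nat (rdim \<pi> * rdim \<nu>)"
      using tr[of 0] by (simp add: one \<pi> \<nu> sG)
    then have "rdim \<pi> * rdim \<nu> = (\<Sum>k<N. rdim (s k))" by (metis of_nat_eq_iff)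
    also have "\<dots> = (\<Sum>\<sigma>\<in>s ` {..<N}. \<Sum>k\<in>{k \<in> {..<N}. s k = \<sigma>}. rdim (s k))"
      by (rule sum.image_gen) simp
    also have "\<dots> = (\<Sum>\<sigma>\<in>s ` {..<N}. rdim \<sigma> * fusion \<pi> \<nu> \<sigma>)"
      using sG by (intro sum.cong refl) (auto simp: fus mult.commute)
    finally show "rdim \<pi> * rdim \<nu> = (\<Sum>\<sigma>\<in>s ` {..<N}. rdim \<sigma> * fusion \<pi> \<nu> \<sigma>)" .
    show "fusion \<pi> \<nu> \<sigma> = 0" if "\<sigma> \<in> Ghat - s ` {..<N}" for \<sigma>
    proof -
      have "{k. k < N \<and> s k = \<sigma>} = {}" using that by auto
      then show ?thesis using fus[of \<sigma>] that by (simp only: card.empty Diff_iff)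
    qed
    show "(LINT g|\<mu>. cnj (character \<sigma> g) * (character \<pi> g * character \<nu> g)) = of_nat (fusion \<pi> \<nu> \<sigma>)"
      if \<sigma>: "\<sigma> \<in> Ghat" for \<sigma>
    proof -
      have "(LINT g|\<mu>. cnj (character \<sigma> g) * (character \<pi> g * character \<nu> g)) =
          (LINT g|\<mu>. (\<Sum>k<N. cnj (character \<sigma> g) * character (s k) g))"
        by (simp add: sum_distrib_left flip: tr)
      also have "\<dots> = (\<Sum>k<N. LINT g|\<mu>. cnj (character \<sigma> g) * character (s k) g)"
        by (rule Bochner_Integration.integral_sum)
          (auto intro!: integrable_continuous continuous_intros continuous_character Ghat_rep \<sigma> sG)
      also have "\<dots> = (\<Sum>k<N. if s k = \<sigma> then 1 else 0)"
        by (intro sum.cong) (auto simp: character_orthonormal[OF \<sigma> sG])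
      also have "\<dots> = of_nat (card {k. k < N \<and> s k = \<sigma>})"
        by (subst sum.inter_filter[symmetric]) (auto simp: lessThan_def)
      finally show ?thesis by (simp add: fus[OF \<sigma>])
    qed
  qed
qed

end

section \<open>The kernel of the composed maps\<close>

lemma Re_characteracter_le:
  assumes "unitary_rep \<pi>"
  shows "Re (character \<pi> g) \<le> rdim \<pi>"
  using Re_characteracter_less[OF assms, of g] by (cases "\<pi> g = 1\<^sub>m (rdim \<pi>)") (auto simp: mtrace_one)

section \<open>The orthonormal system and the Dirichlet kernel\<close>

lemma finite_basis_index: "finite F \<Longrightarrow> finite (basis_index F)"
  by (auto simp: basis_index_def)

lemma sum_basis_index:
  assumes "finite F"
  shows "(\<Sum>p\<in>basis_index F. f p) = (\<Sum>\<pi>\<in>F. \<Sum>i<rdim \<pi>. \<Sum>j<rdim \<pi>. f (\<pi>, i, j))"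
proof -
  have "(\<Sum>p\<in>basis_index F. f p) = (\<Sum>(\<pi>, q)\<in>(SIGMA \<pi>:F. {..<rdim \<pi>} \<times> {..<rdim \<pi>}). f (\<pi>, q))"
    by (simp add: basis_index_def split_def)
  also have "\<dots> = (\<Sum>\<pi>\<in>F. \<Sum>q\<in>{..<rdim \<pi>} \<times> {..<rdim \<pi>}. f (\<pi>, q))"
    using assms by (intro sum.Sigma[symmetric]) auto
  finally show ?thesis by (simp add: sum.cartesian_product split_def)
qed

context compact_haar_dual
begin

lemma weight_pos:
  assumes "finite F" "F \<subseteq> Ghat" "F \<noteq> {}"
  shows "weight F > 0"
  unfolding weight_def
proof (rule sum_pos)
  fix \<pi> assume "\<pi> \<in> F"
  then have "rdim \<pi> > 0" using assms Ghat_dim_pos by blast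
  then show "0 < (real (rdim \<pi>))\<^sup>2" by simp
qed (use assms in auto)

lemma continuous_basis_fun:
  assumes "p \<in> basis_index Ghat"
  shows "continuous_on UNIV (basis_fun p)"
  using assms unfolding basis_index_def basis_fun_def
  by (auto intro!: continuous_intros Ghat_continuous)

lemma basis_fun_orthonormal:
  assumes "p \<in> basis_index Ghat" "q \<in> basis_index Ghat"
  shows "L2_inner \<mu> (basis_fun p) (basis_fun q) = (if p = q then 1 else 0)"
proof -
  obtain \<pi> i j where p: "p = (\<pi>, i, j)" "\<pi> \<in> Ghat" "i < rdim \<pi>" "j < rdim \<pi>"
    using assms by (auto simp: basis_index_def)
  obtain \<sigma> k l where q: "q = (\<sigma>, k, l)" "\<sigma> \<in> Ghat" "k < rdim \<sigma>" "l < rdim \<sigma>"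
    using assms by (auto simp: basis_index_def)
  have "L2_inner \<mu> (basis_fun p) (basis_fun q) =
      (LINT g|\<mu>. of_real (sqrt (rdim \<pi>) * sqrt (rdim \<sigma>)) * (cnj (\<pi> g $$ (i, j)) * \<sigma> g $$ (k, l)))"
    unfolding L2_inner_def by (simp add: p q basis_fun_def mult_ac)
  also have "\<dots> = of_real (sqrt (rdim \<pi>) * sqrt (rdim \<sigma>)) *
      (if \<pi> = \<sigma> \<and> i = k \<and> j = l then 1 / of_nat (rdim \<pi>) else 0)"
    using Schur_orthogonality[of \<pi> \<sigma> i j k l] p q by simp
  also have "\<dots> = (if p = q then 1 else 0)"
    using Ghat_dim_pos[OF p(2)] by (auto simp: p q simp flip: of_real_mult)
  finally show ?thesis .
qed

text \<open>The analogue of the classical Dirichlet kernel: \<open>dirichlet F (x - y)\<close> is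
  the integral kernel of the projection onto the span of the coefficients of F. The weight d(\<pi>)
  comes from the two square roots in the orthonormal basis.\<close>

definition dirichlet :: "('g \<Rightarrow> complex mat) set \<Rightarrow> 'g \<Rightarrow> complex" where
  "dirichlet F z = (\<Sum>\<pi>\<in>F. of_nat (rdim \<pi>) * character \<pi> z)"

lemma continuous_dirichlet: "F \<subseteq> Ghat \<Longrightarrow> continuous_on UNIV (dirichlet F)"
  unfolding dirichlet_def by (intro continuous_intros continuous_character Ghat_rep) auto

lemma reproducing_kernel:
  assumes F: "finite F" "F \<subseteq> Ghat"
  shows "(\<Sum>p\<in>basis_index F. basis_fun p x * cnj (basis_fun p y)) = dirichlet F (x - y)"
proof -
  have sq: "complex_of_real (sqrt (real d)) * (u * (complex_of_real (sqrt (real d)) * v)) = of_nat d * (u * v)" for d u v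
  proof -
    have "complex_of_real (sqrt (real d)) * complex_of_real (sqrt (real d)) = of_nat d"
      by (simp flip: of_real_mult)
    then show ?thesis by (metis mult.assoc mult.left_commute)
  qed
  have "character \<pi> (x - y) = (\<Sum>i<rdim \<pi>. \<Sum>j<rdim \<pi>. \<pi> x $$ (i, j) * cnj (\<pi> y $$ (i, j)))" if "\<pi> \<in> F" for \<pi>
    using character_diff[OF Ghat_rep] F that by blast
  then show ?thesis
    unfolding sum_basis_index[OF F(1)] dirichlet_def
    by (intro sum.cong refl) (simp add: basis_fun_def sum_distrib_left mult.assoc sq)
qed

lemma proj_op_basis_fun:
  assumes F: "finite F" "F \<subseteq> Ghat" and q: "q \<in> basis_index F"
  shows "proj_op \<mu> F (basis_fun q) = basis_fun q"
proof
  fix x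
  have sub: "p \<in> basis_index Ghat" if "p \<in> basis_index F" for p
    using F that by (auto simp: basis_index_def)
  have "proj_op \<mu> F (basis_fun q) x = (\<Sum>p\<in>basis_index F. if p = q then basis_fun q x else 0)"
    unfolding proj_op_def matrix_unit_def
    by (intro sum.cong refl) (simp add: basis_fun_orthonormal sub q)
  then show "proj_op \<mu> F (basis_fun q) x = basis_fun q x"
    using finite_basis_index[OF F(1)] q by simp
qed

lemma L2_inner_proj_op:
  assumes F: "finite F" "F \<subseteq> Ghat" and p: "p \<in> basis_index F"
  shows "L2_inner \<mu> (basis_fun p) (proj_op \<mu> F \<xi>) = L2_inner \<mu> (basis_fun p) \<xi>"
proof -
  have sub: "r \<in> basis_index Ghat" if "r \<in> basis_index F" for r
    using F that by (auto simp: basis_index_def)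
  have "L2_inner \<mu> (basis_fun p) (proj_op \<mu> F \<xi>) =
      (LINT x|\<mu>. (\<Sum>r\<in>basis_index F. L2_inner \<mu> (basis_fun r) \<xi> * (cnj (basis_fun p x) * basis_fun r x)))"
    by (subst L2_inner_def) (simp add: proj_op_def matrix_unit_def sum_distrib_left mult_ac)
  also have "\<dots> = (\<Sum>r\<in>basis_index F. LINT x|\<mu>. L2_inner \<mu> (basis_fun r) \<xi> * (cnj (basis_fun p x) * basis_fun r x))"
    by (rule Bochner_Integration.integral_sum)
      (auto intro!: integrable_continuous continuous_intros continuous_basis_fun sub p)
  also have "\<dots> = (\<Sum>r\<in>basis_index F. L2_inner \<mu> (basis_fun r) \<xi> * L2_inner \<mu> (basis_fun p) (basis_fun r))"
    by (simp add: L2_inner_def[of \<mu> "basis_fun p"])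
  also have "\<dots> = (\<Sum>r\<in>basis_index F. if r = p then L2_inner \<mu> (basis_fun p) \<xi> else 0)"
    by (intro sum.cong refl) (simp add: basis_fun_orthonormal sub p)
  finally show ?thesis using finite_basis_index[OF F(1)] p by simp
qed

text \<open>Once the matrix coefficients of the compressed operator are written as integrals over y,
  the double sum over basis vectors factors under the integral: one sum is the reproducing kernel at
  (x, y), the other its conjugate.\<close>

lemma decompress_compress:
  assumes F: "finite F" "F \<subseteq> Ghat" and f: "continuous_on UNIV f"
  shows "decompress \<mu> F (compress \<mu> F f) x =
    (LINT y|\<mu>. f y * of_real ((cmod (dirichlet F (x - y)))\<^sup>2 / weight F))"
proof -
  let ?I = "basis_index F"
  let ?w = "complex_of_real (1 / weight F)"
  have sub: "r \<in> basis_index Ghat" if "r \<in> ?I" for r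
    using F that by (auto simp: basis_index_def)
  have coef: "L2_inner \<mu> (basis_fun p) (compress \<mu> F f (basis_fun q)) =
      (LINT y|\<mu>. cnj (basis_fun p y) * (f y * basis_fun q y))" if "p \<in> ?I" "q \<in> ?I" for p q
    using that by (simp add: compress_def proj_op_basis_fun[OF F] L2_inner_proj_op[OF F])
      (simp add: L2_inner_def mult_op_def)
  have "decompress \<mu> F (compress \<mu> F f) x =
      (\<Sum>p\<in>?I. \<Sum>q\<in>?I. L2_inner \<mu> (basis_fun p) (compress \<mu> F f (basis_fun q)) *
        (?w * (basis_fun p x * cnj (basis_fun q x))))"
    unfolding decompress_def
    by (intro sum.cong refl) (auto simp: basis_fun_def real_sqrt_mult mult_ac intro!: sum.cong)
  also have "\<dots> = (\<Sum>p\<in>?I. \<Sum>q\<in>?I. LINT y|\<mu>.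
      ?w * (f y * ((basis_fun p x * cnj (basis_fun p y)) * cnj (basis_fun q x * cnj (basis_fun q y)))))"
  proof (intro sum.cong refl)
    fix p q assume pq: "p \<in> ?I" "q \<in> ?I"
    show "L2_inner \<mu> (basis_fun p) (compress \<mu> F f (basis_fun q)) *
        (?w * (basis_fun p x * cnj (basis_fun q x))) =
      (LINT y|\<mu>. ?w * (f y * ((basis_fun p x * cnj (basis_fun p y)) * cnj (basis_fun q x * cnj (basis_fun q y)))))"
      unfolding coef[OF pq] by (subst integral_mult_left_zero[symmetric]) (simp add: mult_ac)
  qed
  also have "\<dots> = (\<Sum>p\<in>?I. LINT y|\<mu>. (\<Sum>q\<in>?I.
      ?w * (f y * ((basis_fun p x * cnj (basis_fun p y)) * cnj (basis_fun q x * cnj (basis_fun q y))))))"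
    by (intro sum.cong refl Bochner_Integration.integral_sum[symmetric] integrable_continuous
        continuous_intros f continuous_basis_fun sub)
  also have "\<dots> = (LINT y|\<mu>. (\<Sum>p\<in>?I. \<Sum>q\<in>?I.
      ?w * (f y * ((basis_fun p x * cnj (basis_fun p y)) * cnj (basis_fun q x * cnj (basis_fun q y))))))"
    by (intro Bochner_Integration.integral_sum[symmetric] integrable_continuous
        continuous_intros f continuous_basis_fun sub)
  also have "\<dots> = (LINT y|\<mu>. ?w * (f y * (dirichlet F (x - y) * cnj (dirichlet F (x - y)))))"
    unfolding reproducing_kernel[OF F, symmetric] cnj_sum sum_product
    by (simp only: sum_distrib_left)
  also have "\<dots> = (LINT y|\<mu>. f y * of_real ((cmod (dirichlet F (x - y)))\<^sup>2 / weight F))"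
    by (simp add: complex_norm_square[symmetric] field_simps)
  finally show ?thesis .
qed

text \<open>Parseval for the orthonormal characters. It shows that division by the weight yields a
  probability density.\<close>

lemma integral_dirichlet_square:
  assumes F: "finite F" "F \<subseteq> Ghat"
  shows "(LINT z|\<mu>. (cmod (dirichlet F z))\<^sup>2) = weight F"
proof -
  have c: "continuous_on UNIV (character \<sigma>)" if "\<sigma> \<in> F" for \<sigma>
    using continuous_character[OF Ghat_rep] F that by blast
  have "complex_of_real (LINT z|\<mu>. (cmod (dirichlet F z))\<^sup>2) =
      (LINT z|\<mu>. cnj (dirichlet F z) * dirichlet F z)"
    by (simp add: integral_complex_of_real[symmetric] complex_norm_square mult.commute del: of_real_power integral_complex_of_real)
  also have "\<dots> = (LINT z|\<mu>. (\<Sum>\<sigma>\<in>F. \<Sum>\<nu>\<in>F. of_nat (rdim \<sigma>) * of_nat (rdim \<nu>) * (cnj (character \<sigma> z) * character \<nu> z)))"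
    by (simp only: dirichlet_def cnj_sum sum_product) (simp add: mult_ac)
  also have "\<dots> = (\<Sum>\<sigma>\<in>F. LINT z|\<mu>. (\<Sum>\<nu>\<in>F. of_nat (rdim \<sigma>) * of_nat (rdim \<nu>) * (cnj (character \<sigma> z) * character \<nu> z)))"
    by (rule Bochner_Integration.integral_sum) (intro integrable_continuous continuous_intros c)
  also have "\<dots> = (\<Sum>\<sigma>\<in>F. \<Sum>\<nu>\<in>F. of_nat (rdim \<sigma>) * of_nat (rdim \<nu>) * (LINT z|\<mu>. cnj (character \<sigma> z) * character \<nu> z))"
    by (intro sum.cong refl, subst Bochner_Integration.integral_sum)
      (auto intro!: integrable_continuous continuous_intros c)
  also have "\<dots> = (\<Sum>\<sigma>\<in>F. \<Sum>\<nu>\<in>F. if \<sigma> = \<nu> then of_nat (rdim \<sigma>) * of_nat (rdim \<sigma>) else 0)"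
    using F by (intro sum.cong refl) (auto simp: character_orthonormal subset_iff)
  also have "\<dots> = complex_of_real (weight F)"
    using F(1) by (simp add: weight_def power2_eq_square)
  finally show ?thesis using of_real_eq_iff by blast
qed

text \<open>Expanding the square leaves integrals of three characters, which are fusion
  multiplicities. They are real, so the real part may be taken after the complex
  computation.\<close>

lemma integral_characteracter_dirichlet_square:
  assumes F: "finite F" "F \<subseteq> Ghat" and \<pi>: "\<pi> \<in> Ghat"
  shows "(LINT z|\<mu>. Re (character \<pi> z) * (cmod (dirichlet F z))\<^sup>2) =
    (\<Sum>\<nu>\<in>F. \<Sum>\<sigma>\<in>F. real (rdim \<nu> * rdim \<sigma> * fusion \<pi> \<nu> \<sigma>))"
proof -
  have c: "continuous_on UNIV (character \<sigma>)" if "\<sigma> \<in> F" for \<sigma>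
    using continuous_character[OF Ghat_rep] F that by blast
  note c\<pi> = continuous_character[OF Ghat_rep[OF \<pi>]]
  note cD = continuous_dirichlet[OF F(2)]
  have fus: "(LINT z|\<mu>. cnj (character \<sigma> z) * (character \<pi> z * character \<nu> z)) = of_nat (fusion \<pi> \<nu> \<sigma>)"
    if "\<nu> \<in> F" "\<sigma> \<in> F" for \<nu> \<sigma>
    using fusion_facts[OF \<pi>, of \<nu>] F that by (metis subset_iff)
  have "(LINT z|\<mu>. character \<pi> z * of_real ((cmod (dirichlet F z))\<^sup>2)) =
      (LINT z|\<mu>. (\<Sum>\<nu>\<in>F. \<Sum>\<sigma>\<in>F. of_nat (rdim \<nu>) * of_nat (rdim \<sigma>) * (cnj (character \<sigma> z) * (character \<pi> z * character \<nu> z))))"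
  proof (rule Bochner_Integration.integral_cong[OF refl])
    fix z
    have "complex_of_real ((cmod (dirichlet F z))\<^sup>2) =
        (\<Sum>\<nu>\<in>F. \<Sum>\<sigma>\<in>F. (of_nat (rdim \<nu>) * character \<nu> z) * cnj (of_nat (rdim \<sigma>) * character \<sigma> z))"
      by (simp only: complex_norm_square dirichlet_def cnj_sum sum_product)
    then show "character \<pi> z * of_real ((cmod (dirichlet F z))\<^sup>2) = (\<Sum>\<nu>\<in>F. \<Sum>\<sigma>\<in>F.
        of_nat (rdim \<nu>) * of_nat (rdim \<sigma>) * (cnj (character \<sigma> z) * (character \<pi> z * character \<nu> z)))"
      by (simp add: sum_distrib_left mult_ac del: of_real_power)
  qed
  also have "\<dots> = (\<Sum>\<nu>\<in>F. LINT z|\<mu>. (\<Sum>\<sigma>\<in>F. of_nat (rdim \<nu>) * of_nat (rdim \<sigma>) * (cnj (character \<sigma> z) * (character \<pi> z * character \<nu> z))))"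
    by (rule Bochner_Integration.integral_sum) (intro integrable_continuous continuous_intros c c\<pi>)
  also have "\<dots> = (\<Sum>\<nu>\<in>F. \<Sum>\<sigma>\<in>F. of_nat (rdim \<nu>) * of_nat (rdim \<sigma>) * (LINT z|\<mu>. cnj (character \<sigma> z) * (character \<pi> z * character \<nu> z)))"
    by (intro sum.cong refl, subst Bochner_Integration.integral_sum)
      (auto intro!: integrable_continuous continuous_intros c c\<pi>)
  also have "\<dots> = of_real (\<Sum>\<nu>\<in>F. \<Sum>\<sigma>\<in>F. real (rdim \<nu> * rdim \<sigma> * fusion \<pi> \<nu> \<sigma>))"
    by (simp add: fus)
  finally have "Re (LINT z|\<mu>. character \<pi> z * of_real ((cmod (dirichlet F z))\<^sup>2)) =
      (\<Sum>\<nu>\<in>F. \<Sum>\<sigma>\<in>F. real (rdim \<nu> * rdim \<sigma> * fusion \<pi> \<nu> \<sigma>))" by simp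
  moreover have "integrable \<mu> (\<lambda>z. character \<pi> z * of_real ((cmod (dirichlet F z))\<^sup>2))"
    by (intro integrable_continuous continuous_intros c\<pi> cD)
  ultimately show ?thesis by (simp add: integral_Re[symmetric] del: of_real_power)
qed

text \<open>
  Since \<open>\<Sum>\<^sub>\<sigma> d(\<sigma>) N\<^sub>\<pi>\<^sub>\<nu>\<^sup>\<sigma> = d(\<pi>) d(\<nu>)\<close>, the defect is exactly the part of the double sum with
  \<open>\<nu> \<in> F\<close> and \<open>\<sigma> \<notin> F\<close>, which is one of the two sums in the Folner condition.
\<close>

lemma dirichlet_defect:
  assumes F: "finite F" "F \<subseteq> Ghat" and \<pi>: "\<pi> \<in> Ghat"
  obtains t :: real where "t \<ge> 0"
    "ennreal t \<le> (\<Sum>\<^sub>\<infinity>\<sigma>\<in>Ghat - F. \<Sum>\<nu>\<in>F. folner_term \<pi> \<sigma> \<nu>)"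
    "(LINT z|\<mu>. (rdim \<pi> - Re (character \<pi> z)) * (cmod (dirichlet F z))\<^sup>2) = rdim \<pi> * t"
proof -
  have "\<forall>\<nu>\<in>F. \<exists>S. finite S \<and> S \<subseteq> Ghat \<and> rdim \<pi> * rdim \<nu> = (\<Sum>\<sigma>\<in>S. rdim \<sigma> * fusion \<pi> \<nu> \<sigma>) \<and>
      (\<forall>\<sigma>\<in>Ghat - S. fusion \<pi> \<nu> \<sigma> = 0)"
  proof
    fix \<nu> assume "\<nu> \<in> F"
    then have \<nu>: "\<nu> \<in> Ghat" using F by blast
    show "\<exists>S. finite S \<and> S \<subseteq> Ghat \<and> rdim \<pi> * rdim \<nu> = (\<Sum>\<sigma>\<in>S. rdim \<sigma> * fusion \<pi> \<nu> \<sigma>) \<and>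
      (\<forall>\<sigma>\<in>Ghat - S. fusion \<pi> \<nu> \<sigma> = 0)"
      by (rule fusion_facts[OF \<pi> \<nu>]) blast
  qed
  then obtain S where S: "\<And>\<nu>. \<nu> \<in> F \<Longrightarrow> finite (S \<nu>) \<and> S \<nu> \<subseteq> Ghat \<and>
      rdim \<pi> * rdim \<nu> = (\<Sum>\<sigma>\<in>S \<nu>. rdim \<sigma> * fusion \<pi> \<nu> \<sigma>) \<and>
      (\<forall>\<sigma>\<in>Ghat - S \<nu>. fusion \<pi> \<nu> \<sigma> = 0)"
    by metis
  \<comment> \<open>A finite set that contains F and every \<sigma> in Ghat with nonzero
    multiplicity for some \<nu> in F, so the dimension identity holds over U for all these \<nu> at
    once.\<close>
  define U where "U = F \<union> (\<Union>\<nu>\<in>F. S \<nu>)"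
  have U: "finite U" "U \<subseteq> Ghat" "F \<subseteq> U" using F S by (auto simp: U_def)
  have dim: "rdim \<pi> * rdim \<nu> = (\<Sum>\<sigma>\<in>U. rdim \<sigma> * fusion \<pi> \<nu> \<sigma>)" if \<nu>: "\<nu> \<in> F" for \<nu>
  proof -
    have "(\<Sum>\<sigma>\<in>S \<nu>. rdim \<sigma> * fusion \<pi> \<nu> \<sigma>) = (\<Sum>\<sigma>\<in>U. rdim \<sigma> * fusion \<pi> \<nu> \<sigma>)"
      using S[OF \<nu>] U \<nu> by (intro sum.mono_neutral_left) (auto simp: U_def)
    then show ?thesis using S[OF \<nu>] by simp
  qed
  \<comment> \<open>A finite partial sum of the Folner sum over the complement. As a real number it
    can be computed with, and nonnegativity of the terms gives the comparison in
    \<open>ennreal\<close>.\<close>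
  define t where "t = (\<Sum>\<sigma>\<in>U - F. \<Sum>\<nu>\<in>F. real (rdim \<sigma>) * real (rdim \<nu>) / real (rdim \<pi>) * real (fusion \<pi> \<nu> \<sigma>))"
  have "ennreal t = (\<Sum>\<sigma>\<in>U - F. \<Sum>\<nu>\<in>F. folner_term \<pi> \<sigma> \<nu>)"
    unfolding t_def folner_term_def by (simp add: sum_nonneg flip: sum_ennreal)
  also have "\<dots> \<le> (\<Sum>\<^sub>\<infinity>\<sigma>\<in>Ghat - F. \<Sum>\<nu>\<in>F. folner_term \<pi> \<sigma> \<nu>)"
    using U by (intro finite_sum_le_infsum_ennreal) auto
  finally have t_le: "ennreal t \<le> (\<Sum>\<^sub>\<infinity>\<sigma>\<in>Ghat - F. \<Sum>\<nu>\<in>F. folner_term \<pi> \<sigma> \<nu>)" .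
  have t_nonneg: "t \<ge> 0" unfolding t_def by (intro sum_nonneg) auto
  have "(LINT z|\<mu>. (rdim \<pi> - Re (character \<pi> z)) * (cmod (dirichlet F z))\<^sup>2) = rdim \<pi> * t"
  proof -
    note c\<pi> = continuous_character[OF Ghat_rep[OF \<pi>]] and cD = continuous_dirichlet[OF F(2)]
    have "(LINT z|\<mu>. (rdim \<pi> - Re (character \<pi> z)) * (cmod (dirichlet F z))\<^sup>2) =
        (LINT z|\<mu>. rdim \<pi> * (cmod (dirichlet F z))\<^sup>2 - Re (character \<pi> z) * (cmod (dirichlet F z))\<^sup>2)"
      by (simp add: algebra_simps)
    also have "\<dots> = (LINT z|\<mu>. rdim \<pi> * (cmod (dirichlet F z))\<^sup>2) - (LINT z|\<mu>. Re (character \<pi> z) * (cmod (dirichlet F z))\<^sup>2)"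
      by (intro Bochner_Integration.integral_diff integrable_continuous continuous_intros c\<pi> cD)
    also have "\<dots> = rdim \<pi> * weight F - (\<Sum>\<nu>\<in>F. \<Sum>\<sigma>\<in>F. real (rdim \<nu> * rdim \<sigma> * fusion \<pi> \<nu> \<sigma>))"
      by (simp add: integral_dirichlet_square[OF F] integral_characteracter_dirichlet_square[OF F \<pi>])
    also have "rdim \<pi> * weight F = (\<Sum>\<nu>\<in>F. \<Sum>\<sigma>\<in>U. real (rdim \<nu> * rdim \<sigma> * fusion \<pi> \<nu> \<sigma>))"
    proof -
      have "real (rdim \<pi>) * (real (rdim \<nu>))\<^sup>2 = (\<Sum>\<sigma>\<in>U. real (rdim \<nu> * rdim \<sigma> * fusion \<pi> \<nu> \<sigma>))"
        if "\<nu> \<in> F" for \<nu>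
      proof -
        have "real (rdim \<pi>) * (real (rdim \<nu>))\<^sup>2 = real (rdim \<nu>) * real (rdim \<pi> * rdim \<nu>)"
          by (simp add: power2_eq_square mult_ac)
        also have "\<dots> = (\<Sum>\<sigma>\<in>U. real (rdim \<nu> * rdim \<sigma> * fusion \<pi> \<nu> \<sigma>))"
          unfolding dim[OF that] by (simp add: sum_distrib_left mult_ac)
        finally show ?thesis .
      qed
      then show ?thesis by (simp add: weight_def sum_distrib_left)
    qed
    also have "\<dots> - (\<Sum>\<nu>\<in>F. \<Sum>\<sigma>\<in>F. real (rdim \<nu> * rdim \<sigma> * fusion \<pi> \<nu> \<sigma>)) =
        (\<Sum>\<nu>\<in>F. \<Sum>\<sigma>\<in>U - F. real (rdim \<nu> * rdim \<sigma> * fusion \<pi> \<nu> \<sigma>))"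
      by (simp only: sum_diff[OF U(1,3)] sum_subtractf)
    also have "\<dots> = rdim \<pi> * t"
      unfolding t_def using Ghat_dim_pos[OF \<pi>]
      by (subst sum.swap) (simp add: sum_distrib_left mult_ac)
    finally show ?thesis .
  qed
  with t_nonneg t_le show thesis by (rule that)
qed

text \<open>The pairs with oscillation at least \<epsilon> form a compact set K away from the
  diagonal. Every pair in K is detected by some \<pi>, and finitely many \<pi> suffice for all of K.
  Their sum has a positive minimum on K, so a large multiple of it dominates the bounded oscillation
  there; off K the term \<epsilon> does.\<close>

lemma oscillation_estimate:
  fixes f :: "'g \<Rightarrow> complex"
  assumes f: "continuous_on UNIV f" and \<epsilon>: "\<epsilon> > 0"
  obtains S C where "finite S" "S \<subseteq> Ghat" "C \<ge> 0"
    "\<And>x y. cmod (f y - f x) \<le> \<epsilon> + C * (\<Sum>\<pi>\<in>S. rdim \<pi> - Re (character \<pi> (x - y)))"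
proof -
  let ?o = "\<lambda>p :: 'g \<times> 'g. cmod (f (snd p) - f (fst p))"
  let ?r = "\<lambda>\<pi> (p :: 'g \<times> 'g). rdim \<pi> - Re (character \<pi> (fst p - snd p))"
  have o_cont: "continuous_on UNIV ?o"
    by (intro continuous_intros continuous_on_compose_UNIV[OF f])
  have r_cont: "continuous_on UNIV (?r \<pi>)" if "\<pi> \<in> Ghat" for \<pi>
    by (intro continuous_intros continuous_on_compose_UNIV[OF continuous_character[OF Ghat_rep[OF that]]])
  have r_nonneg: "?r \<pi> p \<ge> 0" if "\<pi> \<in> Ghat" for \<pi> p
    using Re_characteracter_le[OF Ghat_rep[OF that]] by simp
  define K where "K = {p. \<epsilon> \<le> ?o p}"
  have "compact (UNIV :: ('g \<times> 'g) set)"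
    using compact_Times[OF compact_UNIV compact_UNIV] by simp
  moreover have "closed K"
    unfolding K_def by (intro closed_Collect_le continuous_on_const o_cont)
  ultimately have K: "compact K" using compact_Int_closed[of UNIV K] by simp
  have op: "open {p. 0 < ?r \<pi> p}" if "\<pi> \<in> Ghat" for \<pi>
    by (intro open_Collect_less continuous_on_const r_cont that)
  have cover: "K \<subseteq> (\<Union>\<pi>\<in>Ghat. {p. 0 < ?r \<pi> p})"
  proof
    fix p assume "p \<in> K"
    then have "fst p \<noteq> snd p" using \<epsilon> by (auto simp: K_def)
    then have "fst p - snd p \<noteq> 0" by simp
    then obtain \<pi> where "\<pi> \<in> Ghat" "Re (character \<pi> (fst p - snd p)) < rdim \<pi>"
      by (rule Ghat_separates)
    then show "p \<in> (\<Union>\<pi>\<in>Ghat. {p. 0 < ?r \<pi> p})" by auto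
  qed
  obtain S where S: "S \<subseteq> Ghat" "finite S" "K \<subseteq> (\<Union>\<pi>\<in>S. {p. 0 < ?r \<pi> p})"
    by (rule compactE_image[OF K op cover])
  let ?s = "\<lambda>p. \<Sum>\<pi>\<in>S. ?r \<pi> p"
  have s_nonneg: "?s p \<ge> 0" for p using S r_nonneg by (intro sum_nonneg) auto
  obtain B where B: "B > 0" "\<And>x. cmod (f x) \<le> B" using continuous_bounded[OF f] by blast
  have o_le: "?o p \<le> 2 * B" for p
    using norm_triangle_ineq4[of "f (snd p)" "f (fst p)"] B(2)[of "fst p"] B(2)[of "snd p"] by linarith
  \<comment> \<open>\<open>2 * B\<close> bounds every oscillation, so C is \<open>2 * B\<close>
    divided by the minimum of ?s on K when K is nonempty.\<close>
  have "\<exists>C\<ge>0. \<forall>p\<in>K. 2 * B \<le> C * ?s p"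
  proof (cases "K = {}")
    case False
    have "continuous_on K ?s"
      using S(1) by (intro continuous_on_sum continuous_on_subset[OF r_cont subset_UNIV]) auto
    then obtain p0 where p0: "p0 \<in> K" "\<And>p. p \<in> K \<Longrightarrow> ?s p0 \<le> ?s p"
      using continuous_attains_inf[OF K False] by blast
    obtain \<pi> where "\<pi> \<in> S" "0 < ?r \<pi> p0" using p0(1) S(3) by blast
    then have pos: "?s p0 > 0" using S r_nonneg by (intro sum_pos2[of S \<pi>]) auto
    have "2 * B \<le> 2 * B / ?s p0 * ?s p" if "p \<in> K" for p
      using p0(2)[OF that] pos B(1) by (simp add: field_simps)
    then show ?thesis using pos B(1) by (intro exI[of _ "2 * B / ?s p0"]) auto
  qed auto
  then obtain C where C: "C \<ge> 0" "\<And>p. p \<in> K \<Longrightarrow> 2 * B \<le> C * ?s p" by blast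
  have "?o p \<le> \<epsilon> + C * ?s p" for p
  proof (cases "p \<in> K")
    case True
    then show ?thesis using C(2)[OF True] o_le[of p] \<epsilon> by linarith
  next
    case False
    moreover have "C * ?s p \<ge> 0" using C(1) s_nonneg by simp
    ultimately show ?thesis by (simp add: K_def)
  qed
  from this[of "(_, _)"] show thesis using that[OF S(2,1) C(1)] by simp
qed

text \<open>Integrate the oscillation estimate against the density h (x - y). The substitution y
  \<mapsto> x - y then removes x from the right-hand side, so the bound is uniform in x.\<close>

lemma decompress_compress_error:
  fixes f :: "'g \<Rightarrow> complex"
  assumes F: "finite F" "F \<subseteq> Ghat" "F \<noteq> {}" and f: "continuous_on UNIV f"
    and S: "finite S" "S \<subseteq> Ghat"
    and osc: "\<And>x y. cmod (f y - f x) \<le> \<epsilon> + C * (\<Sum>\<pi>\<in>S. rdim \<pi> - Re (character \<pi> (x - y)))"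
  shows "cmod (decompress \<mu> F (compress \<mu> F f) x - f x) \<le> \<epsilon> +
    C * (\<Sum>\<pi>\<in>S. (LINT z|\<mu>. (rdim \<pi> - Re (character \<pi> z)) * (cmod (dirichlet F z))\<^sup>2) / weight F)"
proof -
  note w = weight_pos[OF F]
  define h where "h = (\<lambda>z. (cmod (dirichlet F z))\<^sup>2 / weight F)"
  have h: "continuous_on UNIV h"
    unfolding h_def using w by (intro continuous_intros continuous_dirichlet F) auto
  have h_nonneg: "h z \<ge> 0" for z using w by (simp add: h_def)
  have h_int: "(LINT z|\<mu>. h z) = 1"
    using w by (simp add: h_def integral_dirichlet_square[OF F(1,2)])
  have hx: "continuous_on UNIV (\<lambda>y. h (x - y))"
    by (intro continuous_on_compose_UNIV[OF h] continuous_intros)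
  have cchar: "continuous_on UNIV (character \<pi>)" if "\<pi> \<in> S" for \<pi>
    using continuous_character[OF Ghat_rep] S that by blast
  have ccharx: "continuous_on UNIV (\<lambda>y. character \<pi> (x - y))" if "\<pi> \<in> S" for \<pi>
    by (intro continuous_on_compose_UNIV[OF cchar[OF that]] continuous_intros)
  have "decompress \<mu> F (compress \<mu> F f) x = (LINT y|\<mu>. f y * of_real (h (x - y)))"
    unfolding h_def by (rule decompress_compress[OF F(1,2) f])
  moreover have "f x = (LINT y|\<mu>. f x * of_real (h (x - y)))"
    by (simp add: integral_reflect[OF h] h_int)
  ultimately have "decompress \<mu> F (compress \<mu> F f) x - f x =
      (LINT y|\<mu>. f y * of_real (h (x - y))) - (LINT y|\<mu>. f x * of_real (h (x - y)))"
    by simp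
  also have "\<dots> = (LINT y|\<mu>. f y * of_real (h (x - y)) - f x * of_real (h (x - y)))"
    by (intro Bochner_Integration.integral_diff[symmetric] integrable_continuous continuous_intros f hx)
  also have "\<dots> = (LINT y|\<mu>. (f y - f x) * of_real (h (x - y)))"
    by (simp add: algebra_simps)
  finally have "cmod (decompress \<mu> F (compress \<mu> F f) x - f x) \<le> (LINT y|\<mu>. cmod ((f y - f x) * of_real (h (x - y))))"
    by (simp only: integral_norm_bound)
  also have "\<dots> \<le> (LINT y|\<mu>. (\<epsilon> + C * (\<Sum>\<pi>\<in>S. rdim \<pi> - Re (character \<pi> (x - y)))) * h (x - y))"
    using osc h_nonneg
    by (intro integral_mono integrable_continuous continuous_intros f hx ccharx)
      (auto simp: norm_mult intro!: mult_right_mono)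
  also have "\<dots> = (LINT z|\<mu>. (\<epsilon> + C * (\<Sum>\<pi>\<in>S. rdim \<pi> - Re (character \<pi> z))) * h z)"
    by (rule integral_reflect[of "\<lambda>z. (\<epsilon> + C * (\<Sum>\<pi>\<in>S. rdim \<pi> - Re (character \<pi> z))) * h z"])
      (intro continuous_intros h cchar)
  also have "\<dots> = (LINT z|\<mu>. \<epsilon> * h z + (\<Sum>\<pi>\<in>S. C * ((rdim \<pi> - Re (character \<pi> z)) * h z)))"
    by (simp add: algebra_simps sum_distrib_left sum_distrib_right)
  also have "\<dots> = (LINT z|\<mu>. \<epsilon> * h z) + (LINT z|\<mu>. (\<Sum>\<pi>\<in>S. C * ((rdim \<pi> - Re (character \<pi> z)) * h z)))"
    by (intro Bochner_Integration.integral_add integrable_continuous continuous_intros h cchar)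
  also have "(LINT z|\<mu>. (\<Sum>\<pi>\<in>S. C * ((rdim \<pi> - Re (character \<pi> z)) * h z))) =
      (\<Sum>\<pi>\<in>S. LINT z|\<mu>. C * ((rdim \<pi> - Re (character \<pi> z)) * h z))"
    by (intro Bochner_Integration.integral_sum integrable_continuous continuous_intros h cchar)
  also have "\<dots> = C * (\<Sum>\<pi>\<in>S. (LINT z|\<mu>. (rdim \<pi> - Re (character \<pi> z)) * (cmod (dirichlet F z))\<^sup>2) / weight F)"
    by (simp add: h_def sum_distrib_left)
  finally show ?thesis by (simp add: h_int)
qed

lemma folner_defect_tendsto:
  assumes F: "folner_seq Ghat F" and \<pi>: "\<pi> \<in> Ghat" and \<epsilon>: "\<epsilon> > 0"
  shows "\<forall>\<^sub>F n in sequentially.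
    (LINT z|\<mu>. (rdim \<pi> - Re (character \<pi> z)) * (cmod (dirichlet (F n) z))\<^sup>2) / weight (F n) < \<epsilon>"
proof -
  let ?A = "\<lambda>n. \<Sum>\<sigma>\<in>F n. \<Sum>\<^sub>\<infinity>\<nu>\<in>Ghat - F n. folner_term \<pi> \<sigma> \<nu>"
  let ?B = "\<lambda>n. \<Sum>\<^sub>\<infinity>\<sigma>\<in>Ghat - F n. \<Sum>\<nu>\<in>F n. folner_term \<pi> \<sigma> \<nu>"
  have d: "rdim \<pi> > 0" by (rule Ghat_dim_pos[OF \<pi>])
  have Fn: "finite (F n)" "F n \<subseteq> Ghat" "F n \<noteq> {}" for n
    using F by (auto simp: folner_seq_def)
  note w = weight_pos[OF Fn]
  have "(\<lambda>n. (?A n + ?B n) / ennreal (weight (F n))) \<longlonglongrightarrow> 0"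
    using F \<pi> unfolding folner_seq_def by blast
  \<comment> \<open>The defect integral carries the factor rdim \<pi>, which is divided out of
    \<epsilon> in advance.\<close>
  moreover have "(0 :: ennreal) < ennreal (\<epsilon> / rdim \<pi>)" using \<epsilon> d by simp
  ultimately have "\<forall>\<^sub>F n in sequentially. (?A n + ?B n) / ennreal (weight (F n)) < ennreal (\<epsilon> / rdim \<pi>)"
    by (rule order_tendstoD(2))
  then show ?thesis
  proof eventually_elim
    case (elim n)
    obtain t :: real where t: "t \<ge> 0" "ennreal t \<le> ?B n"
      "(LINT z|\<mu>. (rdim \<pi> - Re (character \<pi> z)) * (cmod (dirichlet (F n) z))\<^sup>2) = rdim \<pi> * t"
      by (rule dirichlet_defect[OF Fn(1)[of n] Fn(2)[of n] \<pi>]) (rule that; assumption)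
    have "ennreal (t / weight (F n)) = ennreal t / ennreal (weight (F n))"
      using t(1) w[of n] by (simp add: divide_ennreal)
    also have "\<dots> \<le> (?A n + ?B n) / ennreal (weight (F n))"
      using t(2) by (intro divide_right_mono_ennreal) (simp add: add_increasing)
    also note elim
    finally have "t / weight (F n) < \<epsilon> / rdim \<pi>"
      using t(1) w[of n] by (simp add: ennreal_less_iff)
    then have "rdim \<pi> * t / weight (F n) < \<epsilon>" using d by (simp add: field_simps)
    then show ?case by (simp only: t(3))
  qed
qed

end

theorem theorem5p4:
  fixes \<mu> :: "'g::{topological_group_add, t2_space, second_countable_topology} measure"
    and Ghat :: "('g \<Rightarrow> complex mat) set"
    and F :: "nat \<Rightarrow> ('g \<Rightarrow> complex mat) set"
    and f :: "'g \<Rightarrow> complex"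
  assumes "compact (UNIV :: 'g set)"
    and "haar_prob \<mu>"
    and "dual_transversal Ghat"
    and "folner_seq Ghat F"
    and "continuous_on UNIV f"
  shows "(\<lambda>n. SUP x. cmod (decompress \<mu> (F n) (compress \<mu> (F n) f) x - f x)) \<longlonglongrightarrow> 0"
proof -
  interpret compact_haar_dual \<mu> Ghat
    by unfold_locales (use assms in auto)
  let ?e = "\<lambda>n x. cmod (decompress \<mu> (F n) (compress \<mu> (F n) f) x - f x)"
  have Fn: "finite (F n)" "F n \<subseteq> Ghat" "F n \<noteq> {}" for n
    using assms(4) by (auto simp: folner_seq_def)
  show ?thesis
  proof (rule tendstoI)
    fix e :: real assume e: "e > 0"
    then have e3: "e / 3 > 0" by simp
    obtain S C where S: "finite S" "S \<subseteq> Ghat" and C: "C \<ge> 0"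
      and osc: "\<And>x y. cmod (f y - f x) \<le> e / 3 + C * (\<Sum>\<pi>\<in>S. rdim \<pi> - Re (character \<pi> (x - y)))"
      by (rule oscillation_estimate[OF assms(5) e3]) (rule that; assumption)
    \<comment> \<open>The summand 1 keeps D positive when C or S is trivial, so that \<delta> is
      well defined and positive.\<close>
    define D where "D = C * card S + 1"
    have D: "D > 0" using C by (simp add: D_def add_nonneg_pos)
    define \<delta> where "\<delta> = e / 3 / D"
    have \<delta>_pos: "\<delta> > 0" using e3 D by (simp add: \<delta>_def)
    have "C * (card S * \<delta>) + \<delta> = D * \<delta>" by (simp add: D_def algebra_simps)
    also have "\<dots> = e / 3" using D by (simp add: \<delta>_def)
    finally have \<delta>: "\<delta> > 0" "C * (card S * \<delta>) \<le> e / 3" using \<delta>_pos by auto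
    have "\<forall>\<^sub>F n in sequentially. \<forall>\<pi>\<in>S.
        (LINT z|\<mu>. (rdim \<pi> - Re (character \<pi> z)) * (cmod (dirichlet (F n) z))\<^sup>2) / weight (F n) < \<delta>"
      using S folner_defect_tendsto[OF assms(4) _ \<delta>(1)] by (intro eventually_ball_finite) auto
    then show "\<forall>\<^sub>F n in sequentially. dist (SUP x. ?e n x) 0 < e"
    proof eventually_elim
      case (elim n)
      have "?e n x \<le> 2 * e / 3" for x
      proof -
        have "?e n x \<le> e / 3 + C * (\<Sum>\<pi>\<in>S. (LINT z|\<mu>. (rdim \<pi> - Re (character \<pi> z)) *
            (cmod (dirichlet (F n) z))\<^sup>2) / weight (F n))"
          by (rule decompress_compress_error[OF Fn assms(5) S osc])
        also have "\<dots> \<le> e / 3 + C * (\<Sum>\<pi>\<in>S. \<delta>)"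
          using elim C by (intro add_left_mono mult_left_mono sum_mono) (auto intro: less_imp_le)
        also have "\<dots> \<le> 2 * e / 3" using \<delta>(2) by simp
        finally show ?thesis .
      qed
      note bound = this
      have "(SUP x. ?e n x) \<le> 2 * e / 3" by (rule cSUP_least[OF _ bound]) simp
      \<comment> \<open>The supremum of reals is meaningful only for a set that is bounded above;
        \<open>bound\<close> provides this.\<close>
      moreover have "0 \<le> (SUP x. ?e n x)"
        by (rule cSUP_upper2[OF bdd_aboveI2[OF bound] UNIV_I[of 0]]) simp
      ultimately show ?case using e by simp
    qed
  qed
qed

end
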